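(* Let $$1\rightarrow K\stackrel{i}{\rightarrow} G\stackrel{p}{\rightarrow} Q\rightarrow 1$$ be a short exact sequence of finitely generated groups such that $K$ is non-elementary and strongly hyperbolic relative to a proper subgroup $K_1$. Suppose that $G$ preserves cusps, i.e. for every $g\in G$ there exists $k\in K$ such that $gK_1g^{-1}=kK_1k^{-1}$. Then there exist constants $R\geq 1$, $\epsilon\geq 0$ and an $(R,\epsilon)$ quasi-isometric section $s\colon Q\to G$, that is, a map $s\colon Q\to G$ with $p\circ s=\mathrm{id}_Q$ and $$\frac{1}{R}d_Q(q,q')-\epsilon \leq d_G(s(q),s(q'))\leq R\,d_Q(q,q')+\epsilon \quad\text{for all } q,q'\in Q.$$
   Context: $d_G$ and $d_Q$ denote word metrics with respect to finite generating sets. $K$ is identified with the normal subgroup $i(K)$ of $G$. Non-elementary means that $K$ is neither virtually cyclic nor equal to $K_1$. Relative hyperbolicity (Farb). Let $G$ be a finitely generated group, $H$ a finitely generated subgroup, and $\Gamma_G$ the Cayley graph of $G$ with respect to a finite generating set. The coned-off Cayley graph $\widehat{\Gamma}_G$ is obtained from $\Gamma_G$ by adding, for each left coset $gH$, a new vertex $v(gH)$ and an edge of length $1/2$ from each element of $gH$ to $v(gH)$. $G$ is weakly hyperbolic relative to $H$ if $\widehat{\Gamma}_G$ is Gromov hyperbolic. A path penetrates $gH$ if it passes through $v(gH)$. An electric $P$-quasigeodesic is a $P$-quasigeodesic in $\widehat{\Gamma}_G$; it is without backtracking if it does not return to any left coset of $H$ after leaving it. The pair $(G,H)$ satisfies bounded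 coset penetration if for every $P\geq 1$ there is a constant $D=D(P)$ such that for any two electric $P$-quasigeodesics $\alpha,\beta$ without backtracking with the same endpoints: (1) if $\alpha$ penetrates $gH$ but $\beta$ does not, then $\alpha$ travels a $\Gamma_G$-distance of at most $D$ in $gH$; (2) if both penetrate $gH$, then the vertices at which $\alpha$ and $\beta$ first enter $gH$ are at $\Gamma_G$-distance at most $D$, and similarly for the last exit vertices. $G$ is strongly hyperbolic relative to $H$ if it is weakly hyperbolic relative to $H$ and $(G,H)$ satisfies bounded coset penetration. *)

theory Defs
  imports Complex_Main "HOL-Algebra.Algebra" "HOL-Algebra.Left_Coset"
begin

section \<open>Finite generating sets and word metrics\<close>

definition finite_generating_set :: "('a, 'm) monoid_scheme \<Rightarrow> 'a set \<Rightarrow> bool" where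
  "finite_generating_set G S \<longleftrightarrow> finite S \<and> S \<subseteq> carrier G \<and> generate G S = carrier G"

definition finitely_generated :: "('a, 'm) monoid_scheme \<Rightarrow> bool" where
  "finitely_generated G \<longleftrightarrow> (\<exists>S. finite_generating_set G S)"

definition word_length :: "('a, 'm) monoid_scheme \<Rightarrow> 'a set \<Rightarrow> 'a \<Rightarrow> nat" where
  "word_length G S g =
     (LEAST n. \<exists>ws. length ws = n \<and> set ws \<subseteq> S \<union> m_inv G ` S
                   \<and> foldr (\<lambda>x y. x \<otimes>\<^bsub>G\<^esub> y) ws \<one>\<^bsub>G\<^esub> = g)"

definition word_dist :: "('a, 'm) monoid_scheme \<Rightarrow> 'a set \<Rightarrow> 'a \<Rightarrow> 'a \<Rightarrow> real" where
  "word_dist G S x y = real (word_length G S (inv\<^bsub>G\<^esub> x \<otimes>\<^bsub>G\<^esub> y))"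

definition virtually_cyclic :: "('a, 'm) monoid_scheme \<Rightarrow> bool" where
  "virtually_cyclic G \<longleftrightarrow> (\<exists>c\<in>carrier G. finite (rcosets\<^bsub>G\<^esub> (generate G {c})))"


section \<open>Gromov hyperbolicity\<close>

definition gromov_product :: "('p \<Rightarrow> 'p \<Rightarrow> real) \<Rightarrow> 'p \<Rightarrow> 'p \<Rightarrow> 'p \<Rightarrow> real" where
  "gromov_product d e x y = (d x e + d y e - d x y) / 2"

definition gromov_hyperbolic :: "'p set \<Rightarrow> ('p \<Rightarrow> 'p \<Rightarrow> real) \<Rightarrow> bool" where
  "gromov_hyperbolic M d \<longleftrightarrow>
     (\<exists>\<delta>\<ge>0. \<forall>e\<in>M. \<forall>x\<in>M. \<forall>y\<in>M. \<forall>z\<in>M.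
        gromov_product d e x z \<ge> min (gromov_product d e x y) (gromov_product d e y z) - \<delta>)"


section \<open>Metric graphs\<close>

text \<open>
  A metric graph is given by a vertex set \<open>V\<close>, a symmetric irreflexive edge relation \<open>E\<close> and an
  edge length function \<open>w\<close>, symmetric and positive on \<open>E\<close>.
\<close>

definition is_walk :: "'v set \<Rightarrow> ('v \<times> 'v) set \<Rightarrow> 'v list \<Rightarrow> bool" where
  "is_walk V E vs \<longleftrightarrow> vs \<noteq> [] \<and> set vs \<subseteq> V \<and> successively (\<lambda>u v. (u, v) \<in> E) vs"

definition walk_length :: "('v \<Rightarrow> 'v \<Rightarrow> real) \<Rightarrow> 'v list \<Rightarrow> real" where
  "walk_length w vs = (\<Sum>i<length vs - 1. w (vs ! i) (vs ! Suc i))"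

text \<open>Path metric on the vertices (meaningful when the graph is connected).\<close>

definition vertex_dist ::
    "'v set \<Rightarrow> ('v \<times> 'v) set \<Rightarrow> ('v \<Rightarrow> 'v \<Rightarrow> real) \<Rightarrow> 'v \<Rightarrow> 'v \<Rightarrow> real" where
  "vertex_dist V E w u v =
     Inf (walk_length w ` {vs. is_walk V E vs \<and> hd vs = u \<and> last vs = v})"

text \<open>
  Points of the geometric realization: \<open>(u, v, t)\<close> is the point of the edge from \<open>u\<close> to \<open>v\<close> at
  distance \<open>t\<close> from \<open>u\<close>. A point may have several names, for instance \<open>(v, u, w u v - t)\<close>; these
  are at distance \<open>0\<close> from each other, which is harmless for Gromov's inequality.
\<close>

definition graph_points :: "('v \<times> 'v) set \<Rightarrow> ('v \<Rightarrow> 'v \<Rightarrow> real) \<Rightarrow> ('v \<times> 'v \<times> real) set" where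
  "graph_points E w = {(u, v, t). (u, v) \<in> E \<and> 0 \<le> t \<and> t \<le> w u v}"

text \<open>
  A shortest path between two points leaves and enters their edges through end vertices, or
  stays inside a common edge.
\<close>

definition point_dist ::
    "'v set \<Rightarrow> ('v \<times> 'v) set \<Rightarrow> ('v \<Rightarrow> 'v \<Rightarrow> real)
      \<Rightarrow> 'v \<times> 'v \<times> real \<Rightarrow> 'v \<times> 'v \<times> real \<Rightarrow> real" where
  "point_dist V E w = (\<lambda>(u, v, t) (u', v', t').
     Min ({t + vertex_dist V E w u u' + t',
           t + vertex_dist V E w u v' + (w u' v' - t'),
           (w u v - t) + vertex_dist V E w v u' + t',
           (w u v - t) + vertex_dist V E w v v' + (w u' v' - t')}
          \<union> (if u' = u \<and> v' = v then {\<bar>t - t'\<bar>} else {})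
          \<union> (if u' = v \<and> v' = u then {\<bar>t - (w u v - t')\<bar>} else {})))"


section \<open>The coned-off Cayley graph\<close>

text \<open>\<open>Cone C\<close> is the new vertex attached to the left coset \<open>C\<close>.\<close>

datatype 'a cvertex = Elt 'a | Cone "'a set"

definition coned_vertices :: "('a, 'm) monoid_scheme \<Rightarrow> 'a set \<Rightarrow> 'a cvertex set" where
  "coned_vertices G H = Elt ` carrier G \<union> Cone ` (lcosets\<^bsub>G\<^esub> H)"

definition cayley_edges :: "('a, 'm) monoid_scheme \<Rightarrow> 'a set \<Rightarrow> ('a \<times> 'a) set" where
  "cayley_edges G S =
     {(x, y). x \<in> carrier G \<and> y \<in> carrier G \<and> x \<noteq> y
              \<and> (\<exists>s\<in>S. y = x \<otimes>\<^bsub>G\<^esub> s \<or> x = y \<otimes>\<^bsub>G\<^esub> s)}"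

definition coned_edges ::
    "('a, 'm) monoid_scheme \<Rightarrow> 'a set \<Rightarrow> 'a set \<Rightarrow> ('a cvertex \<times> 'a cvertex) set" where
  "coned_edges G S H =
     {(Elt x, Elt y) | x y. (x, y) \<in> cayley_edges G S}
     \<union> {(Elt x, Cone C) | x C. C \<in> lcosets\<^bsub>G\<^esub> H \<and> x \<in> C}
     \<union> {(Cone C, Elt x) | x C. C \<in> lcosets\<^bsub>G\<^esub> H \<and> x \<in> C}"

fun coned_weight :: "'a cvertex \<Rightarrow> 'a cvertex \<Rightarrow> real" where
  "coned_weight (Elt x) (Elt y) = 1"
| "coned_weight _ _ = 1 / 2"

definition weakly_hyperbolic_rel ::
    "('a, 'm) monoid_scheme \<Rightarrow> 'a set \<Rightarrow> 'a set \<Rightarrow> bool" where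
  "weakly_hyperbolic_rel G S H \<longleftrightarrow>
     gromov_hyperbolic (graph_points (coned_edges G S H) coned_weight)
       (point_dist (coned_vertices G H) (coned_edges G S H) coned_weight)"


section \<open>Electric quasigeodesics and bounded coset penetration\<close>

text \<open>
  Paths are edge paths between vertices of the Cayley graph. A \<open>P\<close>-quasigeodesic is a path
  whose arc length parametrization is a \<open>(P, P)\<close>-quasi-isometric embedding; the subpath from the
  \<open>i\<close>-th to the \<open>j\<close>-th vertex is \<open>drop i (take (Suc j) vs)\<close>.
\<close>

definition electric_quasigeodesic ::
    "('a, 'm) monoid_scheme \<Rightarrow> 'a set \<Rightarrow> 'a set \<Rightarrow> real \<Rightarrow> 'a cvertex list \<Rightarrow> bool" where
  "electric_quasigeodesic G S H P vs \<longleftrightarrow>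
     is_walk (coned_vertices G H) (coned_edges G S H) vs
     \<and> hd vs \<in> Elt ` carrier G \<and> last vs \<in> Elt ` carrier G
     \<and> (\<forall>i j. i \<le> j \<and> j < length vs \<longrightarrow>
          (let L = walk_length coned_weight (drop i (take (Suc j) vs));
               d = vertex_dist (coned_vertices G H) (coned_edges G S H) coned_weight
                     (vs ! i) (vs ! j)
           in 1 / P * L - P \<le> d \<and> d \<le> P * L + P))"

definition penetrates :: "'a cvertex list \<Rightarrow> 'a set \<Rightarrow> bool" where
  "penetrates vs C \<longleftrightarrow> Cone C \<in> set vs"

text \<open>A path is in the coset \<open>C\<close> when it is at an element of \<open>C\<close> or at the cone vertex of \<open>C\<close>.\<close>

definition without_backtracking ::
    "('a, 'm) monoid_scheme \<Rightarrow> 'a set \<Rightarrow> 'a cvertex list \<Rightarrow> bool" where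
  "without_backtracking G H vs \<longleftrightarrow>
     (\<forall>C\<in>lcosets\<^bsub>G\<^esub> H. \<forall>i j k. i \<le> j \<and> j \<le> k \<and> k < length vs
        \<and> vs ! i \<in> insert (Cone C) (Elt ` C) \<and> vs ! k \<in> insert (Cone C) (Elt ` C)
        \<longrightarrow> vs ! j \<in> insert (Cone C) (Elt ` C))"

definition elements_in_coset :: "'a set \<Rightarrow> 'a cvertex list \<Rightarrow> 'a list" where
  "elements_in_coset C vs = [x. Elt x \<leftarrow> vs, x \<in> C]"

text \<open>
  Used only for paths which penetrate \<open>C\<close> and have their endpoints in the Cayley graph, so that
  \<open>elements_in_coset\<close> is not empty.
\<close>

definition entry_vertex :: "'a set \<Rightarrow> 'a cvertex list \<Rightarrow> 'a" where
  "entry_vertex C vs = hd (elements_in_coset C vs)"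

definition exit_vertex :: "'a set \<Rightarrow> 'a cvertex list \<Rightarrow> 'a" where
  "exit_vertex C vs = last (elements_in_coset C vs)"

definition bounded_coset_penetration ::
    "('a, 'm) monoid_scheme \<Rightarrow> 'a set \<Rightarrow> 'a set \<Rightarrow> bool" where
  "bounded_coset_penetration G S H \<longleftrightarrow>
     (\<forall>P\<ge>1. \<exists>D. \<forall>\<alpha> \<beta>.
        electric_quasigeodesic G S H P \<alpha> \<and> without_backtracking G H \<alpha>
        \<and> electric_quasigeodesic G S H P \<beta> \<and> without_backtracking G H \<beta>
        \<and> hd \<alpha> = hd \<beta> \<and> last \<alpha> = last \<beta> \<longrightarrow>
        (\<forall>C\<in>lcosets\<^bsub>G\<^esub> H.
           (penetrates \<alpha> C \<and> \<not> penetrates \<beta> C \<longrightarrow>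
              word_dist G S (entry_vertex C \<alpha>) (exit_vertex C \<alpha>) \<le> D)
           \<and> (penetrates \<alpha> C \<and> penetrates \<beta> C \<longrightarrow>
              word_dist G S (entry_vertex C \<alpha>) (entry_vertex C \<beta>) \<le> D
              \<and> word_dist G S (exit_vertex C \<alpha>) (exit_vertex C \<beta>) \<le> D)))"

definition strongly_hyperbolic_rel :: "('a, 'm) monoid_scheme \<Rightarrow> 'a set \<Rightarrow> bool" where
  "strongly_hyperbolic_rel G H \<longleftrightarrow>
     group G \<and> subgroup H G \<and> finitely_generated (G\<lparr>carrier := H\<rparr>)
     \<and> (\<exists>S. finite_generating_set G S
            \<and> weakly_hyperbolic_rel G S H \<and> bounded_coset_penetration G S H)"


section \<open>Group extensions\<close>

text \<open>
  The library's exact sequences require all groups to have the same element type, so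
  exactness is spelled out here.
\<close>

definition group_extension ::
    "('k, 'a) monoid_scheme \<Rightarrow> ('k \<Rightarrow> 'g) \<Rightarrow> ('g, 'b) monoid_scheme \<Rightarrow> ('g \<Rightarrow> 'q)
      \<Rightarrow> ('q, 'c) monoid_scheme \<Rightarrow> bool" where
  "group_extension K i G p Q \<longleftrightarrow>
     group K \<and> group G \<and> group Q \<and> i \<in> mon K G \<and> p \<in> epi G Q \<and> i ` carrier K = kernel G Q p"

definition non_elementary :: "('a, 'm) monoid_scheme \<Rightarrow> 'a set \<Rightarrow> bool" where
  "non_elementary K K1 \<longleftrightarrow> \<not> virtually_cyclic K \<and> carrier K \<noteq> K1"

definition conjugate_subset :: "('a, 'm) monoid_scheme \<Rightarrow> 'a \<Rightarrow> 'a set \<Rightarrow> 'a set" where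
  "conjugate_subset G g A = (\<lambda>x. g \<otimes>\<^bsub>G\<^esub> x \<otimes>\<^bsub>G\<^esub> inv\<^bsub>G\<^esub> g) ` A"

definition preserves_cusps ::
    "('k, 'a) monoid_scheme \<Rightarrow> 'k set \<Rightarrow> ('k \<Rightarrow> 'g) \<Rightarrow> ('g, 'b) monoid_scheme \<Rightarrow> bool" where
  "preserves_cusps K K1 i G \<longleftrightarrow>
     (\<forall>g\<in>carrier G. \<exists>k\<in>carrier K.
        conjugate_subset G g (i ` K1) = conjugate_subset G (i k) (i ` K1))"

end

theory Submission
  imports Defs
begin

text \<open>
  Let \<open>G\<close> act on \<open>K\<close> by conjugation. A map \<open>m\<close> from \<open>G\<close> to \<open>K\<close> which is equivariant up to a uniform
  error under left multiplication by \<open>K\<close>, and up to an error depending on \<open>t\<close> under each \<open>t\<close> in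
  \<open>G\<close>, yields a quasi-isometric section: choose \<open>s q\<close> over \<open>q\<close> so that \<open>m ((s q)\<^sup>-\<^sup>1)\<close> has bounded length;
  then \<open>(s q)\<^sup>-\<^sup>1 (s q')\<close> lies in a finite set whenever \<open>q\<close> and \<open>q'\<close> are adjacent.

  If \<open>K1\<close> is finite, then \<open>K\<close> is a hyperbolic group which is not virtually cyclic, and \<open>m g\<close> is the
  coarse barycentre of the image under \<open>g\<close> of three distinct points at infinity (Mosher's
  argument). If \<open>K1\<close> is infinite, then it is self-normalizing by bounded coset penetration, \<open>G\<close> acts
  on the left cosets of \<open>K1\<close> since it preserves cusps, and \<open>m g\<close> is the coarsely well-defined
  point at which electric geodesics from \<open>g K1\<close> to \<open>g B\<close> leave \<open>g K1\<close>, for a fixed coset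
  \<open>B \<noteq> K1\<close>.
\<close>

section \<open>Word metrics\<close>

text \<open>The generating set \<open>S\<close> of a marked group may be infinite. This admits
  \<open>S \<union> H\<close>, whose word metric is the electric metric on group elements, so that
  the same lemmas serve both metrics. The error of \<open>m\<close> under left multiplication by
  \<open>K\<close> has to be uniform, and this shapes both constructions. Conjugation by
  \<open>i k\<close> differs from left multiplication by \<open>k\<close> in a right factor
  \<open>k\<^sup>-\<^sup>1\<close> of unbounded length. Points at infinity do not feel bounded
  displacements, whatever their size. In the coset case an element of \<open>G\<close> determines
  its \<open>K\<close>-part only up to \<open>K1\<close>, and a right factor from \<open>K1\<close>
  disappears in a left coset of \<open>K1\<close>. That ambiguity is no larger than
  \<open>K1\<close> because \<open>K1\<close> is self-normalizing, which is where its infiniteness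
  enters: a bounded \<open>K1\<close>-invariant set is a contradiction only then. If
  \<open>K1\<close> is finite, \<open>S \<union> K1\<close> is a finite generating set, and the
  electric metric is an honest word metric. Inverses occur in the section because \<open>m\<close>
  controls multiplication on the left, while the word metric of \<open>G\<close> only sees
  \<open>(s q)\<^sup>-\<^sup>1 (s q')\<close>.\<close>

locale marked_group = group G for G (structure) +
  fixes S :: "'a set"
  assumes S_carrier: "S \<subseteq> carrier G" and S_generates: "generate G S = carrier G"
begin

abbreviation letters :: "'a set" where
  "letters \<equiv> S \<union> m_inv G ` S"

abbreviation word_prod :: "'a list \<Rightarrow> 'a" where
  "word_prod ws \<equiv> foldr (\<lambda>x y. x \<otimes> y) ws \<one>"

abbreviation len :: "'a \<Rightarrow> nat" where
  "len \<equiv> word_length G S"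

abbreviation wdist :: "'a \<Rightarrow> 'a \<Rightarrow> real" where
  "wdist \<equiv> word_dist G S"

lemma letters_carrier: "letters \<subseteq> carrier G"
  using S_carrier by auto

lemma letters_inv: "a \<in> letters \<Longrightarrow> inv a \<in> letters"
  using S_carrier by (auto simp: subset_iff)

lemma word_prod_closed: "set ws \<subseteq> letters \<Longrightarrow> word_prod ws \<in> carrier G"
  using letters_carrier by (induction ws) (simp_all add: subset_eq)

lemma word_prod_append:
  "set us \<subseteq> letters \<Longrightarrow> set ws \<subseteq> letters \<Longrightarrow>
    word_prod (us @ ws) = word_prod us \<otimes> word_prod ws"
proof (induction us)
  case Nil
  then show ?case using word_prod_closed by simp
next
  case (Cons a us)
  then have "a \<in> carrier G" using letters_carrier by auto
  then show ?case using Cons word_prod_closed by (simp add: m_assoc)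
qed

lemma word_exists: "g \<in> carrier G \<Longrightarrow> \<exists>ws. set ws \<subseteq> letters \<and> word_prod ws = g"
proof -
  assume "g \<in> carrier G"
  then have "g \<in> generate G S" using S_generates by simp
  then show ?thesis
  proof (induction rule: generate.induct)
    case one
    then show ?case by (intro exI[of _ "[]"]) simp
  next
    case (incl h)
    then show ?case using S_carrier by (intro exI[of _ "[h]"]) auto
  next
    case (inv h)
    then show ?case using S_carrier by (intro exI[of _ "[inv h]"]) auto
  next
    case (eng h1 h2)
    then obtain us ws where "set us \<subseteq> letters" "word_prod us = h1"
      "set ws \<subseteq> letters" "word_prod ws = h2" by auto
    then show ?case
      using word_prod_append[of us ws] by (intro exI[of _ "us @ ws"]) (simp del: foldr_append)
  qed
qed

lemma len_word_prod_le:
  assumes "set ws \<subseteq> letters"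
  shows "len (word_prod ws) \<le> length ws"
  unfolding word_length_def by (rule Least_le) (use assms in auto)

lemma len_word:
  assumes "g \<in> carrier G"
  obtains ws where "length ws = len g" "set ws \<subseteq> letters" "word_prod ws = g"
proof -
  obtain us where "set us \<subseteq> letters" "word_prod us = g"
    using word_exists[OF assms] by auto
  then have "\<exists>ws. length ws = length us \<and> set ws \<subseteq> letters \<and> word_prod ws = g" by auto
  from LeastI[of "\<lambda>n. \<exists>ws. length ws = n \<and> set ws \<subseteq> letters \<and> word_prod ws = g", OF this]
  show ?thesis using that unfolding word_length_def[symmetric] by blast
qed

lemma len_one [simp]: "len \<one> = 0"
  using len_word_prod_le[of "[]"] by simp

lemma len_mult:
  assumes "g \<in> carrier G" "h \<in> carrier G"
  shows "len (g \<otimes> h) \<le> len g + len h"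
proof -
  obtain us where us: "length us = len g" "set us \<subseteq> letters" "word_prod us = g"
    using len_word[OF assms(1)] .
  obtain vs where vs: "length vs = len h" "set vs \<subseteq> letters" "word_prod vs = h"
    using len_word[OF assms(2)] .
  show ?thesis
    using len_word_prod_le[of "us @ vs"] word_prod_append[of us vs] us vs
    by (simp del: foldr_append)
qed

lemma len_letter:
  assumes "a \<in> letters"
  shows "len a \<le> 1"
  using len_word_prod_le[of "[a]"] assms letters_carrier by auto

lemma len_le_1_letter:
  assumes "g \<in> carrier G" "len g \<le> 1"
  shows "g = \<one> \<or> g \<in> letters"
proof -
  obtain us where us: "length us = len g" "set us \<subseteq> letters" "word_prod us = g"
    using len_word[OF assms(1)] .
  show ?thesis
  proof (cases us)
    case Nil
    then show ?thesis using us by simp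
  next
    case (Cons a vs)
    then have "vs = []" using us(1) assms(2) by (cases vs) auto
    then show ?thesis using us Cons letters_carrier by auto
  qed
qed

lemma len_inv_le:
  assumes "g \<in> carrier G"
  shows "len (inv g) \<le> len g"
proof -
  have "set us \<subseteq> letters \<Longrightarrow> len (inv (word_prod us)) \<le> length us" for us
  proof (induction us)
    case (Cons a us)
    then have a: "a \<in> letters" "a \<in> carrier G" "word_prod us \<in> carrier G"
      using letters_carrier word_prod_closed by auto
    have "len (inv (word_prod us) \<otimes> inv a) \<le> length us + 1"
      using Cons a len_mult[of "inv (word_prod us)" "inv a"] len_letter[OF letters_inv[OF a(1)]]
      by auto
    then show ?case using a by (simp add: inv_mult_group)
  qed simp
  then show ?thesis using len_word[OF assms] by metis
qed

lemma len_inv: "g \<in> carrier G \<Longrightarrow> len (inv g) = len g"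
  using len_inv_le[of g] len_inv_le[of "inv g"] by simp

text \<open>The points are the values of the prefixes of a shortest word. Were a middle piece
  shorter than its number of letters, the three pieces together would make \<open>g\<close> shorter
  than \<open>len g\<close>.\<close>

lemma len_geodesic:
  assumes "g \<in> carrier G"
  obtains c where "c 0 = \<one>" "c (len g) = g" "\<And>k. c k \<in> carrier G"
    "\<And>i j. i \<le> j \<Longrightarrow> j \<le> len g \<Longrightarrow> len (inv (c i) \<otimes> c j) = j - i"
proof -
  obtain us where us: "length us = len g" "set us \<subseteq> letters" "word_prod us = g"
    using len_word[OF assms] .
  define c where "c k = word_prod (take k us)" for k
  have sub: "set (take k us) \<subseteq> letters" "set (drop k us) \<subseteq> letters" for k
    using us(2) set_take_subset[of k us] set_drop_subset[of k us] by blast+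
  have cc: "c k \<in> carrier G" for k
    unfolding c_def using sub word_prod_closed by blast
  have le: "len (inv (c i) \<otimes> c j) \<le> j - i" if ij: "i \<le> j" "j \<le> len g" for i j
  proof -
    define v where "v = drop i (take j us)"
    have "take j us = take i us @ v"
      unfolding v_def using ij by (metis append_take_drop_id min.absorb1 take_take)
    moreover have v: "set v \<subseteq> letters"
      unfolding v_def using sub(1)[of j] set_drop_subset[of i "take j us"] by blast
    ultimately have "c j = c i \<otimes> word_prod v"
      unfolding c_def using word_prod_append sub by metis
    then have "inv (c i) \<otimes> c j = word_prod v"
      using cc word_prod_closed[OF v] by (simp add: m_assoc[symmetric])
    moreover have "length v = j - i" unfolding v_def using ij us by simp
    ultimately show ?thesis using len_word_prod_le[OF v] by simp
  qed
  have c0: "c 0 = \<one>" and cn: "c (len g) = g" unfolding c_def using us by auto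
  have "len (inv (c i) \<otimes> c j) = j - i" if ij: "i \<le> j" "j \<le> len g" for i j
  proof -
    have "g = c i \<otimes> (inv (c i) \<otimes> c j) \<otimes> (inv (c j) \<otimes> g)"
      using cc assms by (simp add: m_assoc[symmetric])
    then have "len g \<le> len (c i) + len (inv (c i) \<otimes> c j) + len (inv (c j) \<otimes> g)"
      using len_mult[of "c i \<otimes> (inv (c i) \<otimes> c j)" "inv (c j) \<otimes> g"]
        len_mult[of "c i" "inv (c i) \<otimes> c j"] cc assms by fastforce
    moreover have "len (c i) \<le> i" using le[of 0 i] ij c0 cc by simp
    moreover have "len (inv (c j) \<otimes> g) \<le> len g - j" using le[of j "len g"] ij cn by simp
    ultimately show ?thesis using le[OF ij] ij by linarith
  qed
  then show ?thesis using that[of c] c0 cn cc by blast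
qed

lemma finite_len_ball:
  assumes "finite S"
  shows "finite {g \<in> carrier G. len g \<le> n}"
proof (rule finite_subset)
  show "{g \<in> carrier G. len g \<le> n} \<subseteq> word_prod ` {ws. set ws \<subseteq> letters \<and> length ws \<le> n}"
  proof
    fix g assume g: "g \<in> {g \<in> carrier G. len g \<le> n}"
    then have "g \<in> carrier G" by simp
    then obtain ws where ws: "length ws = len g" "set ws \<subseteq> letters" "word_prod ws = g"
      by (rule len_word)
    then have "ws \<in> {ws. set ws \<subseteq> letters \<and> length ws \<le> n}" using g by simp
    then show "g \<in> word_prod ` {ws. set ws \<subseteq> letters \<and> length ws \<le> n}"
      unfolding ws(3)[symmetric] by (rule imageI)
  qed
  show "finite (word_prod ` {ws. set ws \<subseteq> letters \<and> length ws \<le> n})"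
    using assms by (intro finite_imageI finite_lists_length_le) simp
qed

section \<open>The left-invariant word metric and its geodesics\<close>

lemma wdist_nonneg: "0 \<le> wdist x y"
  by (simp add: word_dist_def)

lemma wdist_self [simp]: "x \<in> carrier G \<Longrightarrow> wdist x x = 0"
  by (simp add: word_dist_def)

lemma wdist_sym: "x \<in> carrier G \<Longrightarrow> y \<in> carrier G \<Longrightarrow> wdist x y = wdist y x"
  using len_inv[of "inv x \<otimes> y"] by (simp add: word_dist_def inv_mult_group)

lemma wdist_triangle:
  assumes "x \<in> carrier G" "y \<in> carrier G" "z \<in> carrier G"
  shows "wdist x z \<le> wdist x y + wdist y z"
proof -
  have "inv x \<otimes> z = (inv x \<otimes> y) \<otimes> (inv y \<otimes> z)"
    using assms by (simp add: m_assoc[symmetric]) (simp add: m_assoc)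
  then show ?thesis
    using len_mult[of "inv x \<otimes> y" "inv y \<otimes> z"] assms by (simp add: word_dist_def)
qed

lemma wdist_left:
  assumes "g \<in> carrier G" "x \<in> carrier G" "y \<in> carrier G"
  shows "wdist (g \<otimes> x) (g \<otimes> y) = wdist x y"
proof -
  have "inv (g \<otimes> x) \<otimes> (g \<otimes> y) = inv x \<otimes> y"
    using assms by (simp add: inv_mult_group m_assoc) (simp add: m_assoc[symmetric])
  then show ?thesis by (simp add: word_dist_def)
qed

lemma wdist_one_left [simp]: "x \<in> carrier G \<Longrightarrow> wdist \<one> x = real (len x)"
  by (simp add: word_dist_def)

lemma wdist_right [simp]:
  "x \<in> carrier G \<Longrightarrow> g \<in> carrier G \<Longrightarrow> wdist x (x \<otimes> g) = real (len g)"
  by (simp add: word_dist_def m_assoc[symmetric])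

lemma wdist_geodesic:
  assumes "x \<in> carrier G" "y \<in> carrier G"
  obtains c n where "c 0 = x" "c n = y" "\<And>k. c k \<in> carrier G" "real n = wdist x y"
    "\<And>i j. i \<le> j \<Longrightarrow> j \<le> n \<Longrightarrow> wdist (c i) (c j) = real (j - i)"
proof -
  define g where "g = inv x \<otimes> y"
  have g: "g \<in> carrier G" using assms g_def by simp
  obtain c where c: "c 0 = \<one>" "c (len g) = g" "\<And>k. c k \<in> carrier G"
    "\<And>i j. i \<le> j \<Longrightarrow> j \<le> len g \<Longrightarrow> len (inv (c i) \<otimes> c j) = j - i"
    using len_geodesic[OF g] by blast
  show ?thesis
  proof (rule that[of "\<lambda>k. x \<otimes> c k" "len g"])
    show "x \<otimes> c (len g) = y" using assms c by (simp add: g_def m_assoc[symmetric])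
    show "wdist (x \<otimes> c i) (x \<otimes> c j) = real (j - i)" if "i \<le> j" "j \<le> len g" for i j
      using c that wdist_left assms by (simp add: word_dist_def)
  qed (use assms c in \<open>auto simp: word_dist_def g_def\<close>)
qed

section \<open>Lipschitz bounds for homomorphisms and automorphisms\<close>

lemma len_hom_le:
  assumes "marked_group H T" "f \<in> hom G H"
    and "\<And>s. s \<in> S \<Longrightarrow> word_length H T (f s) \<le> L" and g: "g \<in> carrier G"
  shows "word_length H T (f g) \<le> L * len g"
proof -
  interpret H: marked_group H T by fact
  have f: "f x \<in> carrier H" if "x \<in> carrier G" for x
    using assms(2) that hom_in_carrier by metis
  interpret h: group_hom G H f by unfold_locales fact
  have "set us \<subseteq> letters \<Longrightarrow> H.len (f (word_prod us)) \<le> L * length us" for us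
  proof (induction us)
    case (Cons a us)
    then have a: "a \<in> letters" "a \<in> carrier G" "word_prod us \<in> carrier G"
      using letters_carrier word_prod_closed by auto
    have "H.len (f a) \<le> L"
      using a(1) assms(3) S_carrier H.len_inv f by (auto simp: subset_iff)
    then have "H.len (f a \<otimes>\<^bsub>H\<^esub> f (word_prod us)) \<le> L + L * length us"
      using Cons H.len_mult[of "f a" "f (word_prod us)"] a f by fastforce
    then show ?case using a by simp
  qed simp
  then show ?thesis using len_word[OF g] by metis
qed

text \<open>Bounds on the generators are assumed in place of finiteness of \<open>S\<close>, because
  the lemma is also applied to the infinite generating set \<open>S \<union> H\<close>, where the
  bound on \<open>H\<close> comes from \<open>f\<close> preserving \<open>H\<close>.\<close>

lemma bounded_iso_bilipschitz:
  assumes f: "f \<in> iso G G" and A: "\<And>s. s \<in> S \<Longrightarrow> len (f s) \<le> A"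
    and B: "\<And>s. s \<in> S \<Longrightarrow> len (inv_into (carrier G) f s) \<le> B"
  obtains L :: real where "1 \<le> L"
    "\<And>x y. x \<in> carrier G \<Longrightarrow> y \<in> carrier G \<Longrightarrow> wdist (f x) (f y) \<le> L * wdist x y"
    "\<And>x y. x \<in> carrier G \<Longrightarrow> y \<in> carrier G \<Longrightarrow> wdist x y \<le> L * wdist (f x) (f y)"
proof -
  have fh: "f \<in> hom G G" and bij: "bij_betw f (carrier G) (carrier G)"
    using f unfolding iso_def by auto
  interpret f: group_hom G G f by unfold_locales (rule fh)
  define f' where "f' = inv_into (carrier G) f"
  have f': "f' \<in> hom G G"
    using iso_set_sym[OF f] unfolding f'_def iso_def by blast
  have ff': "f' (f g) = g" if "g \<in> carrier G" for g
    unfolding f'_def using bij that by (simp add: bij_betw_def)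
  define L where "L = A + B + 1"
  have L: "len (f g) \<le> L * len g" "len g \<le> L * len (f g)" if g: "g \<in> carrier G" for g
    using len_hom_le[OF marked_group_axioms fh A g]
      len_hom_le[OF marked_group_axioms f' B[folded f'_def], of "f g"] ff'[OF g] g
    unfolding L_def by (auto simp: algebra_simps)
  have Lr: "real (len (f g)) \<le> real L * real (len g)" "real (len g) \<le> real L * real (len (f g))"
    if "g \<in> carrier G" for g
    using L[OF that] by (metis of_nat_le_iff of_nat_mult)+
  show ?thesis
  proof (rule that[of "real L"])
    show "wdist (f x) (f y) \<le> real L * wdist x y" "wdist x y \<le> real L * wdist (f x) (f y)"
      if "x \<in> carrier G" "y \<in> carrier G" for x y
      using Lr[of "inv x \<otimes> y"] that by (simp_all add: word_dist_def)
  qed (simp add: L_def)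
qed

lemma finite_len_bound:
  assumes "finite S"
  obtains L where "\<And>s. s \<in> S \<Longrightarrow> len (f s) \<le> L"
proof
  show "len (f s) \<le> Max (len ` f ` S)" if "s \<in> S" for s
    using assms that by (intro Max_ge) auto
qed

lemma iso_bilipschitz:
  assumes "finite S" and f: "f \<in> iso G G"
  obtains L :: real where "1 \<le> L"
    "\<And>x y. x \<in> carrier G \<Longrightarrow> y \<in> carrier G \<Longrightarrow> wdist (f x) (f y) \<le> L * wdist x y"
    "\<And>x y. x \<in> carrier G \<Longrightarrow> y \<in> carrier G \<Longrightarrow> wdist x y \<le> L * wdist (f x) (f y)"
  by (metis bounded_iso_bilipschitz[OF f] finite_len_bound[OF assms(1)])

end

section \<open>Hyperbolic spaces\<close>

text \<open>With \<open>h = k div 2\<close> the power is at least \<open>h * h\<close>, and a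
  quadratic outgrows a linear function. This closes the estimate "T is at most logarithmic in T" in
  \<open>morse\<close>.\<close>

lemma exponential_le_linear_bounded:
  fixes a b :: real
  assumes "0 \<le> a" "0 \<le> b"
  obtains k0 where "\<And>k::nat. 2 ^ k \<le> a * k + b \<Longrightarrow> k \<le> k0"
proof
  fix k :: nat
  assume k: "2 ^ k \<le> a * k + b"
  define h where "h = k div 2"
  have hk: "2 * h \<le> k" "k \<le> 2 * h + 1" unfolding h_def by auto
  have "real h * real h \<le> 2 ^ h * 2 ^ h"
    using of_nat_less_two_power[of h, where 'a=real] by (intro mult_mono) auto
  also have "\<dots> = 2 ^ (2 * h)" by (simp add: mult_2 power_add)
  also have "\<dots> \<le> 2 ^ k" using hk by (intro power_increasing) auto
  also have "\<dots> \<le> a * k + b" by (rule k)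
  also have "\<dots> \<le> a * (2 * h + 1) + b"
    using assms hk by (intro add_mono mult_left_mono) auto
  finally have hh: "real h * real h \<le> a * (2 * h + 1) + b" .
  have "real h \<le> 3 * a + b + 1"
  proof (rule ccontr)
    assume h: "\<not> real h \<le> 3 * a + b + 1"
    then have h1: "1 \<le> real h" using assms by linarith
    have "(3 * a + b) * real h < real h * real h"
      using h h1 by (intro mult_strict_right_mono) auto
    moreover have "a + b \<le> (a + b) * real h" using h1 assms by (simp add: mult_le_cancel_left1)
    ultimately show False using hh by (simp add: algebra_simps)
  qed
  moreover have "real k \<le> real (2 * h + 1)" using hk by (simp only: of_nat_le_iff)
  ultimately have "real k \<le> 2 * (3 * a + b + 1) + 1" by simp
  then show "k \<le> nat \<lceil>2 * (3 * a + b + 1) + 1\<rceil>" by linarith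
qed

text \<open>Geodesics are sequences indexed by natural numbers, so all distances are integers, as in
  a word metric. Points at distance 0 need not be equal, and \<open>c\<close> stays in
  \<open>M\<close> also beyond \<open>n\<close>, which saves side conditions.\<close>

locale hyperbolic_space =
  fixes M :: "'a set" and d :: "'a \<Rightarrow> 'a \<Rightarrow> real" and \<delta> :: real
  assumes d_nonneg: "0 \<le> d x y"
    and d_self: "x \<in> M \<Longrightarrow> d x x = 0"
    and d_sym: "x \<in> M \<Longrightarrow> y \<in> M \<Longrightarrow> d x y = d y x"
    and d_triangle: "x \<in> M \<Longrightarrow> y \<in> M \<Longrightarrow> z \<in> M \<Longrightarrow> d x z \<le> d x y + d y z"
    and delta_nonneg: "0 \<le> \<delta>"
    and four_point: "e \<in> M \<Longrightarrow> x \<in> M \<Longrightarrow> y \<in> M \<Longrightarrow> z \<in> M \<Longrightarrow>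
      min (gromov_product d e x y) (gromov_product d e y z) - \<delta> \<le> gromov_product d e x z"
    and geodesic: "x \<in> M \<Longrightarrow> y \<in> M \<Longrightarrow>
      \<exists>c n. c 0 = x \<and> c n = y \<and> (\<forall>k. c k \<in> M) \<and> real n = d x y
        \<and> (\<forall>i j. i \<le> j \<and> j \<le> n \<longrightarrow> d (c i) (c j) = real (j - i))"
begin

section \<open>Elementary properties of Gromov products\<close>

abbreviation gp :: "'a \<Rightarrow> 'a \<Rightarrow> 'a \<Rightarrow> real" where
  "gp \<equiv> gromov_product d"

lemma gp_sym: "x \<in> M \<Longrightarrow> y \<in> M \<Longrightarrow> gp e x y = gp e y x"
  by (simp add: gromov_product_def d_sym)

lemma gp_nonneg: "e \<in> M \<Longrightarrow> x \<in> M \<Longrightarrow> y \<in> M \<Longrightarrow> 0 \<le> gp e x y"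
  using d_triangle[of x e y] by (simp add: gromov_product_def d_sym)

lemma gp_le_left: "e \<in> M \<Longrightarrow> x \<in> M \<Longrightarrow> y \<in> M \<Longrightarrow> gp e x y \<le> d e x"
  using d_triangle[of y x e] by (simp add: gromov_product_def d_sym)

lemma gp_le_right: "e \<in> M \<Longrightarrow> x \<in> M \<Longrightarrow> y \<in> M \<Longrightarrow> gp e x y \<le> d e y"
  using d_triangle[of x y e] by (simp add: gromov_product_def d_sym)

lemma gp_self: "e \<in> M \<Longrightarrow> x \<in> M \<Longrightarrow> gp e x x = d e x"
  by (simp add: gromov_product_def d_sym d_self)

lemma gp_swap: "e \<in> M \<Longrightarrow> x \<in> M \<Longrightarrow> y \<in> M \<Longrightarrow> gp x e y + gp e x y = d e x"
  by (simp add: gromov_product_def d_sym field_simps)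

lemma gp_base: "e \<in> M \<Longrightarrow> f \<in> M \<Longrightarrow> x \<in> M \<Longrightarrow> y \<in> M \<Longrightarrow> gp e x y \<le> gp f x y + d e f"
  using d_triangle[of x f e] d_triangle[of y f e] d_sym[of e f]
  by (simp add: gromov_product_def field_simps)

lemma gp_ge: "e \<in> M \<Longrightarrow> x \<in> M \<Longrightarrow> y \<in> M \<Longrightarrow> d e x - d x y \<le> gp e x y"
  using d_triangle[of e y x] by (simp add: gromov_product_def d_sym)

lemma gp_geodesic:
  assumes "\<And>k. c k \<in> M" "\<And>i j. i \<le> j \<and> j \<le> n \<longrightarrow> d (c i) (c j) = real (j - i)" "s \<le> n"
  shows "gp (c s) (c 0) (c n) = 0"
  using assms(2)[of 0 s] assms(2)[of s n] assms(2)[of 0 n] assms(3) d_sym[OF assms(1) assms(1), of n s]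
  by (simp add: gromov_product_def of_nat_diff)

text \<open>Cutting the chain at \<open>2 ^ k\<close> and keeping the half with the smaller product
  costs one \<delta> per level. The loss is thus logarithmic in the number of steps; applied to a
  point \<open>p\<close> of a geodesic between the ends, it yields a step of the chain close to
  \<open>p\<close>.\<close>

lemma gp_chain:
  assumes "\<And>i. i \<le> n \<Longrightarrow> x i \<in> M" "p \<in> M" "0 < n" "n \<le> 2 ^ k"
  shows "\<exists>i<n. gp p (x i) (x (Suc i)) \<le> gp p (x 0) (x n) + k * \<delta>"
  using assms
proof (induction k arbitrary: x n)
  case 0
  then have "n = 1" by simp
  then show ?case by (intro exI[of _ 0]) simp
next
  case (Suc k)
  show ?case
  proof (cases "n \<le> 2 ^ k")
    case True
    then obtain i where "i < n" "gp p (x i) (x (Suc i)) \<le> gp p (x 0) (x n) + k * \<delta>"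
      using Suc.IH[of n x] Suc.prems by blast
    then show ?thesis using delta_nonneg by (intro exI[of _ i]) (simp add: algebra_simps)
  next
    case False
    define a where "a = (2::nat) ^ k"
    have a: "0 < a" "a < n" "n - a \<le> 2 ^ k" using False Suc.prems(4) unfolding a_def by auto
    obtain i where i: "i < a" "gp p (x i) (x (Suc i)) \<le> gp p (x 0) (x a) + k * \<delta>"
      using Suc.IH[of a x] Suc.prems a unfolding a_def by force
    obtain j where j: "j < n - a"
      "gp p (x (a + j)) (x (a + Suc j)) \<le> gp p (x a) (x n) + k * \<delta>"
      using Suc.IH[of "n - a" "\<lambda>i. x (a + i)"] Suc.prems a by force
    have "min (gp p (x 0) (x a)) (gp p (x a) (x n)) - \<delta> \<le> gp p (x 0) (x n)"
      using Suc.prems a by (intro four_point) auto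
    then consider "gp p (x 0) (x a) \<le> gp p (x 0) (x n) + \<delta>"
      | "gp p (x a) (x n) \<le> gp p (x 0) (x n) + \<delta>" by linarith
    then show ?thesis
    proof cases
      case 1
      then show ?thesis using i a by (intro exI[of _ i]) (simp add: algebra_simps)
    next
      case 2
      then show ?thesis using j a by (intro exI[of _ "a + j"]) (simp add: algebra_simps)
    qed
  qed
qed

lemma chain_dist:
  assumes "\<And>i. i \<le> n \<Longrightarrow> x i \<in> M" "\<And>i. i < n \<Longrightarrow> d (x i) (x (Suc i)) \<le> L"
    and "i \<le> j" "j \<le> n"
  shows "d (x i) (x j) \<le> L * real (j - i)"
  using assms(3,4)
proof (induction j rule: dec_induct)
  case base
  then show ?case using assms(1) by (simp add: d_self)
next
  case (step j)
  then have "d (x i) (x (Suc j)) \<le> d (x i) (x j) + d (x j) (x (Suc j))"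
    by (intro d_triangle assms) auto
  then show ?case using step assms(2)[of j] by (simp add: Suc_diff_le algebra_simps)
qed

text \<open>Stop at the first point whose distance from \<open>x 0\<close> is at least
  \<open>2 * T\<close>. By \<open>gp_swap\<close> its product with \<open>x n\<close> seen from
  \<open>x 0\<close> is that distance minus a product of at most \<open>T\<close>. If no point is
  that far, the end \<open>x n\<close> itself will do, since its product with itself is its
  distance.\<close>

lemma chain_cut:
  assumes "\<And>i. i \<le> n \<Longrightarrow> x i \<in> M" "\<And>i. i < n \<Longrightarrow> d (x i) (x (Suc i)) \<le> L" "0 \<le> L"
    and T: "0 \<le> T" "T \<le> d (x 0) (x n)" "\<And>m. m \<le> n \<Longrightarrow> gp (x m) (x 0) (x n) \<le> T"
  shows "\<exists>m\<le>n. d (x 0) (x m) \<le> 2 * T + L \<and> T \<le> gp (x 0) (x m) (x n)"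
proof (cases "\<exists>m\<le>n. 2 * T \<le> d (x 0) (x m)")
  case True
  define m where "m = (LEAST m. m \<le> n \<and> 2 * T \<le> d (x 0) (x m))"
  have m: "m \<le> n" "2 * T \<le> d (x 0) (x m)"
    unfolding m_def using LeastI_ex[OF True] by auto
  have least: "d (x 0) (x i) < 2 * T" if "i < m" for i
    using not_less_Least[of i "\<lambda>m. m \<le> n \<and> 2 * T \<le> d (x 0) (x m)"] that m(1)
    unfolding m_def by force
  have "d (x 0) (x m) \<le> 2 * T + L"
  proof (cases m)
    case 0
    then show ?thesis using assms by (simp add: d_self)
  next
    case (Suc i)
    then have "d (x 0) (x m) \<le> d (x 0) (x i) + d (x i) (x m)"
      using m by (intro d_triangle assms) auto
    then show ?thesis using least[of i] assms(2)[of i] Suc m by simp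
  qed
  moreover have "T \<le> gp (x 0) (x m) (x n)"
    using gp_swap[of "x 0" "x m" "x n"] m assms(1) T(3)[of m] by simp
  ultimately show ?thesis using m by blast
next
  case False
  then show ?thesis
    using T assms(1,3) by (intro exI[of _ n]) (force simp: gp_self)
qed

text \<open>A connectedness argument: take the last point \<open>y s\<close> close to some
  \<open>x a\<close> with \<open>a \<le> l\<close>. Its successor is close only to points after
  \<open>l\<close>, so \<open>y s\<close> is close to some \<open>x b\<close> with
  \<open>l \<le> b\<close> as well. Then \<open>x a\<close> and \<open>x b\<close> are close, hence
  so are their indices, and \<open>l\<close> lies between them.\<close>

lemma quasigeodesic_near_geodesic:
  assumes x: "\<And>i. i \<le> n \<Longrightarrow> x i \<in> M" "\<And>i. i < n \<Longrightarrow> d (x i) (x (Suc i)) \<le> L"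
    and qg: "\<And>i j. i \<le> j \<Longrightarrow> j \<le> n \<Longrightarrow> real (j - i) \<le> L * d (x i) (x j) + c"
    and pos: "0 \<le> L" "0 \<le> c" "0 \<le> E"
    and y: "\<And>s. y s \<in> M" "\<And>s. s < g \<Longrightarrow> d (y s) (y (Suc s)) \<le> 1" "y 0 = x 0" "y g = x n"
    and near: "\<And>s. s \<le> g \<Longrightarrow> \<exists>a\<le>n. d (y s) (x a) \<le> E"
    and l: "l \<le> n"
  shows "\<exists>s\<le>g. d (x l) (y s) \<le> E + L * (L * (2 * E + 1) + c)"
proof -
  define P where "P s \<longleftrightarrow> s \<le> g \<and> (\<exists>a\<le>l. d (y s) (x a) \<le> E)" for s
  have "P 0" using y(3) x(1)[of 0] pos unfolding P_def by (force simp: d_self)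
  define s where "s = Greatest P"
  have bd: "\<And>s. P s \<Longrightarrow> s \<le> g" unfolding P_def by simp
  have "P s" unfolding s_def using GreatestI_nat[of P, OF \<open>P 0\<close> bd] .
  then obtain a where a: "s \<le> g" "a \<le> l" "d (y s) (x a) \<le> E" unfolding P_def by blast
  have max: "s' \<le> s" if "P s'" for s' unfolding s_def using Greatest_le_nat[of P, OF that bd] .
  have "\<exists>b. l \<le> b \<and> b \<le> n \<and> d (y s) (x b) \<le> E + 1"
  proof (cases "s = g")
    case True
    then show ?thesis using y(4) l pos x(1) by (intro exI[of _ n]) (simp add: d_self)
  next
    case False
    then have sg: "Suc s \<le> g" using a by simp
    then obtain b where b: "b \<le> n" "d (y (Suc s)) (x b) \<le> E" using near by blast
    then have "l < b" using max[of "Suc s"] sg unfolding P_def by (meson Suc_n_not_le_n not_le)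
    moreover have "d (y s) (x b) \<le> d (y s) (y (Suc s)) + d (y (Suc s)) (x b)"
      using b by (intro d_triangle y x) auto
    ultimately show ?thesis using b y(2)[of s] sg by (intro exI[of _ b]) auto
  qed
  then obtain b where b: "l \<le> b" "b \<le> n" "d (y s) (x b) \<le> E + 1" by blast
  have M: "x a \<in> M" "x b \<in> M" "x l \<in> M" using a b l x by auto
  have "d (x a) (x b) \<le> 2 * E + 1"
    using d_triangle[OF M(1) y(1) M(2), of s] d_sym[OF M(1) y(1), of s] a b by linarith
  then have "L * d (x a) (x b) \<le> L * (2 * E + 1)" using pos by (intro mult_left_mono) auto
  then have "real (b - a) \<le> L * (2 * E + 1) + c" using qg[of a b] a b by linarith
  then have "real (l - a) \<le> L * (2 * E + 1) + c" using b by linarith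
  then have "d (x a) (x l) \<le> L * (L * (2 * E + 1) + c)"
    using chain_dist[of n x L a l] x a l pos mult_left_mono[of "real (l - a)" _ L] by fastforce
  moreover have "d (x l) (y s) \<le> d (x a) (x l) + d (y s) (x a)"
    using d_triangle[OF M(3) M(1) y(1), of s] d_sym M y(1) by metis
  ultimately show ?thesis using a by (intro exI[of _ s]) auto
qed

text \<open>
  The Morse lemma in terms of Gromov products. If the largest product \<open>T\<close> is attained at
  \<open>i \<le> l \<le> j\<close>, cutting the chain at distance about \<open>2T\<close> on both sides of \<open>l\<close> leaves a chain of
  length linear in \<open>T\<close>, and by \<open>gp_chain\<close> the geodesic between its ends is within \<open>O(log T)\<close> of it.
  Hence \<open>T = O(log T)\<close>.
\<close>

lemma morse:
  assumes L: "1 \<le> L" and c: "0 \<le> c"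
  obtains D where "\<And>x n i l j. (\<And>i. i \<le> n \<Longrightarrow> x i \<in> M) \<Longrightarrow>
      (\<And>i. i < n \<Longrightarrow> d (x i) (x (Suc i)) \<le> L) \<Longrightarrow>
      (\<And>i j. i \<le> j \<Longrightarrow> j \<le> n \<Longrightarrow> real (j - i) \<le> L * d (x i) (x j) + c) \<Longrightarrow>
      i \<le> l \<Longrightarrow> l \<le> j \<Longrightarrow> j \<le> n \<Longrightarrow> gp (x l) (x i) (x j) \<le> D"
proof -
  \<comment> \<open>Below, the largest product is at most
    \<open>2 * \<delta> + E * (1 + 2 * L * L) + L * (L + c)\<close> with
    \<open>E = k * \<delta> + L\<close>. Bounding \<open>k\<close> by \<open>(k - 1) + 1\<close>
    turns this into \<open>A * (k - 1) + B\<close>. The number of steps between the two cuts is at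
    most \<open>p * T + q\<close>, because their ends are at distance at most
    \<open>2 * (2 * T + L)\<close>.\<close>
  define A where "A = \<delta> * (1 + 2 * L * L)"
  define B where "B = 2 * \<delta> + (\<delta> + L) * (1 + 2 * L * L) + L * (L + c)"
  have AB: "0 \<le> A" "0 \<le> B"
    unfolding A_def B_def using L c delta_nonneg by auto
  define p where "p = 4 * L"
  define q where "q = L * (2 * L) + c"
  have pq: "0 \<le> p" "0 \<le> q" unfolding p_def q_def using L c by auto
  obtain k0 where k0: "\<And>k::nat. 2 ^ k \<le> (p * A) * k + (p * B + q + 1) \<Longrightarrow> k \<le> k0"
    using exponential_le_linear_bounded[of "p * A" "p * B + q + 1"] AB pq by fastforce
  have "gp (x l) (x i) (x j) \<le> A * k0 + B"
    if x: "\<And>i. i \<le> n \<Longrightarrow> x i \<in> M" "\<And>i. i < n \<Longrightarrow> d (x i) (x (Suc i)) \<le> L"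
      and qg: "\<And>i j. i \<le> j \<Longrightarrow> j \<le> n \<Longrightarrow> real (j - i) \<le> L * d (x i) (x j) + c"
      and ij: "i \<le> l" "l \<le> j" "j \<le> n" for x n i l j
  proof -
    define I where "I = {(i, l, j). i \<le> l \<and> l \<le> j \<and> j \<le> n}"
    define F where "F = (\<lambda>(i, l, j). gp (x l) (x i) (x j))"
    have "I \<subseteq> {..n} \<times> {..n} \<times> {..n}" unfolding I_def by auto
    then have fin: "finite (F ` I)" using finite_subset by blast
    define T where "T = Max (F ` I)"
    have T: "gp (x l) (x i) (x j) \<le> T" if "i \<le> l" "l \<le> j" "j \<le> n" for i l j
    proof -
      have "F (i, l, j) \<in> F ` I" using that by (intro imageI) (simp add: I_def)
      then show ?thesis unfolding T_def using Max_ge[OF fin] by (simp add: F_def)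
    qed
    have "T \<in> F ` I" unfolding T_def using fin ij by (intro Max_in) (auto simp: I_def)
    then obtain i l j where ilj: "i \<le> l" "l \<le> j" "j \<le> n" "T = gp (x l) (x i) (x j)"
      unfolding I_def F_def by auto
    have T0: "0 \<le> T" unfolding ilj(4) using ilj x by (intro gp_nonneg) auto
    \<comment> \<open>The cut on the side of \<open>i\<close> uses the chain read backwards from
      \<open>l\<close>.\<close>
    have "\<exists>m\<le>l - i. d (x (l - 0)) (x (l - m)) \<le> 2 * T + L
        \<and> T \<le> gp (x (l - 0)) (x (l - m)) (x (l - (l - i)))"
    proof (rule chain_cut[of "l - i" "\<lambda>m. x (l - m)" L T])
      show "d (x (l - m)) (x (l - Suc m)) \<le> L" if "m < l - i" for m
      proof -
        have "Suc (l - Suc m) = l - m" "l - Suc m < n" using that ilj by auto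
        then show ?thesis using x(2)[of "l - Suc m"] d_sym[of "x (l - m)"] x(1) by simp
      qed
      show "T \<le> d (x (l - 0)) (x (l - (l - i)))"
        unfolding ilj(4) using gp_le_left[of "x l" "x i" "x j"] ilj x by simp
      show "gp (x (l - m)) (x (l - 0)) (x (l - (l - i))) \<le> T" if "m \<le> l - i" for m
        using T[of i "l - m" l] ilj that x by (simp add: gp_sym[of "x l"])
    qed (use ilj x L T0 in auto)
    then obtain m where m: "m \<le> l - i" "d (x l) (x (l - m)) \<le> 2 * T + L"
      "T \<le> gp (x l) (x (l - m)) (x i)" using ilj by auto
    define i' where "i' = l - m"
    have "\<exists>m\<le>j - l. d (x (l + 0)) (x (l + m)) \<le> 2 * T + L
        \<and> T \<le> gp (x (l + 0)) (x (l + m)) (x (l + (j - l)))"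
    proof (rule chain_cut[of "j - l" "\<lambda>m. x (l + m)" L T])
      show "T \<le> d (x (l + 0)) (x (l + (j - l)))"
        unfolding ilj(4) using gp_le_right[of "x l" "x i" "x j"] ilj x by simp
      show "gp (x (l + m)) (x (l + 0)) (x (l + (j - l))) \<le> T" if "m \<le> j - l" for m
        using T[of l "l + m" j] ilj that by simp
    qed (use ilj x L T0 in auto)
    then obtain m' where m': "m' \<le> j - l" "d (x l) (x (l + m')) \<le> 2 * T + L"
      "T \<le> gp (x l) (x (l + m')) (x j)" using ilj by auto
    define j' where "j' = l + m'"
    have le: "i' \<le> l" "l \<le> j'" "j' \<le> n" unfolding i'_def j'_def using ilj m m' by auto
    have M: "x i' \<in> M" "x j' \<in> M" "x l \<in> M" "x i \<in> M" "x j \<in> M" using le ilj x by auto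
    \<comment> \<open>Replacing \<open>x i\<close> by \<open>x i'\<close> and \<open>x j\<close> by
      \<open>x j'\<close> costs one \<delta> each.\<close>
    have gp': "T - 2 * \<delta> \<le> gp (x l) (x i') (x j')"
      using four_point[OF M(3) M(1) M(4) M(5)] four_point[OF M(3) M(1) M(5) M(2)] ilj(4)
        m(3) m'(3) gp_sym[OF M(2) M(5), of "x l"] unfolding i'_def[symmetric] j'_def[symmetric]
      using delta_nonneg by linarith
    define N where "N = j' - i'"
    have N: "real N \<le> p * T + q"
    proof -
      have "d (x i') (x l) \<le> 2 * T + L" "d (x l) (x j') \<le> 2 * T + L"
        using d_sym[OF M(1) M(3)] m(2) m'(2) by (simp_all add: i'_def j'_def)
      then have "d (x i') (x j') \<le> 2 * (2 * T + L)"
        using d_triangle[OF M(1) M(3) M(2)] by argo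
      then have "L * d (x i') (x j') \<le> L * (2 * (2 * T + L))" using L by (intro mult_left_mono) auto
      then show ?thesis
        using qg[of i' j'] le unfolding N_def p_def q_def by (simp add: algebra_simps)
    qed
    have "\<exists>k. N \<le> 2 ^ k" by (meson less_exp less_imp_le)
    define k where "k = (LEAST k. N \<le> 2 ^ k)"
    have k: "N \<le> 2 ^ k" unfolding k_def using LeastI_ex[OF \<open>\<exists>k. N \<le> 2 ^ k\<close>] .
    \<comment> \<open>Minimality of \<open>k\<close> gives \<open>2 ^ (k - 1) < N\<close> for
      positive \<open>k\<close>. For \<open>k = 0\<close> truncated subtraction makes the left side
      1, and the summand 1 on the right covers \<open>N = 0\<close>.\<close>
    have k': "2 ^ (k - 1) \<le> real N + 1"
    proof (cases k)
      case (Suc k')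
      then have "\<not> N \<le> 2 ^ k'" using not_less_Least[of k' "\<lambda>k. N \<le> 2 ^ k"] unfolding k_def by auto
      then have "2 ^ k' \<le> real N" by (metis linear of_nat_le_iff of_nat_numeral of_nat_power)
      moreover have "(2::real) ^ (k - 1) = 2 ^ k'" using Suc by simp
      ultimately show ?thesis by linarith
    qed simp
    define E where "E = k * \<delta> + L"
    have E0: "0 \<le> E" unfolding E_def using delta_nonneg L by simp
    obtain y g where y: "y 0 = x i'" "y g = x j'" "\<And>s. y s \<in> M"
      "\<And>i j. i \<le> j \<and> j \<le> g \<longrightarrow> d (y i) (y j) = real (j - i)"
      using geodesic[OF M(1) M(2)] by metis
    have gy: "gp (y s) (x i') (x j') = 0" if "s \<le> g" for s
      using gp_geodesic[of y g s] y that by simp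
    have "\<exists>s\<le>g. d (x (i' + (l - i'))) (y s) \<le> E + L * (L * (2 * E + 1) + c)"
    proof (rule quasigeodesic_near_geodesic[of N "\<lambda>m. x (i' + m)" L c E y g "l - i'"])
      show "\<exists>a\<le>N. d (y s) (x (i' + a)) \<le> E" if s: "s \<le> g" for s
      proof (cases "N = 0")
        case True
        then have "i' = j'" using le unfolding N_def by simp
        then have "d (y s) (x i') = 0" using gy[OF s] gp_self y(3) M by metis
        then show ?thesis using E0 by (intro exI[of _ 0]) simp
      next
        case False
        then obtain a where a: "a < N" "gp (y s) (x (i' + a)) (x (i' + Suc a)) \<le> k * \<delta>"
          using gp_chain[of N "\<lambda>m. x (i' + m)" "y s" k] x le k y(3) gy[OF s] unfolding N_def by force
        have "d (y s) (x (i' + a)) - d (x (i' + a)) (x (i' + Suc a)) \<le> k * \<delta>"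
          using gp_ge[of "y s" "x (i' + a)" "x (i' + Suc a)"] a y(3) x(1) le unfolding N_def by force
        moreover have "i' + a < n" using a le unfolding N_def by simp
        ultimately have "d (y s) (x (i' + a)) \<le> E"
          using x(2)[of "i' + a"] unfolding E_def by simp
        then show ?thesis using a by (intro exI[of _ a]) simp
      qed
      show "d (y s) (y (Suc s)) \<le> 1" if "s < g" for s using y(4)[of s "Suc s"] that by simp
      show "real (b - a) \<le> L * d (x (i' + a)) (x (i' + b)) + c" if "a \<le> b" "b \<le> N" for a b
        using qg[of "i' + a" "i' + b"] that le unfolding N_def by auto
    qed (use le x L c E0 y in \<open>auto simp: N_def\<close>)
    then obtain s where s: "s \<le> g" "d (x l) (y s) \<le> E + L * (L * (2 * E + 1) + c)" using le by auto
    have "T - 2 * \<delta> \<le> E + L * (L * (2 * E + 1) + c)"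
      using gp_base[of "x l" "y s" "x i'" "x j'"] gy s M y(3) gp' by force
    then have TE: "T \<le> 2 * \<delta> + E + L * (L * (2 * E + 1) + c)" by simp
    also have "\<dots> = 2 * \<delta> + E * (1 + 2 * L * L) + L * (L + c)" by (simp add: algebra_simps)
    also have "\<dots> \<le> 2 * \<delta> + ((real (k - 1) + 1) * \<delta> + L) * (1 + 2 * L * L) + L * (L + c)"
      unfolding E_def using L delta_nonneg
      by (intro add_mono mult_right_mono order_refl) auto
    also have "\<dots> = A * real (k - 1) + B" unfolding A_def B_def by (simp add: algebra_simps)
    finally have TA: "T \<le> A * real (k - 1) + B" .
    have "2 ^ (k - 1) \<le> p * T + q + 1" using k' N by simp
    also have "\<dots> \<le> p * (A * real (k - 1) + B) + q + 1"
      using TA pq by (intro add_mono mult_left_mono order_refl) auto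
    finally have "k - 1 \<le> k0" using k0[of "k - 1"] by (simp add: algebra_simps)
    then have "A * real (k - 1) \<le> A * k0" using AB by (intro mult_left_mono) auto
    then show ?thesis using T[OF that(4-6)] TA by linarith
  qed
  then show ?thesis using that by blast
qed

text \<open>The coarse barycentre of a triangle: a point coarsely on all three sides. Formulating
  this by Gromov products avoids choosing geodesics and lets the notion pass to sequences at
  infinity.\<close>

definition center :: "real \<Rightarrow> 'a \<Rightarrow> 'a \<Rightarrow> 'a \<Rightarrow> 'a \<Rightarrow> bool" where
  "center C m x y z \<longleftrightarrow> gp m x y \<le> C \<and> gp m y z \<le> C \<and> gp m x z \<le> C"

text \<open>On a geodesic from \<open>x\<close> to \<open>y\<close>, the branch point of the
  approximating tripod lies at distance \<open>gp x y z\<close> from \<open>x\<close>. Rounding this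
  distance to an integer accounts for the 1, one use of the four-point condition for the
  \<delta>.\<close>

lemma center_exists:
  assumes M: "x \<in> M" "y \<in> M" "z \<in> M"
  obtains m where "m \<in> M" "center (1 + \<delta>) m x y z"
proof -
  obtain c n where c: "c 0 = x" "c n = y" "\<And>k. c k \<in> M" "real n = d x y"
    "\<And>i j. i \<le> j \<and> j \<le> n \<longrightarrow> d (c i) (c j) = real (j - i)"
    using geodesic[OF M(1,2)] by metis
  define s where "s = nat \<lfloor>gp x y z\<rfloor>"
  have s: "real s \<le> gp x y z" "gp x y z \<le> real s + 1"
    unfolding s_def using gp_nonneg[of x y z] M by linarith+
  have "s \<le> n" using s gp_le_left[of x y z] M c(4) by simp
  define m where "m = c s"
  have m: "m \<in> M" "d x m = s" "d m y = d x y - s"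
    using c(1,2,4) c(3)[of s] c(5)[of 0 s] c(5)[of s n] \<open>s \<le> n\<close> unfolding m_def by auto
  have sym: "d y x = d x y" "d z x = d x z" "d z y = d y z" "d m x = d x m" "d y m = d m y" "d z m = d m z"
    using M m d_sym by auto
  have xy: "gp m x y = 0" using m sym by (simp add: gromov_product_def)
  have "min (gp x m y) (gp x y z) - \<delta> \<le> gp x m z" "min (gp y m x) (gp y x z) - \<delta> \<le> gp y m z"
    by (intro four_point M m)+
  moreover have "gp x m y = s" "gp y m x = d x y - s" "gp y x z = d x y - gp x y z"
    using m sym by (simp_all add: gromov_product_def field_simps)
  ultimately have "real s - \<delta> \<le> gp x m z" "d x y - s - 1 - \<delta> \<le> gp y m z"
    using s by linarith+
  moreover have "gp m x z = s - gp x m z" "gp m y z = d x y - s - gp y m z"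
    using m sym by (simp_all add: gromov_product_def field_simps)
  ultimately have "center (1 + \<delta>) m x y z"
    using xy delta_nonneg unfolding center_def by simp
  then show ?thesis using that m by blast
qed

text \<open>Seen from \<open>m\<close>, the four-point condition with \<open>m'\<close> as middle
  point lets at most one of \<open>x\<close>, \<open>y\<close>, \<open>z\<close> have a product with
  \<open>m'\<close> above \<open>C + \<delta>\<close>; likewise from \<open>m'\<close> with
  \<open>C' + \<delta>\<close>. For one of the three vertices both products are therefore small, and
  their sum is \<open>d m m'\<close>.\<close>

lemma center_unique:
  assumes M: "x \<in> M" "y \<in> M" "z \<in> M" "m \<in> M" "m' \<in> M"
    and "center C m x y z" "center C' m' x y z"
  shows "d m m' \<le> C + C' + 2 * \<delta>"
proof -
  have *: "min (gp m x m') (gp m m' y) - \<delta> \<le> gp m x y" "min (gp m y m') (gp m m' z) - \<delta> \<le> gp m y z"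
    "min (gp m x m') (gp m m' z) - \<delta> \<le> gp m x z"
    "min (gp m' x m) (gp m' m y) - \<delta> \<le> gp m' x y" "min (gp m' y m) (gp m' m z) - \<delta> \<le> gp m' y z"
    "min (gp m' x m) (gp m' m z) - \<delta> \<le> gp m' x z"
    by (intro four_point M)+
  have "gp m x m' + gp m' x m = d m m'" "gp m y m' + gp m' y m = d m m'"
    "gp m z m' + gp m' z m = d m m'"
    using M d_sym[of m m'] by (simp_all add: gromov_product_def field_simps)
  moreover have "gp m m' y = gp m y m'" "gp m m' z = gp m z m'" "gp m' m y = gp m' y m" "gp m' m z = gp m' z m"
    using M gp_sym by auto
  ultimately show ?thesis using * assms(6,7) unfolding center_def min_def by argo
qed

lemma gp_perturb:
  assumes "m \<in> M" "x \<in> M" "x' \<in> M" "y \<in> M" "gp m x y \<le> C" "C + \<delta> < gp m x x'"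
  shows "gp m x' y \<le> C + \<delta>"
  using four_point[of m x x' y] assms by linarith

text \<open>The induction carries the angle at the last edge. Since that edge is long and its angle
  at \<open>x k\<close> small, \<open>x k\<close> and \<open>x 0\<close> have a large product seen
  from \<open>x (Suc k)\<close>; the small local product there then forces the product of
  \<open>x 0\<close> with the next point to be small.\<close>

lemma local_to_global_end:
  assumes x: "\<And>i. i \<le> n \<Longrightarrow> x i \<in> M"
    and a: "0 \<le> a" "\<And>i. Suc (Suc i) \<le> n \<Longrightarrow> gp (x (Suc i)) (x i) (x (Suc (Suc i))) \<le> a"
    and b: "\<And>i. i < n \<Longrightarrow> 2 * a + 2 * \<delta> < d (x i) (x (Suc i))"
  shows "Suc k \<le> n \<Longrightarrow> gp (x k) (x 0) (x (Suc k)) \<le> a + \<delta>"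
proof (induction k)
  case 0
  then show ?case
    using gp_le_left[of "x 0" "x 0" "x 1"] x[of 0] x[of 1] d_self a delta_nonneg by simp
next
  case (Suc k)
  have M: "x 0 \<in> M" "x k \<in> M" "x (Suc k) \<in> M" "x (Suc (Suc k)) \<in> M" using Suc.prems x by auto
  have "min (gp (x (Suc k)) (x k) (x 0)) (gp (x (Suc k)) (x 0) (x (Suc (Suc k)))) - \<delta> \<le> a"
    using four_point[OF M(3,2,1,4)] a(2)[of k] Suc.prems by linarith
  moreover have "gp (x (Suc k)) (x k) (x 0) = d (x k) (x (Suc k)) - gp (x k) (x 0) (x (Suc k))"
    using gp_swap[OF M(2,3,1)] gp_sym[OF M(1,3)] by simp
  ultimately show ?case using Suc b[of k] by auto
qed

text \<open>The one-sided estimate is run forwards from \<open>x i\<close> and, on the reversed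
  chain, backwards from \<open>x j\<close>; the two meet at the edge from \<open>x l\<close> to
  \<open>x (Suc l)\<close>. Combining them takes another four-point inequality, hence
  \<open>3 * \<delta>\<close> in place of \<open>2 * \<delta>\<close> in the length
  condition.\<close>

lemma local_to_global:
  assumes x: "\<And>i. i \<le> n \<Longrightarrow> x i \<in> M"
    and a: "0 \<le> a" "\<And>i. Suc (Suc i) \<le> n \<Longrightarrow> gp (x (Suc i)) (x i) (x (Suc (Suc i))) \<le> a"
    and b: "\<And>i. i < n \<Longrightarrow> 2 * a + 3 * \<delta> < d (x i) (x (Suc i))"
    and ij: "i \<le> l" "l \<le> j" "j \<le> n"
  shows "gp (x l) (x i) (x j) \<le> a + 2 * \<delta>"
proof (cases "l = j")
  case True
  have "x i \<in> M" "x j \<in> M" using x ij by auto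
  then show ?thesis using True gp_le_right[of "x j" "x i" "x j"] d_self a delta_nonneg by force
next
  case False
  then have lj: "Suc l \<le> j" using ij by simp
  have M: "x i \<in> M" "x l \<in> M" "x (Suc l) \<in> M" "x j \<in> M" using x ij lj by auto
  have b': "2 * a + 2 * \<delta> < d (x i) (x (Suc i))" if "i < n" for i
    using b[OF that] delta_nonneg by simp
  have 1: "gp (x (i + (l - i))) (x (i + 0)) (x (i + Suc (l - i))) \<le> a + \<delta>"
    by (rule local_to_global_end[of "n - i" "\<lambda>k. x (i + k)"]) (use x a b' ij lj in auto)
  have 2: "gp (x (j - (j - Suc l))) (x (j - 0)) (x (j - Suc (j - Suc l))) \<le> a + \<delta>"
  proof (rule local_to_global_end[of j "\<lambda>k. x (j - k)"])
    show "gp (x (j - Suc k)) (x (j - k)) (x (j - Suc (Suc k))) \<le> a" if "Suc (Suc k) \<le> j" for k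
    proof -
      define k' where "k' = j - Suc (Suc k)"
      have k': "j - Suc k = Suc k'" "j - k = Suc (Suc k')" "Suc (Suc k') \<le> n"
        using that ij unfolding k'_def by auto
      then show ?thesis
        using a(2)[of k'] x gp_sym[of "x k'" "x (Suc (Suc k'))"] unfolding k'_def[symmetric] by simp
    qed
    show "2 * a + 2 * \<delta> < d (x (j - k)) (x (j - Suc k))" if "k < j" for k
    proof -
      have "Suc (j - Suc k) = j - k" "j - Suc k < n" using that ij by auto
      then show ?thesis
        using b[of "j - Suc k"] d_sym[of "x (j - k)"] x delta_nonneg by simp
    qed
  qed (use assms lj in auto)
  have "j - (j - Suc l) = Suc l" "j - Suc (j - Suc l) = l" using lj by auto
  then have 3: "gp (x (Suc l)) (x j) (x l) \<le> a + \<delta>" using 2 by simp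
  have "gp (x l) (x (Suc l)) (x j) = d (x l) (x (Suc l)) - gp (x (Suc l)) (x j) (x l)"
    using gp_swap[OF M(2,3,4)] gp_sym[OF M(4,2)] by simp
  then have "a + 2 * \<delta> < gp (x l) (x (Suc l)) (x j)" using 3 b[of l] lj ij by simp
  moreover have "gp (x l) (x i) (x (Suc l)) \<le> a + \<delta>" using 1 ij by simp
  moreover have "gp (x l) (x (Suc l)) (x j) = gp (x l) (x j) (x (Suc l))" using gp_sym M by auto
  ultimately show ?thesis using four_point[OF M(2) M(1) M(4) M(3)] by linarith
qed

text \<open>An angle bounded by \<open>a + \<delta>\<close> wastes at most twice that amount, so
  every edge of the required length adds at least 1 to the distance from \<open>x 0\<close>.\<close>

lemma local_to_global_dist:
  assumes x: "\<And>i. i \<le> n \<Longrightarrow> x i \<in> M"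
    and a: "0 \<le> a" "\<And>i. Suc (Suc i) \<le> n \<Longrightarrow> gp (x (Suc i)) (x i) (x (Suc (Suc i))) \<le> a"
    and b: "\<And>i. i < n \<Longrightarrow> 2 * a + 2 * \<delta> + 1 \<le> d (x i) (x (Suc i))"
  shows "real n \<le> d (x 0) (x n)"
proof -
  have "k \<le> n \<Longrightarrow> real k \<le> d (x 0) (x k)" for k
  proof (induction k)
    case (Suc k)
    have M: "x 0 \<in> M" "x k \<in> M" "x (Suc k) \<in> M" using Suc.prems x by auto
    have "gp (x k) (x 0) (x (Suc k)) \<le> a + \<delta>"
      using Suc.prems b by (intro local_to_global_end[of n]) (use assms in force)+
    then show ?case
      using Suc b[of k] d_sym[OF M(3,2)] by (simp add: gromov_product_def field_simps)
  qed (simp add: d_nonneg)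
  then show ?thesis by simp
qed

end

section \<open>Hyperbolic groups\<close>

locale hyperbolic_group = marked_group G S + hyperbolic_space "carrier G" "word_dist G S" \<delta>
  for G (structure) and S and \<delta> +
  assumes finite_S: "finite S"
begin

lemma gp_left:
  assumes "g \<in> carrier G" "e \<in> carrier G" "x \<in> carrier G" "y \<in> carrier G"
  shows "gp (g \<otimes> e) (g \<otimes> x) (g \<otimes> y) = gp e x y"
  using assms by (simp add: gromov_product_def wdist_left)

lemma center_left:
  assumes "g \<in> carrier G" "m \<in> carrier G" "x \<in> carrier G" "y \<in> carrier G" "z \<in> carrier G"
  shows "center C (g \<otimes> m) (g \<otimes> x) (g \<otimes> y) (g \<otimes> z) \<longleftrightarrow> center C m x y z"
  using assms by (simp add: center_def gp_left)

lemma gp_toward: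
  assumes "m \<in> carrier G" "x \<in> carrier G" "y \<in> carrier G" "u \<in> carrier G"
    and "wdist m u + wdist u x = wdist m x"
  shows "gp m u y \<le> gp m x y"
  using assms d_triangle[of x u y] d_sym[of x u] d_sym[of m u] d_sym[of m x]
  by (simp add: gromov_product_def)

text \<open>
  The image of a geodesic from \<open>x\<close> to \<open>m\<close> followed by a geodesic from \<open>m\<close> to \<open>y\<close> is a
  quasigeodesic, with constants depending only on \<open>f\<close> and \<open>C\<close>.
\<close>

lemma iso_gp_bounded:
  assumes f: "f \<in> iso G G" and C: "0 \<le> C"
  obtains D where "\<And>m x y. m \<in> carrier G \<Longrightarrow> x \<in> carrier G \<Longrightarrow> y \<in> carrier G \<Longrightarrow>
    gp m x y \<le> C \<Longrightarrow> gp (f m) (f x) (f y) \<le> D"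
proof -
  obtain L :: real where L: "1 \<le> L"
    "\<And>x y. x \<in> carrier G \<Longrightarrow> y \<in> carrier G \<Longrightarrow> wdist (f x) (f y) \<le> L * wdist x y"
    "\<And>x y. x \<in> carrier G \<Longrightarrow> y \<in> carrier G \<Longrightarrow> wdist x y \<le> L * wdist (f x) (f y)"
    using iso_bilipschitz[OF finite_S f] by blast
  have fc: "f x \<in> carrier G" if "x \<in> carrier G" for x
    using f that unfolding iso_def hom_def by auto
  have "0 \<le> 2 * C" using C by simp
  obtain D where D: "\<And>x n i l j. (\<And>i. i \<le> n \<Longrightarrow> x i \<in> carrier G) \<Longrightarrow>
      (\<And>i. i < n \<Longrightarrow> wdist (x i) (x (Suc i)) \<le> L) \<Longrightarrow>
      (\<And>i j. i \<le> j \<Longrightarrow> j \<le> n \<Longrightarrow> real (j - i) \<le> L * wdist (x i) (x j) + 2 * C) \<Longrightarrow>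
      i \<le> l \<Longrightarrow> l \<le> j \<Longrightarrow> j \<le> n \<Longrightarrow> gp (x l) (x i) (x j) \<le> D"
    using morse[OF L(1) \<open>0 \<le> 2 * C\<close>] by blast
  show ?thesis
  proof (rule that[of D])
    fix m x y
    assume M: "m \<in> carrier G" "x \<in> carrier G" "y \<in> carrier G" and gp: "gp m x y \<le> C"
    obtain u a where u: "u 0 = x" "u a = m" "\<And>k. u k \<in> carrier G"
      "\<And>i j. i \<le> j \<Longrightarrow> j \<le> a \<Longrightarrow> wdist (u i) (u j) = real (j - i)"
      using wdist_geodesic[OF M(2,1)] by metis
    obtain v b where v: "v 0 = m" "v b = y" "\<And>k. v k \<in> carrier G"
      "\<And>i j. i \<le> j \<Longrightarrow> j \<le> b \<Longrightarrow> wdist (v i) (v j) = real (j - i)"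
      using wdist_geodesic[OF M(1,3)] by metis
    define w where "w k = (if k \<le> a then u k else v (k - a))" for k
    have wc: "w k \<in> carrier G" for k using u v unfolding w_def by simp
    have wv: "w k = v (k - a)" if "a \<le> k" for k using that u v unfolding w_def by (cases "k = a") auto
    have lower: "real (j - i) \<le> wdist (w i) (w j) + 2 * C" if ij: "i \<le> j" "j \<le> a + b" for i j
    proof -
      consider "j \<le> a" | "a \<le> i" | "i < a" "a < j" by linarith
      then show ?thesis
      proof cases
        case 1
        then show ?thesis using ij u C unfolding w_def by simp
      next
        case 2
        have "j - a - (i - a) = j - i" using 2 by simp
        then show ?thesis using 2 ij wv v(4)[of "i - a" "j - a"] C by simp
      next
        case 3
        define p where "p = u i"
        define q where "q = v (j - a)"
        have pq: "p \<in> carrier G" "q \<in> carrier G" using u v p_def q_def by auto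
        have d: "wdist m p = real (a - i)" "wdist p x = real i" "wdist m x = real a"
          using u(1,2,4) M pq d_sym 3 u(4)[of i a] u(4)[of 0 i] u(4)[of 0 a] unfolding p_def
          by (metis diff_zero le0 less_imp_le order_refl u(3))+
        have d': "wdist m q = real (j - a)" "wdist q y = real (a + b - j)" "wdist m y = real b"
          using v(4)[of 0 "j - a"] v(4)[of "j - a" b] v(4)[of 0 b] v(1,2) 3 ij unfolding q_def by auto
        \<comment> \<open>Moving \<open>x\<close> and \<open>y\<close> towards \<open>m\<close>
          along geodesics does not increase the product. Hence the path through \<open>m\<close>
          from \<open>p\<close> to \<open>q\<close> exceeds their distance by at most
          \<open>2 * C\<close>, the additive constant fed into \<open>morse\<close>.\<close>
        have "gp m p y \<le> gp m x y" by (rule gp_toward) (use M pq d 3 in auto)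
        moreover have "gp m q p \<le> gp m y p" by (rule gp_toward) (use M pq d' 3 ij in auto)
        ultimately have "gp m p q \<le> C" using gp gp_sym M pq by (metis order_trans)
        then have "real (a - i) + real (j - a) \<le> wdist p q + 2 * C"
          using d d' d_sym M pq by (simp add: gromov_product_def)
        then show ?thesis using 3 ij wv[of j] unfolding w_def p_def q_def by auto
      qed
    qed
    have "gp (f (w a)) (f (w 0)) (f (w (a + b))) \<le> D"
    proof (rule D[of "a + b" "\<lambda>k. f (w k)" 0 a "a + b"])
      show "wdist (f (w i)) (f (w (Suc i))) \<le> L" if "i < a + b" for i
      proof -
        have "wdist (w i) (w (Suc i)) = 1"
        proof (cases "Suc i \<le> a")
          case True
          then show ?thesis using u(4)[of i "Suc i"] unfolding w_def by simp
        next
          case False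
          then show ?thesis using v(4)[of "i - a" "Suc i - a"] wv[of i] wv[of "Suc i"] that by auto
        qed
        then show ?thesis using L(2)[OF wc wc, of i "Suc i"] by simp
      qed
      show "real (j - i) \<le> L * wdist (f (w i)) (f (w j)) + 2 * C" if "i \<le> j" "j \<le> a + b" for i j
        using lower[OF that] L(3)[OF wc wc, of i j] by linarith
    qed (use fc wc in auto)
    moreover have "w a = m" "w 0 = x" "w (a + b) = y" using u v wv[of "a + b"] unfolding w_def by auto
    ultimately show "gp (f m) (f x) (f y) \<le> D" by simp
  qed
qed

lemma iso_center:
  assumes "f \<in> iso G G" "0 \<le> C"
  obtains D where "\<And>m x y z. m \<in> carrier G \<Longrightarrow> x \<in> carrier G \<Longrightarrow> y \<in> carrier G \<Longrightarrow> z \<in> carrier G \<Longrightarrow>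
    center C m x y z \<Longrightarrow> center D (f m) (f x) (f y) (f z)"
proof -
  obtain D where "\<And>m x y. m \<in> carrier G \<Longrightarrow> x \<in> carrier G \<Longrightarrow> y \<in> carrier G \<Longrightarrow>
    gp m x y \<le> C \<Longrightarrow> gp (f m) (f x) (f y) \<le> D"
    using iso_gp_bounded[OF assms] by blast
  then show ?thesis using that[of D] unfolding center_def by blast
qed

subsection \<open>Sequences converging at infinity\<close>

text \<open>A point at infinity is represented by a sequence converging to it. The boundary itself
  is never formed; where two sequences should have the same limit, bounded distance between their
  terms is used instead.\<close>

definition gromov_seq :: "(nat \<Rightarrow> 'a) \<Rightarrow> bool" where
  "gromov_seq x \<longleftrightarrow> range x \<subseteq> carrier G \<and> (\<forall>R. \<exists>N. \<forall>n\<ge>N. \<forall>m\<ge>N. R \<le> gp \<one> (x n) (x m))"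

definition limit_center ::
    "real \<Rightarrow> 'a \<Rightarrow> (nat \<Rightarrow> 'a) \<Rightarrow> (nat \<Rightarrow> 'a) \<Rightarrow> (nat \<Rightarrow> 'a) \<Rightarrow> bool" where
  "limit_center C m x y z \<longleftrightarrow> (\<exists>N. \<forall>n\<ge>N. center C m (x n) (y n) (z n))"

lemma gromov_seq_carrier: "gromov_seq x \<Longrightarrow> x n \<in> carrier G"
  unfolding gromov_seq_def by auto

lemma gromov_seqD: "gromov_seq x \<Longrightarrow> \<exists>N. \<forall>n\<ge>N. \<forall>m\<ge>N. R \<le> gp \<one> (x n) (x m)"
  unfolding gromov_seq_def by simp

lemma gromov_seq_gp_base:
  assumes "gromov_seq x" "m \<in> carrier G"
  shows "\<exists>N. \<forall>n\<ge>N. \<forall>n'\<ge>N. R \<le> gp m (x n) (x n')"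
proof -
  obtain N where N: "\<And>n n'. N \<le> n \<Longrightarrow> N \<le> n' \<Longrightarrow> R + wdist \<one> m \<le> gp \<one> (x n) (x n')"
    using gromov_seqD[OF assms(1), of "R + wdist \<one> m"] by blast
  have "R \<le> gp m (x n) (x n')" if "N \<le> n" "N \<le> n'" for n n'
    using N[OF that] gp_base[of \<one> m "x n" "x n'"] gromov_seq_carrier assms by force
  then show ?thesis by blast
qed

lemma gromov_seq_dist:
  assumes "gromov_seq x" "m \<in> carrier G"
  shows "\<exists>N. \<forall>n\<ge>N. R \<le> wdist m (x n)"
proof -
  obtain N where "\<And>n n'. N \<le> n \<Longrightarrow> N \<le> n' \<Longrightarrow> R \<le> gp m (x n) (x n')"
    using gromov_seq_gp_base[OF assms, of R] by blast
  then have "R \<le> wdist m (x n)" if "N \<le> n" for n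
    using that gp_self[of m "x n"] gromov_seq_carrier assms by metis
  then show ?thesis by blast
qed

text \<open>Up to constants, \<open>gp \<one> x y\<close> is the distance from the identity to a
  center of \<open>\<one>\<close>, \<open>x\<close>, \<open>y\<close>. Automorphisms send centers to
  centers by \<open>iso_center\<close>, fix the identity and are bi-Lipschitz, so large products
  have large images.\<close>

lemma gromov_seq_iso:
  assumes f: "f \<in> iso G G" and x: "gromov_seq x"
  shows "gromov_seq (\<lambda>n. f (x n))"
proof -
  obtain L :: real where L: "1 \<le> L"
    "\<And>x y. x \<in> carrier G \<Longrightarrow> y \<in> carrier G \<Longrightarrow> wdist (f x) (f y) \<le> L * wdist x y"
    "\<And>x y. x \<in> carrier G \<Longrightarrow> y \<in> carrier G \<Longrightarrow> wdist x y \<le> L * wdist (f x) (f y)"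
    using iso_bilipschitz[OF finite_S f] by blast
  have "f \<in> hom G G" using f unfolding iso_def by simp
  then interpret f: group_hom G G f by unfold_locales
  have "0 \<le> 1 + \<delta>" using delta_nonneg by simp
  obtain D where D: "\<And>m x y z. m \<in> carrier G \<Longrightarrow> x \<in> carrier G \<Longrightarrow> y \<in> carrier G \<Longrightarrow>
      z \<in> carrier G \<Longrightarrow> center (1 + \<delta>) m x y z \<Longrightarrow> center D (f m) (f x) (f y) (f z)"
    using iso_center[OF f \<open>0 \<le> 1 + \<delta>\<close>] by blast
  have key: "gp \<one> x y \<le> L * (gp \<one> (f x) (f y) + D + \<delta>) + 1 + \<delta>"
    if xy: "x \<in> carrier G" "y \<in> carrier G" for x y
  proof -
    obtain p where p: "p \<in> carrier G" "center (1 + \<delta>) p \<one> x y"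
      using center_exists[of \<one> x y] xy by blast
    have fp: "gp (f p) \<one> (f x) \<le> D" "gp (f p) \<one> (f y) \<le> D"
      using D[of p \<one> x y] p xy unfolding center_def by auto
    have "gp \<one> (f p) (f x) = wdist \<one> (f p) - gp (f p) \<one> (f x)"
      "gp \<one> (f p) (f y) = wdist \<one> (f p) - gp (f p) \<one> (f y)"
      using gp_swap[of \<one> "f p" "f x"] gp_swap[of \<one> "f p" "f y"] p xy by auto
    then have "wdist \<one> (f p) - D - \<delta> \<le> gp \<one> (f x) (f y)"
      using four_point[of \<one> "f x" "f p" "f y"] gp_sym[of "f x" "f p" \<one>] p xy fp by simp
    then have "L * wdist \<one> (f p) \<le> L * (gp \<one> (f x) (f y) + D + \<delta>)"
      using L(1) by (intro mult_left_mono) auto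
    moreover have "wdist \<one> p \<le> L * wdist \<one> (f p)" using L(3)[of \<one> p] p by simp
    moreover have "gp \<one> x y \<le> 1 + \<delta> + wdist \<one> p"
      using gp_base[of \<one> p x y] p xy unfolding center_def by simp
    ultimately show ?thesis by linarith
  qed
  have "\<exists>N. \<forall>n\<ge>N. \<forall>m\<ge>N. R \<le> gp \<one> (f (x n)) (f (x m))" for R
  proof -
    obtain N where N: "\<And>n m. N \<le> n \<Longrightarrow> N \<le> m \<Longrightarrow> L * (R + D + \<delta>) + 1 + \<delta> \<le> gp \<one> (x n) (x m)"
      using gromov_seqD[OF x, of "L * (R + D + \<delta>) + 1 + \<delta>"] by blast
    have "R \<le> gp \<one> (f (x n)) (f (x m))" if "N \<le> n" "N \<le> m" for n m
    proof -
      have "L * (R + D + \<delta>) \<le> L * (gp \<one> (f (x n)) (f (x m)) + D + \<delta>)"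
        using N[OF that] key[of "x n" "x m"] gromov_seq_carrier[OF x] by force
      then show ?thesis using L(1) by simp
    qed
    then show ?thesis by blast
  qed
  then show ?thesis unfolding gromov_seq_def using gromov_seq_carrier[OF x] by auto
qed

text \<open>The new constant does not depend on \<open>r\<close>. Far from \<open>m\<close>, a
  displacement of a vertex by \<open>r\<close> is invisible up to one \<delta>, and each product
  involves two vertices. This makes the error of the equivariant map under \<open>K\<close>
  uniform.\<close>

lemma limit_center_perturb:
  assumes "gromov_seq x" "gromov_seq x'" "limit_center C m x y z" "m \<in> carrier G"
    and "gromov_seq y" "gromov_seq y'" "gromov_seq z" "gromov_seq z'"
    and near: "\<And>n. wdist (x n) (x' n) \<le> r" "\<And>n. wdist (y n) (y' n) \<le> r" "\<And>n. wdist (z n) (z' n) \<le> r"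
  shows "limit_center (C + 2 * \<delta>) m x' y' z'"
proof -
  note c = gromov_seq_carrier[OF assms(1)] gromov_seq_carrier[OF assms(2)]
    gromov_seq_carrier[OF assms(5)] gromov_seq_carrier[OF assms(6)]
    gromov_seq_carrier[OF assms(7)] gromov_seq_carrier[OF assms(8)]
  define R where "R = C + 2 * \<delta> + r + 1"
  obtain N0 where N0: "\<And>n. N0 \<le> n \<Longrightarrow> center C m (x n) (y n) (z n)"
    using assms(3) unfolding limit_center_def by blast
  obtain N1 where N1: "\<And>n. N1 \<le> n \<Longrightarrow> R \<le> wdist m (x n)" using gromov_seq_dist[OF assms(1,4), of R] by blast
  obtain N2 where N2: "\<And>n. N2 \<le> n \<Longrightarrow> R \<le> wdist m (y n)" using gromov_seq_dist[OF assms(5,4), of R] by blast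
  obtain N3 where N3: "\<And>n. N3 \<le> n \<Longrightarrow> R \<le> wdist m (z n)" using gromov_seq_dist[OF assms(7,4), of R] by blast
  have two: "gp m a' b' \<le> C + 2 * \<delta>"
    if "a \<in> carrier G" "b \<in> carrier G" "a' \<in> carrier G" "b' \<in> carrier G" "gp m a b \<le> C"
      "R \<le> wdist m a" "R \<le> wdist m b" "wdist a a' \<le> r" "wdist b b' \<le> r" for a b a' b'
  proof -
    have "gp m a' b \<le> C + \<delta>"
      by (rule gp_perturb[of m a]) (use that assms(4) gp_ge[of m a a'] delta_nonneg in \<open>auto simp: R_def\<close>)
    then have "gp m b a' \<le> C + \<delta>" using gp_sym that by metis
    then have "gp m b' a' \<le> C + \<delta> + \<delta>"
      by (rule gp_perturb[of m b, rotated 4]) (use that assms(4) gp_ge[of m b b'] in \<open>auto simp: R_def\<close>)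
    then show ?thesis using gp_sym that by force
  qed
  have "center (C + 2 * \<delta>) m (x' n) (y' n) (z' n)" if "max (max N0 N1) (max N2 N3) \<le> n" for n
    using that N0[of n] N1[of n] N2[of n] N3[of n] c near unfolding center_def
    using two[of "x n" "y n" "x' n" "y' n"] two[of "y n" "z n" "y' n" "z' n"]
      two[of "x n" "z n" "x' n" "z' n"] by simp
  then show ?thesis unfolding limit_center_def by blast
qed

text \<open>An arbitrary \<open>C\<close> is traded for a universal constant: far out, a center of a
  single finite triple stays within \<open>r\<close> of the identity by
  \<open>center_unique\<close>, so replacing the triple by any later one costs only two \<delta>.
  The universal constant later makes the choice of a center for each \<open>g\<close> uniform in
  \<open>g\<close>.\<close>

lemma limit_center_exists:
  assumes x: "gromov_seq x" and y: "gromov_seq y" and z: "gromov_seq z"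
    and C: "limit_center C \<one> x y z"
  obtains m where "m \<in> carrier G" "limit_center (1 + 3 * \<delta>) m x y z"
proof -
  note c = gromov_seq_carrier[OF x] gromov_seq_carrier[OF y] gromov_seq_carrier[OF z]
  obtain N0 where N0: "\<And>n. N0 \<le> n \<Longrightarrow> center C \<one> (x n) (y n) (z n)"
    using C unfolding limit_center_def by blast
  define r where "r = C + 1 + 3 * \<delta>"
  define R where "R = r + 2 + 3 * \<delta>"
  obtain N1 where N1: "\<And>n n'. N1 \<le> n \<Longrightarrow> N1 \<le> n' \<Longrightarrow> R \<le> gp \<one> (x n) (x n')"
    using gromov_seqD[OF x, of R] by blast
  obtain N2 where N2: "\<And>n n'. N2 \<le> n \<Longrightarrow> N2 \<le> n' \<Longrightarrow> R \<le> gp \<one> (y n) (y n')"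
    using gromov_seqD[OF y, of R] by blast
  obtain N3 where N3: "\<And>n n'. N3 \<le> n \<Longrightarrow> N3 \<le> n' \<Longrightarrow> R \<le> gp \<one> (z n) (z n')"
    using gromov_seqD[OF z, of R] by blast
  define N where "N = max (max N0 N1) (max N2 N3)"
  obtain m where m: "m \<in> carrier G" "center (1 + \<delta>) m (x N) (y N) (z N)"
    using center_exists[of "x N" "y N" "z N"] c by blast
  have "wdist \<one> m \<le> r"
    using center_unique[of "x N" "y N" "z N" \<one> m C "1 + \<delta>"] N0[of N] m c unfolding r_def N_def by simp
  then have big: "1 + 2 * \<delta> + \<delta> < gp m a b" if "R \<le> gp \<one> a b" "a \<in> carrier G" "b \<in> carrier G" for a b
    using gp_base[of \<one> m a b] that m unfolding R_def by auto
  have two: "gp m a' b' \<le> 1 + 3 * \<delta>"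
    if "a \<in> carrier G" "b \<in> carrier G" "a' \<in> carrier G" "b' \<in> carrier G" "gp m a b \<le> 1 + \<delta>"
      "R \<le> gp \<one> a a'" "R \<le> gp \<one> b b'" for a b a' b'
  proof -
    have "gp m a' b \<le> 1 + \<delta> + \<delta>"
      by (rule gp_perturb[of m a]) (use that m big[of a a'] delta_nonneg in auto)
    then have "gp m b a' \<le> 1 + 2 * \<delta>" using gp_sym that by force
    then have "gp m b' a' \<le> 1 + 2 * \<delta> + \<delta>"
      by (rule gp_perturb[of m b, rotated 4]) (use that m big[of b b'] in auto)
    then show ?thesis using gp_sym that by force
  qed
  have "center (1 + 3 * \<delta>) m (x n) (y n) (z n)" if "N \<le> n" for n
    using that m N1[of N n] N2[of N n] N3[of N n] c unfolding center_def N_def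
    using two[of "x N" "y N" "x n" "y n"] two[of "y N" "z N" "y n" "z n"]
      two[of "x N" "z N" "x n" "z n"] by (simp add: N_def)
  then show ?thesis using that m unfolding limit_center_def by blast
qed

lemma limit_center_unique:
  assumes "gromov_seq x" "gromov_seq y" "gromov_seq z" "m \<in> carrier G" "m' \<in> carrier G"
    and "limit_center C m x y z" "limit_center C' m' x y z"
  shows "wdist m m' \<le> C + C' + 2 * \<delta>"
proof -
  obtain N where "\<And>n. N \<le> n \<Longrightarrow> center C m (x n) (y n) (z n)"
    using assms(6) unfolding limit_center_def by blast
  moreover obtain N' where "\<And>n. N' \<le> n \<Longrightarrow> center C' m' (x n) (y n) (z n)"
    using assms(7) unfolding limit_center_def by blast
  ultimately show ?thesis
    using center_unique[of "x (max N N')" "y (max N N')" "z (max N N')" m m' C C']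
      gromov_seq_carrier assms(1-5) by simp
qed

subsection \<open>Loxodromic elements\<close>

lemma int_pow_Suc_right:
  assumes "g \<in> carrier G"
  shows "g [^] (i + 1 :: int) = g [^] i \<otimes> g" "g [^] (i - 1 :: int) = g [^] i \<otimes> inv g"
  using int_pow_mult[OF assms, of i 1] int_pow_mult[OF assms, of i "-1"] assms
  by (simp_all add: int_pow_1 int_pow_neg)

text \<open>The angle at each power of \<open>g\<close> is a translate of the one at the identity,
  so the powers form a chain to which the local-to-global principle applies. The bound on
  \<open>len g\<close> is the one that both the angle and the distance estimate require.\<close>

lemma
  assumes g: "g \<in> carrier G" "gp \<one> (inv g) g \<le> a" "0 \<le> a" "2 * a + 3 * \<delta> + 1 \<le> len g"
  shows powers_gp: "i \<le> l \<Longrightarrow> l \<le> j \<Longrightarrow> gp (g [^] (l::int)) (g [^] i) (g [^] j) \<le> a + 2 * \<delta>"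
    and powers_dist: "i \<le> j \<Longrightarrow> real_of_int (j - i) \<le> wdist (g [^] i) (g [^] j)"
proof -
  define x where "x i k = g [^] (i + int k)" for i :: int and k
  have c: "x i k \<in> carrier G" for i k unfolding x_def using g by simp
  have step: "wdist (x i k) (x i (Suc k)) = len g" for i k
    using int_pow_Suc_right(1)[OF g(1), of "i + int k"] g c[of i k]
    by (simp add: x_def add.commute add.left_commute)
  have turn: "gp (x i (Suc k)) (x i k) (x i (Suc (Suc k))) \<le> a" for i k
  proof -
    have "x i k = x i (Suc k) \<otimes> inv g" "x i (Suc (Suc k)) = x i (Suc k) \<otimes> g"
      using int_pow_Suc_right[OF g(1), of "i + int (Suc k)"]
      by (simp_all add: x_def add.commute add.left_commute)
    then show ?thesis using gp_left[of "x i (Suc k)" \<one> "inv g" g] c g by simp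
  qed
  have long: "2 * a + 3 * \<delta> < wdist (x i k) (x i (Suc k))" for i k
    using step g(4) by simp
  have long': "2 * a + 2 * \<delta> + 1 \<le> wdist (x i k) (x i (Suc k))" for i k
    using step g(4) delta_nonneg by simp
  show "gp (g [^] l) (g [^] i) (g [^] j) \<le> a + 2 * \<delta>" if "i \<le> l" "l \<le> j" for i l j :: int
    using local_to_global[of "nat (j - i)" "x i" a 0 "nat (l - i)" "nat (j - i)"]
      c turn long g(3) that by (simp add: x_def)
  show "real_of_int (j - i) \<le> wdist (g [^] i) (g [^] j)" if "i \<le> j" for i j :: int
    using local_to_global_dist[of "nat (j - i)" "x i" a] c turn long' g(3) that by (simp add: x_def)
qed

text \<open>
  On a long geodesic two segments of length \<open>r\<close> carry the same word by the pigeonhole principle;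
  the element moving the first one to the second one keeps its direction.
\<close>

lemma loxodromic_exists:
  assumes inf: "infinite (carrier G)"
  obtains g where "g \<in> carrier G" "gp \<one> (inv g) g \<le> \<delta>" "R \<le> real (len g)"
proof -
  \<comment> \<open>The two segments will not overlap, so \<open>len g\<close> is at least
    \<open>r\<close> and hence at least \<open>R\<close>; that \<open>r\<close> exceeds \<delta>
    makes the direction argument at the end work.\<close>
  define r where "r = nat \<lceil>R\<rceil> + nat \<lceil>\<delta>\<rceil> + 1"
  have r: "R \<le> r" "\<delta> < r" unfolding r_def using delta_nonneg by linarith+
  define U where "U = {g \<in> carrier G. len g \<le> r}"
  have finU: "finite U" unfolding U_def by (rule finite_len_ball[OF finite_S])
  define K where "K = card U"
  define n where "n = (K + 1) * r"
  have "\<not> carrier G \<subseteq> {g \<in> carrier G. len g \<le> n}"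
    using inf finite_len_ball[OF finite_S, of n] finite_subset by blast
  then obtain h where h: "h \<in> carrier G" "n \<le> len h" by force
  obtain c where c: "c 0 = \<one>" "c (len h) = h" "\<And>k. c k \<in> carrier G"
    "\<And>i j. i \<le> j \<Longrightarrow> j \<le> len h \<Longrightarrow> len (inv (c i) \<otimes> c j) = j - i"
    using len_geodesic[OF h(1)] by blast
  define u where "u k = inv (c (k * r)) \<otimes> c (k * r + r)" for k
  have kr: "k * r + r \<le> len h" if "k \<le> K" for k
  proof -
    have "k * r + r \<le> K * r + r" using that by simp
    also have "\<dots> = n" unfolding n_def by simp
    finally show ?thesis using h by simp
  qed
  have "u ` {..K} \<subseteq> U"
    using c kr unfolding U_def u_def by auto
  then have "\<not> inj_on u {..K}"
    using card_inj_on_le[of u "{..K}" U] finU unfolding K_def by auto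
  then obtain k k' where k: "k < k'" "k' \<le> K" "u k = u k'"
    unfolding inj_on_def by (metis atMost_iff linorder_neqE_nat)
  define i where "i = k * r"
  define i' where "i' = k' * r"
  have "Suc k * r \<le> k' * r" using k by (intro mult_le_mono1) simp
  then have i: "i + r \<le> i'" "i' + r \<le> len h" using kr[OF k(2)] unfolding i_def i'_def by auto
  define g where "g = inv (c i) \<otimes> c i'"
  define v where "v = inv (c i) \<otimes> c (i + r)"
  have v': "v = inv (c i') \<otimes> c (i' + r)" using k(3) unfolding u_def v_def i_def i'_def .
  have gv: "g \<in> carrier G" "v \<in> carrier G" unfolding g_def v_def using c by auto
  have w: "wdist (c a) (c b) = real (b - a)" if "a \<le> b" "b \<le> len h" for a b
    using c that by (simp add: word_dist_def)
  have eq: "c i \<otimes> g = c i'" "c i \<otimes> v = c (i + r)" "c i' \<otimes> inv g = c i"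
    using c(3) unfolding g_def v_def by (simp_all add: inv_mult_group m_assoc[symmetric])
  have eq': "c i' \<otimes> v = c (i' + r)"
    using c(3) unfolding v' by (simp add: m_assoc[symmetric])
  have "gp \<one> g v = gp (c i) (c i') (c (i + r))"
    using gp_left[of "c i" \<one> g v] c gv eq by simp
  also have "\<dots> = r"
    using w[of i i'] w[of i "i + r"] w[of "i + r" i'] i d_sym c by (simp add: gromov_product_def)
  finally have 1: "gp \<one> g v = r" .
  have "gp \<one> (inv g) v = gp (c i') (c i) (c (i' + r))"
    using gp_left[of "c i'" \<one> "inv g" v] c gv eq eq' by simp
  also have "\<dots> = 0"
    using w[of i i'] w[of i' "i' + r"] w[of i "i' + r"] i d_sym[OF c(3) c(3), of "i' + r" i']
    by (simp add: gromov_product_def)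
  finally have 2: "gp \<one> (inv g) v = 0" .
  \<comment> \<open>The common segment \<open>v\<close> points in the direction of \<open>g\<close>
    (product \<open>r\<close>) and away from \<open>inv g\<close> (product 0). As \<delta> is less
    than \<open>r\<close>, the minimum is attained by the product of \<open>inv g\<close> and
    \<open>g\<close>.\<close>
  have "min (gp \<one> (inv g) g) (gp \<one> g v) - \<delta> \<le> gp \<one> (inv g) v"
    by (rule four_point) (use gv in auto)
  then have "gp \<one> (inv g) g \<le> \<delta>" using 1 2 r by linarith
  moreover have "len g = i' - i" unfolding g_def using c i by simp
  then have "R \<le> real (len g)" using i r by linarith
  ultimately show ?thesis using that gv by blast
qed

text \<open>A ball meets only finitely many right cosets, so some coset avoids it; its shortest
  element is far from the identity and cannot be shortened by powers of \<open>g\<close>.\<close>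

lemma shortest_in_coset_exists:
  assumes g: "g \<in> carrier G" and inf: "infinite (rcosets (generate G {g}))"
  obtains k where "k \<in> carrier G" "R \<le> real (len k)" "\<And>j::int. len k \<le> len (g [^] j \<otimes> k)"
proof -
  let ?H = "generate G {g}"
  define B where "B = {k \<in> carrier G. len k \<le> nat \<lceil>R\<rceil>}"
  have H: "subgroup ?H G" using generate_is_subgroup[of "{g}"] g by simp
  have "finite ((\<lambda>k. ?H #> k) ` B)" unfolding B_def using finite_len_ball[OF finite_S] by simp
  then have "\<not> rcosets ?H \<subseteq> (\<lambda>k. ?H #> k) ` B" using inf finite_subset by blast
  then obtain h where h: "h \<in> carrier G" "?H #> h \<notin> (\<lambda>k. ?H #> k) ` B"
    unfolding RCOSETS_def by blast
  define k where "k = arg_min len (\<lambda>x. x \<in> ?H #> h)"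
  have "h \<in> ?H #> h" using rcos_self[OF h(1) H] .
  then have k: "k \<in> ?H #> h" unfolding k_def by (rule arg_min_natI)
  have min: "len k \<le> len x" if "x \<in> ?H #> h" for x
    unfolding k_def using that by (rule arg_min_nat_le)
  have kc: "k \<in> carrier G"
    using k r_coset_subset_G[OF subgroup.subset[OF H] h(1)] by blast
  have eq: "?H #> h = ?H #> k" using repr_independence[OF k h(1) H] .
  have "k \<notin> B" using h(2) eq by blast
  then have "R \<le> real (len k)" using kc unfolding B_def by simp linarith
  moreover have "len k \<le> len (g [^] j \<otimes> k)" for j :: int
  proof (rule min)
    have gj: "g [^] j \<in> ?H" unfolding generate_pow[OF g] by (intro CollectI exI conjI UNIV_I) (rule refl)
    show "g [^] j \<otimes> k \<in> ?H #> h"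
      unfolding eq using rcosI[OF gj subgroup.subset[OF H] kc] .
  qed
  ultimately show ?thesis using that kc by blast
qed

text \<open>If \<open>k\<close> followed the powers of \<open>g\<close> for a distance
  \<open>c\<close>, the power \<open>g [^] int j\<close> of length about \<open>c\<close> would be
  close to a geodesic from the identity to \<open>k\<close>. Multiplying by its inverse would
  shorten \<open>k\<close> by about \<open>c - len g - 8 * \<delta>\<close>, against minimality.
  Three of the four \<delta> that are doubled come from \<open>powers_gp\<close>, one from the
  four-point condition.\<close>

lemma shortest_gp_powers:
  assumes g: "g \<in> carrier G" "gp \<one> (inv g) g \<le> \<delta>" "5 * \<delta> + 1 \<le> len g"
    and k: "k \<in> carrier G" "\<And>j::int. len k \<le> len (g [^] j \<otimes> k)"
  shows "gp \<one> k (g [^] int n) \<le> len g + 8 * \<delta>"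
proof -
  define c where "c = gp \<one> k (g [^] int n)"
  have gc: "g [^] (i::int) \<in> carrier G" for i using g by simp
  have cn: "c \<le> len (g [^] int n)"
    unfolding c_def using gp_le_right[of \<one> k "g [^] int n"] k gc by simp
  have c0: "0 \<le> c" unfolding c_def using gp_nonneg k gc by simp
  define j where "j = (LEAST j. c \<le> len (g [^] int j))"
  have j: "c \<le> len (g [^] int j)" unfolding j_def by (rule LeastI[of _ n]) (rule cn)
  have jn: "j \<le> n" unfolding j_def by (rule Least_le) (rule cn)
  have j': "len (g [^] int j) \<le> c + len g"
  proof (cases j)
    case 0
    then show ?thesis using c0 by simp
  next
    case (Suc i)
    then have "len (g [^] int i) < c"
      using not_less_Least[of i "\<lambda>j. c \<le> len (g [^] int j)"] unfolding j_def by auto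
    moreover have "g [^] int j = g [^] int i \<otimes> g"
      using int_pow_Suc_right(1)[OF g(1), of "int i"] Suc by (simp add: add.commute)
    then have "len (g [^] int j) \<le> len (g [^] int i) + len g" using len_mult[OF gc g(1)] by simp
    ultimately show ?thesis by linarith
  qed
  have "gp (g [^] int j) (g [^] (0::int)) (g [^] int n) \<le> \<delta> + 2 * \<delta>"
    by (rule powers_gp) (use g delta_nonneg jn in auto)
  then have "len (g [^] int j) - 3 * \<delta> \<le> gp \<one> (g [^] int j) (g [^] int n)"
    using gp_swap[of \<one> "g [^] int j" "g [^] int n"] gc by simp
  then have "c - 3 * \<delta> - \<delta> \<le> gp \<one> k (g [^] int j)"
    using four_point[of \<one> k "g [^] int n" "g [^] int j"] gp_sym[OF gc gc, of \<one> "int n" "int j"]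
      gc k j delta_nonneg unfolding c_def by auto
  then have "wdist k (g [^] int j) \<le> len k + len (g [^] int j) - 2 * (c - 4 * \<delta>)"
    using d_sym[of \<one>] k gc by (simp add: gromov_product_def)
  moreover have "wdist k (g [^] int j) = len (g [^] (- int j) \<otimes> k)"
    using d_sym[OF k(1) gc, of "int j"] k g by (simp add: word_dist_def int_pow_neg)
  moreover have "real (len k) \<le> len (g [^] (- int j) \<otimes> k)" using k(2)[of "- int j"] by simp
  ultimately have "real (len k) \<le> len k + (c + len g) - 2 * (c - 4 * \<delta>)" using j' by simp
  then show ?thesis unfolding c_def[symmetric] by simp
qed

lemma powers_gromov_seq:
  assumes g: "g \<in> carrier G" "gp \<one> (inv g) g \<le> \<delta>" "5 * \<delta> + 1 \<le> len g"
  shows "gromov_seq (\<lambda>n. g [^] int n)"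
proof -
  have gc: "g [^] (i::int) \<in> carrier G" for i using g by simp
  have key: "real n - 3 * \<delta> \<le> gp \<one> (g [^] int n) (g [^] int m)" if "n \<le> m" for n m
  proof -
    have "gp (g [^] int n) (g [^] (0::int)) (g [^] int m) \<le> \<delta> + 2 * \<delta>"
      by (rule powers_gp) (use g delta_nonneg that in auto)
    moreover have "real_of_int (int n - 0) \<le> wdist (g [^] (0::int)) (g [^] int n)"
      by (rule powers_dist[of g \<delta>]) (use g delta_nonneg in auto)
    ultimately show ?thesis using gp_swap[of \<one> "g [^] int n" "g [^] int m"] gc by simp
  qed
  have "R \<le> gp \<one> (g [^] int n) (g [^] int m)"
    if "nat \<lceil>R + 3 * \<delta>\<rceil> \<le> n" "nat \<lceil>R + 3 * \<delta>\<rceil> \<le> m" for R n m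
  proof (cases "n \<le> m")
    case True
    then show ?thesis using key[OF True] that by linarith
  next
    case False
    then show ?thesis using key[of m n] that gp_sym[OF gc gc, of \<one> "int n" "int m"] by linarith
  qed
  then show ?thesis unfolding gromov_seq_def using gc by blast
qed

text \<open>
  The third sequence is \<open>k g\<^sup>n\<close> or \<open>k g\<^sup>-\<^sup>n\<close> for an element \<open>k\<close> far from the powers of \<open>g\<close>, with
  the sign chosen so that the sequence leads away from the identity.
\<close>

lemma ideal_triple_exists:
  assumes inf: "\<not> virtually_cyclic G"
  obtains C x y z where "0 \<le> C" "gromov_seq x" "gromov_seq y" "gromov_seq z" "limit_center C \<one> x y z"
proof -
  have "infinite (carrier G)"
  proof
    assume "finite (carrier G)"
    moreover have "rcosets (generate G {\<one>}) \<subseteq> (\<lambda>a. generate G {\<one>} #> a) ` carrier G"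
      unfolding RCOSETS_def by blast
    ultimately show False
      using inf unfolding virtually_cyclic_def by (meson finite_imageI finite_subset one_closed)
  qed
  then obtain g where g: "g \<in> carrier G" "gp \<one> (inv g) g \<le> \<delta>" "7 * \<delta> + 1 \<le> len g"
    using loxodromic_exists[of "7 * \<delta> + 1"] by blast
  have g5: "5 * \<delta> + 1 \<le> len g" using g delta_nonneg by simp
  define g' where "g' = inv g"
  have g': "g' \<in> carrier G" "gp \<one> (inv g') g' \<le> \<delta>" "5 * \<delta> + 1 \<le> len g'" "len g' = len g"
    using g g5 gp_sym[of g "inv g" \<one>] len_inv[of g] unfolding g'_def by auto
  define C where "C = len g + 8 * \<delta>"
  \<comment> \<open>This makes the first edge of the chain \<open>w\<close> below at least
    \<open>7 * \<delta> + 1\<close> long, and makes \<open>gp \<one> k (z n)\<close>, which is at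
    least \<open>len k - 4 * \<delta>\<close>, exceed \<open>C + \<delta>\<close>.\<close>
  define R where "R = C + 7 * \<delta> + 1"
  have "infinite (rcosets (generate G {g}))" using inf g(1) unfolding virtually_cyclic_def by blast
  then obtain k where k: "k \<in> carrier G" "R \<le> real (len k)" "\<And>j::int. len k \<le> len (g [^] j \<otimes> k)"
    using shortest_in_coset_exists[OF g(1), of R] by blast
  have k': "len k \<le> len (g' [^] j \<otimes> k)" for j :: int
    using k(3)[of "-j"] g(1) unfolding g'_def by (simp add: int_pow_inv int_pow_neg)
  have gpk: "gp \<one> k (g [^] int n) \<le> C" "gp \<one> k (g' [^] int n) \<le> C" for n
    using shortest_gp_powers[OF g(1,2) g5 k(1,3)] shortest_gp_powers[OF g'(1,2,3) k(1) k'] g'(4)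
    unfolding C_def by auto
  \<comment> \<open>The directions from \<open>k\<close> to \<open>k \<otimes> g\<close> and to
    \<open>k \<otimes> g'\<close> diverge, so at most one of them can point back to the
    identity.\<close>
  have "min (gp k (k \<otimes> g) \<one>) (gp k \<one> (k \<otimes> g')) - \<delta> \<le> gp k (k \<otimes> g) (k \<otimes> g')"
    by (rule four_point) (use g g' k in auto)
  moreover have "gp k (k \<otimes> g) (k \<otimes> g') \<le> \<delta>"
    using gp_left[of k \<one> g g'] gp_sym[of g "inv g" \<one>] g g' k unfolding g'_def by simp
  ultimately have "gp k \<one> (k \<otimes> g) \<le> 2 * \<delta> \<or> gp k \<one> (k \<otimes> g') \<le> 2 * \<delta>"
    using gp_sym[of \<one> "k \<otimes> g" k] g k by auto
  then obtain h where h: "h \<in> carrier G" "gp \<one> (inv h) h \<le> \<delta>" "7 * \<delta> + 1 \<le> len h" "gp k \<one> (k \<otimes> h) \<le> 2 * \<delta>"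
    using g g' by metis
  \<comment> \<open>The chain identity, \<open>k\<close>, \<open>k h\<close>,
    \<open>k h\<^sup>2\<close> and so on. All its angles are at most \<open>2 * \<delta>\<close>,
    and edges of length \<open>7 * \<delta> + 1\<close> are what the local-to-global principle asks
    for at that angle.\<close>
  define w where "w n = (if n = 0 then \<one> else k \<otimes> h [^] (int n - 1))" for n
  have wc: "w n \<in> carrier G" for n unfolding w_def using h k by simp
  have turn: "gp (w (Suc i)) (w i) (w (Suc (Suc i))) \<le> 2 * \<delta>" for i
  proof (cases i)
    case 0
    then show ?thesis using h k int_pow_1 unfolding w_def by simp
  next
    case (Suc j)
    define y where "y = h [^] (int j + 1)"
    have y: "y \<in> carrier G" "h [^] (1 + int j) = y" "h [^] int j = y \<otimes> inv h" "h [^] (int j + 2) = y \<otimes> h"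
      using h int_pow_Suc_right[OF h(1), of "int j + 1"] unfolding y_def by (simp_all add: add.commute)
    have "gp (k \<otimes> y) (k \<otimes> y \<otimes> inv h) (k \<otimes> y \<otimes> h) = gp \<one> (inv h) h"
      using gp_left[of "k \<otimes> y" \<one> "inv h" h] k h y by simp
    moreover have "w i = k \<otimes> y \<otimes> inv h" "w (Suc i) = k \<otimes> y" "w (Suc (Suc i)) = k \<otimes> y \<otimes> h"
      using Suc y h k unfolding w_def by (simp_all add: m_assoc add.commute)
    ultimately show ?thesis using h delta_nonneg by simp
  qed
  have step: "7 * \<delta> + 1 \<le> wdist (w i) (w (Suc i))" for i
  proof (cases i)
    case 0
    then show ?thesis using k g delta_nonneg unfolding w_def R_def C_def by simp
  next
    case (Suc j)
    have "h [^] (int j + 1) = h [^] int j \<otimes> h" using int_pow_Suc_right(1)[OF h(1)] .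
    then have "w (Suc i) = w i \<otimes> h" using Suc h k unfolding w_def by (simp add: m_assoc add.commute)
    then show ?thesis using h wc by simp
  qed
  have step': "2 * (2 * \<delta>) + 3 * \<delta> < wdist (w i) (w (Suc i))"
    "2 * (2 * \<delta>) + 2 * \<delta> + 1 \<le> wdist (w i) (w (Suc i))" for i
    using step[of i] delta_nonneg by linarith+
  have wgp: "gp (w l) (w i) (w j) \<le> 4 * \<delta>" if "i \<le> l" "l \<le> j" for i l j
    using local_to_global[of j w "2 * \<delta>" i l j] wc turn step' delta_nonneg that by simp
  have wd: "real n \<le> wdist \<one> (w n)" for n
    using local_to_global_dist[of n w "2 * \<delta>"] wc turn step' delta_nonneg by (simp add: w_def)
  define z where "z n = w (Suc n)" for n
  have zc: "z n \<in> carrier G" for n unfolding z_def by (rule wc)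
  have zz: "real n - 4 * \<delta> \<le> gp \<one> (z n) (z m)" if "n \<le> m" for n m
    using wgp[of 0 "Suc n" "Suc m"] wd[of "Suc n"] gp_swap[of \<one> "z n" "z m"] zc[of n] zc[of m] that
    unfolding z_def by (simp add: w_def)
  have "R \<le> gp \<one> (z n) (z m)" if "nat \<lceil>R + 4 * \<delta>\<rceil> \<le> n" "nat \<lceil>R + 4 * \<delta>\<rceil> \<le> m" for R n m
  proof (cases "n \<le> m")
    case True
    then show ?thesis using zz[OF True] that by linarith
  next
    case False
    then show ?thesis using zz[of m n] that gp_sym[OF zc zc, of \<one> n m] by linarith
  qed
  then have z: "gromov_seq z" unfolding gromov_seq_def using zc by blast
  \<comment> \<open>Every \<open>z n\<close> follows \<open>k\<close> for longer than
    \<open>k\<close> follows the powers of \<open>g\<close> or \<open>g'\<close>; so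
    \<open>z n\<close> parts from these powers where \<open>k\<close> does, up to \<delta>.\<close>
  have kz: "C + \<delta> < gp \<one> k (z n)" for n
    using wgp[of 0 1 "Suc n"] gp_swap[of \<one> k "z n"] zc[of n] k delta_nonneg
    unfolding z_def R_def by (simp add: w_def)
  have gz: "gp \<one> (z n) (g [^] int n) \<le> C + \<delta>" "gp \<one> (z n) (g' [^] int n) \<le> C + \<delta>" for n
    using gp_perturb[of \<one> k "z n" "g [^] int n" C] gp_perturb[of \<one> k "z n" "g' [^] int n" C]
      gpk kz k zc g g' by auto
  have gg: "gp \<one> (g [^] int n) (g' [^] int n) \<le> C + \<delta>" for n
  proof -
    have "gp (g [^] (0::int)) (g [^] (- int n)) (g [^] int n) \<le> \<delta> + 2 * \<delta>"
      by (rule powers_gp) (use g g5 delta_nonneg in auto)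
    moreover have "g' [^] int n = g [^] (- int n)"
      unfolding g'_def using g by (simp add: int_pow_inv int_pow_neg)
    ultimately show ?thesis
      using gp_sym[of "g [^] int n" "g [^] (- int n)" \<one>] g delta_nonneg unfolding C_def by simp
  qed
  have "center (C + \<delta>) \<one> (g [^] int n) (g' [^] int n) (z n)" for n
    using gz[of n] gg[of n] gp_sym[OF zc[of n]] g g' unfolding center_def by simp
  then have "limit_center (C + \<delta>) \<one> (\<lambda>n. g [^] int n) (\<lambda>n. g' [^] int n) z"
    unfolding limit_center_def by blast
  moreover have "0 \<le> C + \<delta>" unfolding C_def using delta_nonneg by simp
  ultimately show ?thesis
    using that z powers_gromov_seq[OF g(1,2) g5] powers_gromov_seq[OF g'(1,2,3)] by blast
qed

end

section \<open>Walks\<close>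

lemma walk_length_Nil_single [simp]: "walk_length w [] = 0" "walk_length w [v] = 0"
  by (simp_all add: walk_length_def)

lemma walk_length_Cons: "walk_length w (u # v # vs) = w u v + walk_length w (v # vs)"
  unfolding walk_length_def by (simp add: sum.lessThan_Suc_shift del: sum.lessThan_Suc)

lemma walk_length_glue:
  "us \<noteq> [] \<Longrightarrow> vs \<noteq> [] \<Longrightarrow> last us = hd vs \<Longrightarrow>
    walk_length w (us @ tl vs) = walk_length w us + walk_length w vs"
proof (induction us rule: list_nonempty_induct)
  case (single u)
  then show ?case by (cases vs) auto
next
  case (cons u us)
  then show ?case by (cases us) (auto simp: walk_length_Cons)
qed

lemma is_walk_glue:
  assumes "is_walk W E us" "is_walk W E vs" "last us = hd vs"
  shows "is_walk W E (us @ tl vs)"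
  using assms unfolding is_walk_def
  by (cases vs) (auto simp: successively_append_iff successively_Cons)

lemma last_glue: "vs \<noteq> [] \<Longrightarrow> last us = hd vs \<Longrightarrow> last (us @ tl vs) = last vs"
  by (cases vs) (auto simp: last_append)

abbreviation subwalk :: "nat \<Rightarrow> nat \<Rightarrow> 'v list \<Rightarrow> 'v list" where
  "subwalk i j vs \<equiv> drop i (take (Suc j) vs)"

lemma
  assumes "i \<le> j" "j < length vs"
  shows hd_subwalk: "hd (subwalk i j vs) = vs ! i"
    and last_subwalk: "last (subwalk i j vs) = vs ! j"
    and length_subwalk: "length (subwalk i j vs) = Suc j - i"
  using assms by (auto simp: hd_drop_conv_nth last_conv_nth)

lemma last_take_nth: "i < length vs \<Longrightarrow> last (take (Suc i) vs) = vs ! i"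
  by (simp add: take_Suc_conv_app_nth)

lemma split_walk:
  assumes "i < length vs"
  shows "vs = take (Suc i) vs @ tl (drop i vs)"
  using assms by (metis append_take_drop_id drop_Suc tl_drop)

lemma is_walk_take: "is_walk W E vs \<Longrightarrow> 0 < n \<Longrightarrow> is_walk W E (take n vs)"
  unfolding is_walk_def
  by (metis append_take_drop_id less_nat_zero_code set_take_subset subset_trans successively_append_iff
      take_eq_Nil)

lemma is_walk_drop: "is_walk W E vs \<Longrightarrow> n < length vs \<Longrightarrow> is_walk W E (drop n vs)"
  unfolding is_walk_def
  by (metis append_take_drop_id drop_eq_Nil not_le set_drop_subset subset_trans successively_append_iff)

lemma is_walk_subwalk: "is_walk W E vs \<Longrightarrow> i \<le> j \<Longrightarrow> j < length vs \<Longrightarrow> is_walk W E (subwalk i j vs)"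
  by (intro is_walk_drop is_walk_take) auto

lemma is_walk_edge: "is_walk W E vs \<Longrightarrow> Suc i < length vs \<Longrightarrow> (vs ! i, vs ! Suc i) \<in> E"
  unfolding is_walk_def by (simp add: successively_conv_nth)

lemma is_walk_nth: "is_walk W E vs \<Longrightarrow> i < length vs \<Longrightarrow> vs ! i \<in> W"
  unfolding is_walk_def by (meson nth_mem subsetD)

lemma is_walk_mono: "is_walk W E vs \<Longrightarrow> W \<subseteq> W' \<Longrightarrow> is_walk W' E vs"
  unfolding is_walk_def by blast

lemma walk_length_nonneg: "(\<And>u v. 0 \<le> w u v) \<Longrightarrow> 0 \<le> walk_length w vs"
  unfolding walk_length_def by (simp add: sum_nonneg)

lemma walk_length_split:
  assumes "i \<le> j" "j < length vs"
  shows "walk_length w vs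
    = walk_length w (take (Suc i) vs) + walk_length w (subwalk i j vs) + walk_length w (drop j vs)"
proof -
  have split: "walk_length w us = walk_length w (take (Suc k) us) + walk_length w (drop k us)"
    if "k < length us" for k us
  proof -
    have "walk_length w (take (Suc k) us @ tl (drop k us))
        = walk_length w (take (Suc k) us) + walk_length w (drop k us)"
      by (rule walk_length_glue) (use that in \<open>auto simp: take_Suc_conv_app_nth hd_drop_conv_nth\<close>)
    then show ?thesis using split_walk[OF that] by simp
  qed
  show ?thesis
    using split[of j vs] split[of i "take (Suc j) vs"] assms by (simp add: min_absorb1)
qed

lemma walk_length_coned_nat: "\<exists>n::nat. walk_length coned_weight vs = n / 2"
proof (induction vs rule: induct_list012)
  case (3 u v vs)
  then obtain n :: nat where "walk_length coned_weight (v # vs) = n / 2" by auto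
  moreover have "\<exists>k::nat. coned_weight u v = k / 2"
    by (cases u; cases v) (auto intro: exI[of _ 2] exI[of _ 1])
  then obtain k :: nat where "coned_weight u v = k / 2" by auto
  ultimately show ?case by (intro exI[of _ "k + n"]) (simp add: walk_length_Cons add_divide_distrib)
qed (auto intro: exI[of _ 0])

lemma coned_weight_ge: "1 / 2 \<le> coned_weight u v"
  by (cases u; cases v) auto

lemma coned_weight_nonneg: "0 \<le> coned_weight u v"
  using coned_weight_ge[of u v] by linarith

lemma walk_length_coned_nonneg: "0 \<le> walk_length coned_weight vs"
  by (rule walk_length_nonneg) (rule coned_weight_nonneg)

lemma walk_length_coned_ge: "(real (length vs) - 1) / 2 \<le> walk_length coned_weight vs"
proof (induction vs rule: induct_list012)
  case (3 u v vs)
  then show ?case using coned_weight_ge[of u v] by (simp add: walk_length_Cons)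
qed auto

lemma subwalk_length_le:
  assumes "i' \<le> i" "i \<le> j" "j \<le> j'" "j' < length vs"
  shows "walk_length coned_weight (subwalk i j vs) \<le> walk_length coned_weight (subwalk i' j' vs)"
proof -
  have "subwalk (i - i') (j - i') (subwalk i' j' vs) = subwalk i j vs"
    using assms by (simp add: take_drop min_absorb1)
  moreover have "walk_length coned_weight (subwalk (i - i') (j - i') us) \<le> walk_length coned_weight us"
    if "j - i' < length us" for us
    using walk_length_split[of "i - i'" "j - i'" us coned_weight] that assms
      walk_length_coned_nonneg[of "take (Suc (i - i')) us"] walk_length_coned_nonneg[of "drop (j - i') us"]
    by simp
  moreover have "j - i' < length (subwalk i' j' vs)" using assms by simp
  ultimately show ?thesis by metis
qed

section \<open>Shortest walks in induced subgraphs of the coned-off graph\<close>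

definition shortest_walk :: "'a cvertex set \<Rightarrow> ('a cvertex \<times> 'a cvertex) set \<Rightarrow> 'a cvertex list \<Rightarrow> bool" where
  "shortest_walk W E vs \<longleftrightarrow> is_walk W E vs \<and>
     (\<forall>ws. is_walk W E ws \<and> hd ws = hd vs \<and> last ws = last vs \<longrightarrow>
       walk_length coned_weight vs \<le> walk_length coned_weight ws)"

text \<open>All lengths are multiples of one half, so twice the length is a natural number and a
  minimum is attained even though the graph is not locally finite in general.\<close>

lemma shortest_walk_exists:
  assumes "is_walk W E us"
  obtains vs where "shortest_walk W E vs" "hd vs = hd us" "last vs = last us"
proof -
  define P where "P vs \<longleftrightarrow> is_walk W E vs \<and> hd vs = hd us \<and> last vs = last us" for vs
  define f where "f vs = nat \<lfloor>2 * walk_length coned_weight vs\<rfloor>" for vs :: "'a cvertex list"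
  have f: "real (f vs) = 2 * walk_length coned_weight vs" for vs :: "'a cvertex list"
  proof -
    obtain n :: nat where "2 * walk_length coned_weight vs = n"
      using walk_length_coned_nat[of vs] by (metis field_sum_of_halves mult_2)
    then show ?thesis unfolding f_def by simp
  qed
  have "P us" unfolding P_def using assms by simp
  then obtain vs where vs: "P vs" "\<And>ws. P ws \<Longrightarrow> f vs \<le> f ws"
    using ex_has_least_nat[of P us f] by blast
  have "walk_length coned_weight vs \<le> walk_length coned_weight ws" if "P ws" for ws
    using vs(2)[OF that] f[of vs] f[of ws] by linarith
  then show ?thesis using that[of vs] vs(1) unfolding P_def shortest_walk_def by simp
qed

lemma shortest_walk_subwalk:
  assumes vs: "shortest_walk W E vs" and ij: "i \<le> j" "j < length vs"
  shows "shortest_walk W E (subwalk i j vs)"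
  unfolding shortest_walk_def
proof (intro conjI allI impI)
  have w: "is_walk W E vs" using vs unfolding shortest_walk_def by simp
  show "is_walk W E (subwalk i j vs)" using w ij by (rule is_walk_subwalk)
  fix ws
  assume "is_walk W E ws \<and> hd ws = hd (subwalk i j vs) \<and> last ws = last (subwalk i j vs)"
  then have ws: "is_walk W E ws" "hd ws = vs ! i" "last ws = vs ! j" "ws \<noteq> []"
    unfolding hd_subwalk[OF ij] last_subwalk[OF ij] is_walk_def by auto
  define us where "us = take (Suc i) vs @ tl ws"
  have p: "is_walk W E (take (Suc i) vs)" "take (Suc i) vs \<noteq> []" "last (take (Suc i) vs) = vs ! i"
    "hd (take (Suc i) vs) = hd vs"
    using is_walk_take[OF w, of "Suc i"] ij by (auto simp: last_take_nth hd_take)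
  have s: "is_walk W E (drop j vs)" "drop j vs \<noteq> []" "hd (drop j vs) = vs ! j" "last (drop j vs) = last vs"
    using is_walk_drop[OF w] ij by (auto simp: hd_drop_conv_nth)
  have us: "is_walk W E us" "us \<noteq> []" "last us = vs ! j" "hd us = hd vs"
    "walk_length coned_weight us = walk_length coned_weight (take (Suc i) vs) + walk_length coned_weight ws"
    unfolding us_def
    using p ws is_walk_glue[OF p(1) ws(1)] last_glue[OF ws(4), of "take (Suc i) vs"]
      walk_length_glue[OF p(2) ws(4), of coned_weight] by auto
  have "is_walk W E (us @ tl (drop j vs))" "hd (us @ tl (drop j vs)) = hd vs"
    "last (us @ tl (drop j vs)) = last vs"
    using is_walk_glue[OF us(1) s(1)] us last_glue[OF s(2), of us] s by auto
  then have "walk_length coned_weight vs \<le> walk_length coned_weight (us @ tl (drop j vs))"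
    using vs unfolding shortest_walk_def by blast
  also have "\<dots> = walk_length coned_weight us + walk_length coned_weight (drop j vs)"
    by (rule walk_length_glue) (use us s in auto)
  finally show "walk_length coned_weight (subwalk i j vs) \<le> walk_length coned_weight ws"
    using walk_length_split[OF ij, of coned_weight] us(5) by simp
qed

lemma shortest_walk_subwalk_le:
  assumes "shortest_walk W E vs" "i \<le> j" "j < length vs"
    and "is_walk W E ws" "hd ws = vs ! i" "last ws = vs ! j"
  shows "walk_length coned_weight (subwalk i j vs) \<le> walk_length coned_weight ws"
  using shortest_walk_subwalk[OF assms(1-3)] assms(4-6) hd_subwalk[OF assms(2,3)]
    last_subwalk[OF assms(2,3)] unfolding shortest_walk_def by simp

lemma shortest_walk_distinct:
  assumes "shortest_walk W E vs" "i \<le> j" "j < length vs" "vs ! i = vs ! j"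
  shows "i = j"
proof -
  have "is_walk W E [vs ! i]"
    using is_walk_nth[of W E vs i] assms unfolding shortest_walk_def is_walk_def by simp
  then have "walk_length coned_weight (subwalk i j vs) \<le> 0"
    using shortest_walk_subwalk_le[OF assms(1-3), of "[vs ! i]"] assms(4) by simp
  then show ?thesis
    using walk_length_coned_ge[of "subwalk i j vs"] assms(2,3) by (simp add: length_subwalk[OF assms(2,3)])
qed

lemma vertex_dist_le:
  assumes "is_walk V E vs"
  shows "vertex_dist V E coned_weight (hd vs) (last vs) \<le> walk_length coned_weight vs"
  unfolding vertex_dist_def
  by (rule cInf_lower) (use assms walk_length_coned_nonneg in \<open>auto intro!: bdd_belowI[of _ 0]\<close>)

section \<open>The coned-off Cayley graph\<close>

locale coned_off = marked_group G S for G (structure) and S +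
  fixes H :: "'a set"
  assumes H: "subgroup H G"
begin

text \<open>The electric metric on group elements is the word metric of \<open>S \<union> H\<close>,
  see \<open>vdist_Elt\<close>: a passage through a cone vertex has length 1, as has a letter of
  \<open>H\<close>.\<close>

sublocale rel: marked_group G "S \<union> H"
proof
  show "S \<union> H \<subseteq> carrier G" using S_carrier subgroup.subset[OF H] by simp
  then show "generate G (S \<union> H) = carrier G"
    using S_generates mono_generate[of S "S \<union> H"] generate_incl[of "S \<union> H"] by blast
qed

abbreviation V where "V \<equiv> coned_vertices G H"
abbreviation E where "E \<equiv> coned_edges G S H"
abbreviation wl where "wl \<equiv> walk_length coned_weight"
abbreviation vdist where "vdist \<equiv> vertex_dist V E coned_weight"
abbreviation cosets where "cosets \<equiv> lcosets\<^bsub>G\<^esub> H"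

text \<open>The induced subgraph on \<open>U\<close> keeps every cone vertex. Shortcuts through
  cosets thus remain available in it, which is what excludes backtracking.\<close>

definition verts :: "'a set \<Rightarrow> 'a cvertex set" where
  "verts U = Elt ` U \<union> Cone ` cosets"

lemma V_verts: "V = verts (carrier G)"
  by (simp add: coned_vertices_def verts_def)

lemma verts_mono: "U \<subseteq> W \<Longrightarrow> verts U \<subseteq> verts W"
  unfolding verts_def by auto

lemma coset_carrier: "C \<in> cosets \<Longrightarrow> x \<in> C \<Longrightarrow> x \<in> carrier G"
  using subgroup.lcosets_carrier[OF H group_axioms] by blast

lemma coset_eq: "C \<in> cosets \<Longrightarrow> x \<in> C \<Longrightarrow> C = x <# H"
  unfolding LCOSETS_def using l_repr_independence[OF _ _ H] by force

lemma cosets_meet: "C \<in> cosets \<Longrightarrow> C' \<in> cosets \<Longrightarrow> x \<in> C \<Longrightarrow> x \<in> C' \<Longrightarrow> C = C'"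
  using coset_eq by metis

lemma coset_self: "x \<in> carrier G \<Longrightarrow> x \<in> x <# H"
  using lcos_self[OF _ H] .

lemma coset_in: "x \<in> carrier G \<Longrightarrow> x <# H \<in> cosets"
  unfolding LCOSETS_def by blast

lemma in_coset_iff:
  assumes "x \<in> carrier G" "y \<in> carrier G"
  shows "y \<in> x <# H \<longleftrightarrow> inv x \<otimes> y \<in> H"
proof
  assume "y \<in> x <# H"
  then obtain h where "h \<in> H" "y = x \<otimes> h" unfolding l_coset_def by blast
  then show "inv x \<otimes> y \<in> H"
    using assms subgroup.mem_carrier[OF H] by (simp add: m_assoc[symmetric])
next
  assume "inv x \<otimes> y \<in> H"
  moreover have "y = x \<otimes> (inv x \<otimes> y)" using assms by (simp add: m_assoc[symmetric])
  ultimately show "y \<in> x <# H" unfolding l_coset_def by blast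
qed

lemma coset_rel_dist:
  assumes "C \<in> cosets" "x \<in> C" "y \<in> C"
  shows "rel.wdist x y \<le> 1"
proof -
  have xy: "x \<in> carrier G" "y \<in> carrier G" using assms coset_carrier by auto
  then have "inv x \<otimes> y \<in> H" using in_coset_iff[OF xy] coset_eq assms by metis
  then show ?thesis using rel.len_letter[of "inv x \<otimes> y"] by (simp add: word_dist_def)
qed

lemma rel_len_le:
  assumes "g \<in> carrier G"
  shows "rel.len g \<le> len g"
proof -
  have "rel.len s \<le> 1" if "s \<in> S" for s using rel.len_letter[of s] that by simp
  then show ?thesis
    using len_hom_le[OF rel.marked_group_axioms, of id 1 g] assms by (simp add: hom_def)
qed

lemma rel_wdist_le: "x \<in> carrier G \<Longrightarrow> y \<in> carrier G \<Longrightarrow> rel.wdist x y \<le> wdist x y"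
  using rel_len_le[of "inv x \<otimes> y"] by (simp add: word_dist_def)

text \<open>\<open>rep\<close> gives the group elements standing for a vertex and \<open>pad\<close>
  their distance from it; together they let elements and cone vertices be treated by one
  induction.\<close>

definition rep :: "'a cvertex \<Rightarrow> 'a set" where
  "rep v = (case v of Elt x \<Rightarrow> {x} | Cone C \<Rightarrow> C)"

definition pad :: "'a cvertex \<Rightarrow> real" where
  "pad v = (case v of Elt x \<Rightarrow> 0 | Cone C \<Rightarrow> 1 / 2)"

lemma rep_simps [simp]: "rep (Elt x) = {x}" "rep (Cone C) = C" "pad (Elt x) = 0" "pad (Cone C) = 1 / 2"
  by (simp_all add: rep_def pad_def)

lemma rep_carrier: "v \<in> V \<Longrightarrow> x \<in> rep v \<Longrightarrow> x \<in> carrier G"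
  using coset_carrier by (auto simp: coned_vertices_def)

lemma cayley_edge_rel_dist:
  assumes "(x, y) \<in> cayley_edges G S"
  shows "x \<in> carrier G" "y \<in> carrier G" "rel.wdist x y \<le> 1"
proof -
  obtain s where s: "s \<in> S" "x \<in> carrier G" "y \<in> carrier G" "y = x \<otimes> s \<or> x = y \<otimes> s"
    using assms unfolding cayley_edges_def by blast
  show "x \<in> carrier G" "y \<in> carrier G" by fact+
  have sl: "rel.len s \<le> 1" "s \<in> carrier G" using rel.len_letter[of s] s S_carrier by auto
  then have "rel.wdist x y \<le> 1 \<or> rel.wdist y x \<le> 1"
    using s(4) rel.wdist_right s by auto
  then show "rel.wdist x y \<le> 1" using rel.wdist_sym s by metis
qed

text \<open>Half edges at a cone vertex are paid for one at a time: a walk entering a cone has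
  length 1/2 more and \<open>pad\<close> 1/2 more, and leaving it uses up both for one letter of
  \<open>H\<close>.\<close>

lemma walk_rel_dist:
  assumes "is_walk V E vs" "x \<in> rep (hd vs)" "y \<in> rep (last vs)"
  shows "rel.wdist x y \<le> wl vs + pad (hd vs) + pad (last vs)"
  using assms
proof (induction vs arbitrary: x rule: induct_list012)
  case 1
  then show ?case by (simp add: is_walk_def)
next
  case (2 v)
  then have v: "v \<in> V" by (simp add: is_walk_def)
  show ?case
  proof (cases v)
    case (Elt a)
    then show ?thesis using 2 v by (auto simp: coned_vertices_def)
  next
    case (Cone C)
    then have "C \<in> cosets" using v by (auto simp: coned_vertices_def)
    then show ?thesis using 2 Cone coset_rel_dist[of C x y] by simp
  qed
next
  case (3 u v vs)
  have w: "is_walk V E (v # vs)" and uv: "(u, v) \<in> E" "u \<in> V" "v \<in> V"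
    using 3(3) by (auto simp: is_walk_def)
  have yc: "y \<in> carrier G"
    using rep_carrier[of "last (v # vs)" y] is_walk_nth[OF w, of "length vs"] 3(5)
      last_conv_nth[of "v # vs"] by simp
  have xc: "x \<in> carrier G" using rep_carrier uv 3(4) by simp
  have "\<exists>x'\<in>rep v. rel.wdist x x' + pad v \<le> coned_weight u v + pad u"
  proof (cases u)
    case u: (Elt a)
    show ?thesis
    proof (cases v)
      case (Elt b)
      then show ?thesis
        using u uv 3(4) cayley_edge_rel_dist[of a b] by (auto simp: coned_edges_def)
    next
      case (Cone C)
      then show ?thesis
        using u uv 3(4) coset_carrier by (auto simp: coned_edges_def intro!: bexI[of _ a])
    qed
  next
    case u: (Cone C)
    then obtain b where b: "v = Elt b" "C \<in> cosets" "b \<in> C"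
      using uv by (auto simp: coned_edges_def)
    then show ?thesis using u 3(4) coset_rel_dist[of C x b] by simp
  qed
  then obtain x' where x': "x' \<in> rep v" "rel.wdist x x' + pad v \<le> coned_weight u v + pad u" by blast
  have "x' \<in> carrier G" using rep_carrier uv x' by blast
  then have "rel.wdist x y \<le> rel.wdist x x' + rel.wdist x' y" using rel.wdist_triangle xc yc by blast
  moreover have "rel.wdist x' y \<le> wl (v # vs) + pad v + pad (last (v # vs))"
    using "3.IH"(2)[OF w, of x'] x' 3(5) by simp
  ultimately show ?case using x' by (simp add: walk_length_Cons)
qed

lemma E_sym: "(u, v) \<in> E \<Longrightarrow> (v, u) \<in> E"
  unfolding coned_edges_def cayley_edges_def by auto

text \<open>A letter from \<open>H\<close> is walked through the cone vertex and any other letter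
  along a Cayley edge; either way no group element besides \<open>x\<close> and \<open>y\<close> is
  visited, so the walk stays in the subgraph induced by \<open>U\<close>.\<close>

lemma step_walk:
  assumes "x \<in> U" "y \<in> U" "U \<subseteq> carrier G" "rel.wdist x y \<le> 1"
  obtains vs where "is_walk (verts U) E vs" "hd vs = Elt x" "last vs = Elt y" "wl vs \<le> 1"
proof -
  have xy: "x \<in> carrier G" "y \<in> carrier G" using assms by auto
  define g where "g = inv x \<otimes> y"
  have g: "g \<in> carrier G" "rel.len g \<le> 1" using xy assms(4) by (auto simp: g_def word_dist_def)
  have y: "y = x \<otimes> g" unfolding g_def using xy by (simp add: m_assoc[symmetric])
  have "g \<in> H \<or> inv g \<in> H \<or> (g \<in> S \<or> inv g \<in> S)"
    using rel.len_le_1_letter[OF g] subgroup.one_closed[OF H] S_carrier subgroup.subset[OF H]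
    by (auto simp: subset_iff)
  then consider "g \<in> H" | "g \<notin> H" "g \<in> S \<or> inv g \<in> S"
    using subgroup.m_inv_closed[OF H] g by fastforce
  then show ?thesis
  proof cases
    case 1
    have C: "x <# H \<in> cosets" "x \<in> x <# H" "y \<in> x <# H"
      using coset_in coset_self in_coset_iff xy 1 unfolding g_def by auto
    show ?thesis
    proof (rule that[of "[Elt x, Cone (x <# H), Elt y]"])
      show "is_walk (verts U) E [Elt x, Cone (x <# H), Elt y]"
        using C assms(1,2) by (auto simp: is_walk_def verts_def coned_edges_def)
    qed (simp_all add: walk_length_Cons)
  next
    case 2
    have "x \<noteq> y"
    proof
      assume "x = y"
      then have "g = \<one>" unfolding g_def using xy by simp
      then show False using 2(1) subgroup.one_closed[OF H] by simp
    qed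
    moreover have "x = y \<otimes> inv g" using y xy g by (simp add: m_assoc)
    ultimately have "(x, y) \<in> cayley_edges G S"
      using 2(2) xy y unfolding cayley_edges_def by blast
    then show ?thesis using assms(1,2)
      by (intro that[of "[Elt x, Elt y]"]) (auto simp: is_walk_def verts_def coned_edges_def walk_length_Cons)
  qed
qed

lemma chain_walk:
  assumes c: "\<And>k. k \<le> n \<Longrightarrow> c k \<in> carrier G"
    and step: "\<And>k. k < n \<Longrightarrow> rel.wdist (c k) (c (Suc k)) \<le> 1"
    and U: "U = c ` {..n}" and jk: "j \<le> k" "k \<le> n"
  shows "\<exists>vs. is_walk (verts U) E vs \<and> hd vs = Elt (c j) \<and> last vs = Elt (c k) \<and> wl vs \<le> real (k - j)"
  using jk
proof (induction k rule: dec_induct)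
  case base
  then show ?case by (intro exI[of _ "[Elt (c j)]"]) (simp add: is_walk_def verts_def U)
next
  case (step k)
  then obtain us where us: "is_walk (verts U) E us" "hd us = Elt (c j)" "last us = Elt (c k)"
    "wl us \<le> real (k - j)" by auto
  have "U \<subseteq> carrier G" using U c by auto
  then obtain ws where ws: "is_walk (verts U) E ws" "hd ws = Elt (c k)" "last ws = Elt (c (Suc k))" "wl ws \<le> 1"
    using step_walk[of "c k" U "c (Suc k)"] assms(2)[of k] step U by auto
  have ne: "us \<noteq> []" "ws \<noteq> []" using us ws unfolding is_walk_def by auto
  show ?case
  proof (intro exI[of _ "us @ tl ws"] conjI)
    show "is_walk (verts U) E (us @ tl ws)" using is_walk_glue us ws by metis
    show "last (us @ tl ws) = Elt (c (Suc k))" using last_glue ne us ws by metis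
    show "wl (us @ tl ws) \<le> real (Suc k - j)"
      using walk_length_glue[OF ne, of coned_weight] us ws step by (simp add: Suc_diff_le)
  qed (use us ne in simp)
qed

lemma is_walk_rev:
  assumes "is_walk W E vs"
  shows "is_walk W E (rev vs)"
  using assms E_sym unfolding is_walk_def by (auto simp: successively_rev elim: successively_mono)

lemma coned_weight_sym: "coned_weight u v = coned_weight v u"
  by (cases u; cases v) auto

lemma wl_rev: "wl (rev vs) = wl vs"
proof (induction vs rule: induct_list012)
  case (3 u v vs)
  have "wl (rev (u # v # vs)) = wl (rev (v # vs) @ tl [v, u])" by simp
  also have "\<dots> = wl (rev (v # vs)) + wl [v, u]"
    by (rule walk_length_glue) (auto simp: last_rev)
  finally show ?case using 3 coned_weight_sym[of u v] by (simp add: walk_length_Cons)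
qed auto

lemma chain_walk':
  assumes "\<And>k. k \<le> n \<Longrightarrow> c k \<in> carrier G"
    and "\<And>k. k < n \<Longrightarrow> rel.wdist (c k) (c (Suc k)) \<le> 1"
    and "U = c ` {..n}" and jk: "j \<le> n" "k \<le> n"
  shows "\<exists>vs. is_walk (verts U) E vs \<and> hd vs = Elt (c j) \<and> last vs = Elt (c k)
    \<and> wl vs \<le> \<bar>real k - real j\<bar>"
proof (cases "j \<le> k")
  case True
  then show ?thesis using chain_walk[OF assms(1-3) True jk(2)] by (simp add: of_nat_diff)
next
  case False
  then obtain vs where "is_walk (verts U) E vs" "hd vs = Elt (c k)" "last vs = Elt (c j)"
    "wl vs \<le> real (j - k)"
    using chain_walk[OF assms(1-3), of k j] jk by auto
  then show ?thesis using is_walk_rev[of "verts U" vs] False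
    by (intro exI[of _ "rev vs"]) (auto simp: wl_rev hd_rev last_rev is_walk_def of_nat_diff)
qed

lemma vdist_ge:
  assumes "is_walk V E us" "x \<in> rep (hd us)" "y \<in> rep (last us)"
  shows "rel.wdist x y - pad (hd us) - pad (last us) \<le> vdist (hd us) (last us)"
  unfolding vertex_dist_def
proof (rule cInf_greatest)
  show "wl ` {vs. is_walk V E vs \<and> hd vs = hd us \<and> last vs = last us} \<noteq> {}"
    using assms(1) by blast
  show "rel.wdist x y - pad (hd us) - pad (last us) \<le> l"
    if l: "l \<in> wl ` {vs. is_walk V E vs \<and> hd vs = hd us \<and> last vs = last us}" for l
  proof -
    obtain vs where "is_walk V E vs" "hd vs = hd us" "last vs = last us" "l = wl vs"
      using l by auto
    then show ?thesis using walk_rel_dist[of vs x y] assms by simp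
  qed
qed

lemma connected:
  assumes "x \<in> carrier G" "y \<in> carrier G"
  obtains vs where "is_walk V E vs" "hd vs = Elt x" "last vs = Elt y" "wl vs \<le> rel.wdist x y"
proof -
  obtain c n where c: "c 0 = x" "c n = y" "\<And>k. c k \<in> carrier G" "real n = rel.wdist x y"
    "\<And>i j. i \<le> j \<Longrightarrow> j \<le> n \<Longrightarrow> rel.wdist (c i) (c j) = real (j - i)"
    using rel.wdist_geodesic[OF assms] by blast
  have "\<exists>vs. is_walk (verts (c ` {..n})) E vs \<and> hd vs = Elt (c 0) \<and> last vs = Elt (c n) \<and> wl vs \<le> real (n - 0)"
    by (rule chain_walk) (use c in auto)
  moreover have "verts (c ` {..n}) \<subseteq> V" unfolding V_verts using c by (intro verts_mono) auto
  ultimately show ?thesis using that c is_walk_mono by (metis diff_zero)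
qed

lemma vdist_Elt:
  assumes "x \<in> carrier G" "y \<in> carrier G"
  shows "vdist (Elt x) (Elt y) = rel.wdist x y"
proof -
  obtain vs where vs: "is_walk V E vs" "hd vs = Elt x" "last vs = Elt y" "wl vs \<le> rel.wdist x y"
    using connected[OF assms] .
  then show ?thesis using vertex_dist_le[OF vs(1)] vdist_ge[OF vs(1), of x y] by simp
qed

subsection \<open>Bounded coset penetration\<close>

text \<open>Two elements of a coset are joined through its cone vertex by a walk of length 1. A
  shortest walk between them that passes through another vertex therefore has exactly two edges of
  length 1/2, and its middle vertex is the cone of that same coset. The competing walks lie in the
  induced subgraph because \<open>verts U\<close> contains all cone vertices.\<close>

lemma shortest_walk_without_backtracking:
  assumes vs: "shortest_walk (verts U) E vs"
  shows "without_backtracking G H vs"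
  unfolding without_backtracking_def
proof (intro ballI allI impI, elim conjE)
  fix C i j k
  assume C: "C \<in> cosets" and ijk: "i \<le> j" "j \<le> k" "k < length vs"
    and vi: "vs ! i \<in> insert (Cone C) (Elt ` C)" and vk: "vs ! k \<in> insert (Cone C) (Elt ` C)"
  have w: "is_walk (verts U) E vs" using vs unfolding shortest_walk_def by simp
  have ik: "i \<le> k" using ijk by simp
  have ik_vert: "vs ! i \<in> verts U" "vs ! k \<in> verts U"
    using is_walk_nth[OF w] ijk by auto
  have ge: "real (k - i) / 2 \<le> wl (subwalk i k vs)"
    using walk_length_coned_ge[of "subwalk i k vs"] length_subwalk[OF ik ijk(3)] ijk by (simp add: Suc_diff_le)
  show "vs ! j \<in> insert (Cone C) (Elt ` C)"
  proof (cases "j = i \<or> j = k")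
    case True
    then show ?thesis using vi vk by auto
  next
    case False
    then have less: "i < j" "j < k" using ijk by auto
    consider x y where "vs ! i = Elt x" "x \<in> C" "vs ! k = Elt y" "y \<in> C"
      | x where "vs ! i = Elt x" "x \<in> C" "vs ! k = Cone C"
      | y where "vs ! i = Cone C" "vs ! k = Elt y" "y \<in> C"
      | "vs ! i = Cone C" "vs ! k = Cone C"
      using vi vk by auto
    then show ?thesis
    proof cases
      case 1
      have "is_walk (verts U) E [Elt x, Cone C, Elt y]"
        using 1 C ik_vert by (auto simp: is_walk_def verts_def coned_edges_def)
      then have le: "wl (subwalk i k vs) \<le> 1"
        using shortest_walk_subwalk_le[OF vs ik ijk(3), of "[Elt x, Cone C, Elt y]"] 1
        by (simp add: walk_length_Cons)
      then have "k = Suc (Suc i)" using ge less by linarith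
      then have k: "k = Suc j" "j = Suc i" using less by auto
      have sub: "subwalk i k vs = [vs ! i, vs ! j, vs ! k]"
        using ijk k by (intro nth_equalityI) (auto simp: less_Suc_eq numeral_3_eq_3)
      have e: "(vs ! i, vs ! j) \<in> E" using is_walk_edge[OF w, of i] k ijk by simp
      show ?thesis
      proof (cases "vs ! j")
        case (Elt z)
        then show ?thesis using le sub 1 by (simp add: walk_length_Cons)
      next
        case (Cone C')
        then have "C' \<in> cosets" "x \<in> C'" using e 1 by (auto simp: coned_edges_def)
        then show ?thesis using cosets_meet[OF C _ 1(2)] Cone by simp
      qed
    next
      case 2
      have "is_walk (verts U) E [Elt x, Cone C]"
        using 2 C ik_vert by (auto simp: is_walk_def verts_def coned_edges_def)
      then have "wl (subwalk i k vs) \<le> 1 / 2"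
        using shortest_walk_subwalk_le[OF vs ik ijk(3), of "[Elt x, Cone C]"] 2
        by (simp add: walk_length_Cons)
      then show ?thesis using ge less by linarith
    next
      case 3
      have "is_walk (verts U) E [Cone C, Elt y]"
        using 3 C ik_vert by (auto simp: is_walk_def verts_def coned_edges_def)
      then have "wl (subwalk i k vs) \<le> 1 / 2"
        using shortest_walk_subwalk_le[OF vs ik ijk(3), of "[Cone C, Elt y]"] 3
        by (simp add: walk_length_Cons)
      then show ?thesis using ge less by linarith
    next
      case 4
      then show ?thesis using shortest_walk_distinct[OF vs ik ijk(3)] less by simp
    qed
  qed
qed

section \<open>Electric quasigeodesics obtained from chains of group elements\<close>

lemma vdist_nonneg:
  assumes "is_walk V E us"
  shows "0 \<le> vdist (hd us) (last us)"
  unfolding vertex_dist_def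
  by (rule cInf_greatest) (use assms walk_length_coned_nonneg in auto)

lemma Elt_before:
  assumes "is_walk V E vs" "hd vs = Elt a" "i < length vs"
  obtains i' x where "i' \<le> i" "vs ! i' = Elt x" "x \<in> rep (vs ! i)"
proof (cases "vs ! i")
  case (Elt x)
  then show ?thesis using that[of i x] by simp
next
  case (Cone C)
  have "i \<noteq> 0"
    using Cone assms hd_conv_nth[of vs] unfolding is_walk_def by (metis cvertex.distinct(1))
  then obtain i' where i': "i = Suc i'" using not0_implies_Suc by blast
  then have "(vs ! i', Cone C) \<in> E" using is_walk_edge[OF assms(1), of i'] assms(3) Cone by simp
  then obtain x where "vs ! i' = Elt x" "x \<in> C" by (auto simp: coned_edges_def)
  then show ?thesis using that[of i' x] i' Cone by simp
qed

lemma Elt_after: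
  assumes "is_walk V E vs" "last vs = Elt a" "i < length vs"
  obtains i' x where "i \<le> i'" "i' < length vs" "vs ! i' = Elt x" "x \<in> rep (vs ! i)"
proof (cases "vs ! i")
  case (Elt x)
  then show ?thesis using that[of i x] assms by simp
next
  case (Cone C)
  have "i \<noteq> length vs - 1"
    using Cone assms last_conv_nth[of vs] unfolding is_walk_def by (metis cvertex.distinct(1))
  then have i': "Suc i < length vs" using assms(3) by simp
  then have "(Cone C, vs ! Suc i) \<in> E" using is_walk_edge[OF assms(1), of i] Cone by simp
  then obtain x where "vs ! Suc i = Elt x" "x \<in> C" by (auto simp: coned_edges_def)
  then show ?thesis using that[of "Suc i" x] i' Cone by simp
qed

text \<open>The inequality is needed only between group elements: a cone vertex on the walk has a
  neighbouring element on either side, and moving both ends of a subwalk outwards to elements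
  lengthens it while changing the distance by at most 1. This gives
  \<open>L \<le> \<mu> * d + 2 * \<mu>\<close>, weaker than which is the condition with constant
  \<open>2 * \<mu> + 1\<close>.\<close>

lemma electric_quasigeodesicI:
  assumes vs: "is_walk V E vs" "hd vs = Elt a" "last vs = Elt b" and mu: "0 \<le> \<mu>"
    and qg: "\<And>i j x y. i \<le> j \<Longrightarrow> j < length vs \<Longrightarrow> vs ! i = Elt x \<Longrightarrow> vs ! j = Elt y \<Longrightarrow>
      wl (subwalk i j vs) \<le> \<mu> * rel.wdist x y + \<mu>"
  shows "electric_quasigeodesic G S H (2 * \<mu> + 1) vs"
proof -
  define P where "P = 2 * \<mu> + 1"
  have P: "1 \<le> P" unfolding P_def using mu by simp
  have ends: "hd vs \<in> Elt ` carrier G" "last vs \<in> Elt ` carrier G"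
    using is_walk_nth[OF vs(1), of 0] is_walk_nth[OF vs(1), of "length vs - 1"] vs
      hd_conv_nth[of vs] last_conv_nth[of vs] unfolding is_walk_def coned_vertices_def by auto
  have "1 / P * wl (subwalk i j vs) - P \<le> vdist (vs ! i) (vs ! j)
      \<and> vdist (vs ! i) (vs ! j) \<le> P * wl (subwalk i j vs) + P"
    if ij: "i \<le> j" "j < length vs" for i j
  proof -
    define L where "L = wl (subwalk i j vs)"
    define d where "d = vdist (vs ! i) (vs ! j)"
    have sub: "is_walk V E (subwalk i j vs)" using is_walk_subwalk[OF vs(1) ij] .
    have d0: "0 \<le> d" "d \<le> L"
      using vdist_nonneg[OF sub] vertex_dist_le[OF sub] ij
      unfolding d_def L_def by (simp_all only: hd_subwalk last_subwalk)
    obtain i' x where i': "i' \<le> i" "vs ! i' = Elt x" "x \<in> rep (vs ! i)"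
      using Elt_before[OF vs(1,2), of i] ij by auto
    obtain j' y where j': "j \<le> j'" "j' < length vs" "vs ! j' = Elt y" "y \<in> rep (vs ! j)"
      using Elt_after[OF vs(1,3) ij(2)] by blast
    have pad: "pad v \<le> 1 / 2" for v by (cases v) auto
    have "rel.wdist x y - pad (vs ! i) - pad (vs ! j) \<le> d"
      using vdist_ge[OF sub, unfolded hd_subwalk[OF ij] last_subwalk[OF ij]] i'(3) j'(4)
      unfolding d_def by blast
    then have "rel.wdist x y \<le> d + 1" using pad[of "vs ! i"] pad[of "vs ! j"] by linarith
    then have "\<mu> * rel.wdist x y \<le> \<mu> * (d + 1)" using mu by (rule mult_left_mono)
    moreover have "L \<le> wl (subwalk i' j' vs)"
      unfolding L_def by (rule subwalk_length_le) (use i' j' ij in auto)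
    moreover have "wl (subwalk i' j' vs) \<le> \<mu> * rel.wdist x y + \<mu>"
      by (rule qg) (use i' j' ij in auto)
    ultimately have "L \<le> \<mu> * d + 2 * \<mu>" by (simp add: algebra_simps)
    also have "\<dots> \<le> P * d + P * P"
    proof (rule add_mono)
      show "\<mu> * d \<le> P * d" unfolding P_def using mu d0 by (intro mult_right_mono) auto
      have "2 * \<mu> \<le> P * 1" unfolding P_def by simp
      also have "\<dots> \<le> P * P" using P by (intro mult_left_mono) auto
      finally show "2 * \<mu> \<le> P * P" .
    qed
    finally have "1 / P * L - P \<le> d" using P by (simp add: field_simps)
    moreover have "1 * L \<le> P * L" using P d0 by (intro mult_right_mono) auto
    then have "d \<le> P * L + P" using P d0 by simp
    ultimately show ?thesis unfolding L_def d_def by simp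
  qed
  then show ?thesis
    unfolding electric_quasigeodesic_def P_def[symmetric] Let_def using vs(1) ends by blast
qed

text \<open>A discrete quasigeodesic for the electric metric that records only group elements.
  Unlike an electric quasigeodesic it may return to a coset; backtracking is removed afterwards by
  passing to a shortest walk.\<close>

definition quasichain :: "real \<Rightarrow> (nat \<Rightarrow> 'a) \<Rightarrow> nat \<Rightarrow> bool" where
  "quasichain \<mu> c n \<longleftrightarrow> (\<forall>k. c k \<in> carrier G) \<and> (\<forall>k<n. rel.wdist (c k) (c (Suc k)) \<le> 1)
     \<and> (\<forall>j k. j \<le> k \<and> k \<le> n \<longrightarrow> real (k - j) \<le> \<mu> * rel.wdist (c j) (c k) + \<mu>)"

lemma quasichainD:
  assumes "quasichain \<mu> c n"
  shows "c k \<in> carrier G" "k < n \<Longrightarrow> rel.wdist (c k) (c (Suc k)) \<le> 1"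
    "j \<le> k \<Longrightarrow> k \<le> n \<Longrightarrow> real (k - j) \<le> \<mu> * rel.wdist (c j) (c k) + \<mu>"
  using assms unfolding quasichain_def by auto

lemma quasichain_mono:
  assumes "quasichain \<mu> c n" "\<mu> \<le> \<mu>'"
  shows "quasichain \<mu>' c n"
proof -
  have "real (k - j) \<le> \<mu>' * rel.wdist (c j) (c k) + \<mu>'" if "j \<le> k" "k \<le> n" for j k
    using quasichainD(3)[OF assms(1) that] mult_right_mono[OF assms(2) rel.wdist_nonneg, of "c j" "c k"]
      assms(2) by linarith
  then show ?thesis using quasichainD(1,2)[OF assms(1)] unfolding quasichain_def by blast
qed

lemma quasichain_shift:
  assumes "quasichain \<mu> c n" "m \<le> n"
  shows "quasichain \<mu> (\<lambda>k. c (m + k)) (n - m)"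
proof -
  have "real (k - j) \<le> \<mu> * rel.wdist (c (m + j)) (c (m + k)) + \<mu>" if "j \<le> k" "k \<le> n - m" for j k
    using quasichainD(3)[OF assms(1), of "m + j" "m + k"] that assms(2) by simp
  then show ?thesis using quasichainD(1,2)[OF assms(1)] assms(2) unfolding quasichain_def by auto
qed

lemma quasichain_take: "quasichain \<mu> c n \<Longrightarrow> m \<le> n \<Longrightarrow> quasichain \<mu> c m"
  unfolding quasichain_def by auto

text \<open>Chains that end in a common coset are made to end at a common point by one more letter
  of \<open>H\<close>. Measuring to the new end point costs another \<mu>, the extra index costs
  1.\<close>

lemma quasichain_snoc:
  assumes c: "quasichain \<mu> c n" and mu: "0 \<le> \<mu>" and y: "y \<in> carrier G" "rel.wdist (c n) y \<le> 1"
  shows "quasichain (2 * \<mu> + 1) (\<lambda>k. if k \<le> n then c k else y) (Suc n)"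
proof -
  let ?c = "\<lambda>k. if k \<le> n then c k else y"
  have "real (k - j) \<le> (2 * \<mu> + 1) * rel.wdist (?c j) (?c k) + (2 * \<mu> + 1)" if jk: "j \<le> k" "k \<le> Suc n" for j k
  proof -
    have d0: "0 \<le> rel.wdist (?c j) (?c k)" by (rule rel.wdist_nonneg)
    have le: "\<mu> * rel.wdist (?c j) (?c k) \<le> (2 * \<mu> + 1) * rel.wdist (?c j) (?c k)"
      using mu d0 by (intro mult_right_mono) auto
    consider "k \<le> n" | "k = Suc n" "j \<le> n" | "k = Suc n" "j = Suc n" using jk by linarith
    then show ?thesis
    proof cases
      case 1
      then show ?thesis using quasichainD(3)[OF c jk(1) 1] jk le mu by simp
    next
      case 2
      have "rel.wdist (c j) (c n) \<le> rel.wdist (c j) y + 1"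
        using rel.wdist_triangle[of "c j" y "c n"] rel.wdist_sym[of y "c n"] quasichainD(1)[OF c] y
        by auto
      then have "\<mu> * rel.wdist (c j) (c n) \<le> \<mu> * (rel.wdist (c j) y + 1)"
        using mu by (rule mult_left_mono)
      then have "real (n - j) \<le> \<mu> * rel.wdist (c j) y + \<mu> + \<mu>"
        using quasichainD(3)[OF c 2(2)] by (simp add: algebra_simps)
      then show ?thesis using 2 le by (simp add: Suc_diff_le)
    next
      case 3
      then show ?thesis using y mu by simp
    qed
  qed
  moreover have "rel.wdist (?c k) (?c (Suc k)) \<le> 1" if "k < Suc n" for k
    using quasichainD(2)[OF c, of k] y(2) that by (cases "k = n") auto
  ultimately show ?thesis using quasichainD(1)[OF c] y(1) unfolding quasichain_def by auto
qed

text \<open>Every element vertex of the walk is a term of the chain, and the chain itself gives a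
  competing walk in the same induced subgraph, of length at most the difference of the
  indices.\<close>

lemma quasichain_shortest_walk:
  assumes c: "quasichain \<mu> c n" and U: "U = c ` {..n}"
    and vs: "shortest_walk (verts U) E vs"
    and ij: "i \<le> j" "j < length vs" "vs ! i = Elt x" "vs ! j = Elt y"
  shows "wl (subwalk i j vs) \<le> \<mu> * rel.wdist x y + \<mu>"
proof -
  have "is_walk (verts U) E vs" using vs unfolding shortest_walk_def by simp
  then have "Elt x \<in> verts U" "Elt y \<in> verts U"
    using is_walk_nth[of "verts U" E vs i] is_walk_nth[of "verts U" E vs j] ij by auto
  then obtain k k' where k: "k \<le> n" "x = c k" "k' \<le> n" "y = c k'"
    unfolding verts_def U by auto
  have cc: "c k \<in> carrier G" "c k' \<in> carrier G" using quasichainD(1)[OF c] by auto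
  obtain ws where ws: "is_walk (verts U) E ws" "hd ws = Elt (c k)" "last ws = Elt (c k')"
    "wl ws \<le> \<bar>real k' - real k\<bar>"
    using chain_walk'[of n c U k k'] quasichainD[OF c] U k by blast
  have "wl (subwalk i j vs) \<le> wl ws"
    using shortest_walk_subwalk_le[OF vs ij(1,2) ws(1)] ws ij k by simp
  moreover have "\<bar>real k' - real k\<bar> \<le> \<mu> * rel.wdist x y + \<mu>"
  proof (cases "k \<le> k'")
    case True
    then show ?thesis using quasichainD(3)[OF c True k(3)] k by (simp add: of_nat_diff)
  next
    case False
    then have "k' \<le> k" by simp
    then show ?thesis
      using quasichainD(3)[OF c _ k(1), of k'] rel.wdist_sym[OF cc] k by (simp add: of_nat_diff)
  qed
  ultimately show ?thesis using ws(4) by linarith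
qed

text \<open>The neighbours of the cone vertex on the walk would both be elements of
  \<open>U \<inter> A\<close>, hence equal, but a shortest walk visits no vertex twice.\<close>

lemma shortest_walk_avoids_cone:
  assumes vs: "shortest_walk (verts U) E vs" "hd vs = Elt a" "last vs = Elt b"
    and U: "U \<inter> A \<subseteq> {x}"
  shows "Cone A \<notin> set vs"
proof
  assume "Cone A \<in> set vs"
  then obtain i where i: "i < length vs" "vs ! i = Cone A" by (auto simp: in_set_conv_nth)
  have w: "is_walk (verts U) E vs" "vs \<noteq> []" using vs unfolding shortest_walk_def is_walk_def by auto
  have "i \<noteq> 0" using i vs hd_conv_nth[OF w(2)] by (metis cvertex.distinct(1))
  moreover have "i \<noteq> length vs - 1" using i vs last_conv_nth[OF w(2)] by (metis cvertex.distinct(1))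
  ultimately obtain j where j: "i = Suc j" "Suc (Suc j) < length vs"
    using i not0_implies_Suc by (metis Suc_lessI diff_Suc_1)
  have "(vs ! j, Cone A) \<in> E" "(Cone A, vs ! Suc (Suc j)) \<in> E"
    using is_walk_edge[OF w(1), of j] is_walk_edge[OF w(1), of "Suc j"] i j by auto
  then obtain y z where yz: "vs ! j = Elt y" "y \<in> A" "vs ! Suc (Suc j) = Elt z" "z \<in> A"
    by (auto simp: coned_edges_def)
  have "Elt y \<in> verts U" "Elt z \<in> verts U"
    using is_walk_nth[OF w(1), of j] is_walk_nth[OF w(1), of "Suc (Suc j)"] yz j by auto
  then have "y = z" using yz U unfolding verts_def by auto
  then show False using shortest_walk_distinct[OF vs(1), of j "Suc (Suc j)"] j yz by simp
qed

lemma mem_elements_in_coset: "x \<in> set (elements_in_coset C vs) \<longleftrightarrow> Elt x \<in> set vs \<and> x \<in> C"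
  unfolding elements_in_coset_def by (force split: cvertex.splits if_splits)

text \<open>
  Joining the vertices of a chain and all cone vertices and taking a shortest walk in the induced
  subgraph gives an electric quasigeodesic without backtracking. Bounded coset penetration is
  applied to such a walk from \<open>c 0\<close> and to one from \<open>c' 0\<close> which is preceded by a
  detour through the cone vertex of \<open>A\<close>.
\<close>

lemma coset_exit:
  assumes bcp: "bounded_coset_penetration G S H" and mu: "0 \<le> \<mu>"
  obtains D where "\<And>A c n c' n'. A \<in> cosets \<Longrightarrow> quasichain \<mu> c n \<Longrightarrow> quasichain \<mu> c' n' \<Longrightarrow>
    c n = c' n' \<Longrightarrow> c 0 \<in> A \<Longrightarrow> c' 0 \<in> A \<Longrightarrow> (\<And>k. 0 < k \<Longrightarrow> k \<le> n \<Longrightarrow> c k \<notin> A) \<Longrightarrow>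
    (\<And>k. 0 < k \<Longrightarrow> k \<le> n' \<Longrightarrow> c' k \<notin> A) \<Longrightarrow> wdist (c 0) (c' 0) \<le> D"
proof -
  \<comment> \<open>The detour has length 1 and moves the starting point by electric distance at
    most 1, so a bound \<open>\<mu> * d + \<mu>\<close> becomes
    \<open>\<mu> * d + 2 * \<mu> + 1\<close>. \<open>P\<close> is the constant that
    \<open>electric_quasigeodesicI\<close> returns for \<mu>'.\<close>
  define \<mu>' where "\<mu>' = 2 * \<mu> + 1"
  define P where "P = 2 * \<mu>' + 1"
  have mu': "0 \<le> \<mu>'" "\<mu> \<le> \<mu>'" "1 \<le> P" unfolding P_def \<mu>'_def using mu by auto
  obtain D where D: "\<And>\<alpha> \<beta> C. electric_quasigeodesic G S H P \<alpha> \<Longrightarrow> without_backtracking G H \<alpha> \<Longrightarrow>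
      electric_quasigeodesic G S H P \<beta> \<Longrightarrow> without_backtracking G H \<beta> \<Longrightarrow>
      hd \<alpha> = hd \<beta> \<Longrightarrow> last \<alpha> = last \<beta> \<Longrightarrow> C \<in> cosets \<Longrightarrow> penetrates \<alpha> C \<Longrightarrow> \<not> penetrates \<beta> C \<Longrightarrow>
      wdist (entry_vertex C \<alpha>) (exit_vertex C \<alpha>) \<le> D"
    using bcp mu'(3) unfolding bounded_coset_penetration_def by meson
  show ?thesis
  proof (rule that[of D])
    fix A c n c' n'
    assume A: "A \<in> cosets" and c: "quasichain \<mu> c n" and c': "quasichain \<mu> c' n'"
      and end_eq: "c n = c' n'" and start: "c 0 \<in> A" "c' 0 \<in> A"
      and avoid: "\<And>k. 0 < k \<Longrightarrow> k \<le> n \<Longrightarrow> c k \<notin> A" "\<And>k. 0 < k \<Longrightarrow> k \<le> n' \<Longrightarrow> c' k \<notin> A"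
    have shortest: "\<exists>vs. shortest_walk (verts (c ` {..n})) E vs \<and> hd vs = Elt (c 0) \<and> last vs = Elt (c n)
        \<and> is_walk V E vs" if c: "quasichain \<mu> c n" for c n
    proof -
      obtain us where us: "is_walk (verts (c ` {..n})) E us" "hd us = Elt (c 0)" "last us = Elt (c n)"
        using chain_walk[of n c "c ` {..n}" 0 n] quasichainD[OF c] by blast
      obtain vs where "shortest_walk (verts (c ` {..n})) E vs" "hd vs = hd us" "last vs = last us"
        using shortest_walk_exists[OF us(1)] .
      moreover have "verts (c ` {..n}) \<subseteq> V"
        unfolding V_verts using quasichainD(1)[OF c] by (intro verts_mono) auto
      ultimately show ?thesis
        using us(2,3) is_walk_mono[of "verts (c ` {..n})" E vs V]
        unfolding shortest_walk_def by (intro exI[of _ vs]) simp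
    qed
    define U where "U = c ` {..n}"
    define U' where "U' = c' ` {..n'}"
    have UA: "U \<inter> A \<subseteq> {c 0}" "U' \<inter> A \<subseteq> {c' 0}"
    proof -
      have "x = c 0" if "x \<in> U" "x \<in> A" for x
        using that avoid(1) unfolding U_def by (metis atMost_iff gr0I imageE)
      moreover have "x = c' 0" if "x \<in> U'" "x \<in> A" for x
        using that avoid(2) unfolding U'_def by (metis atMost_iff gr0I imageE)
      ultimately show "U \<inter> A \<subseteq> {c 0}" "U' \<inter> A \<subseteq> {c' 0}" by blast+
    qed
    obtain \<alpha> where \<alpha>: "shortest_walk (verts U) E \<alpha>" "hd \<alpha> = Elt (c 0)" "last \<alpha> = Elt (c n)" "is_walk V E \<alpha>"
      using shortest[OF c] unfolding U_def by blast
    obtain \<gamma> where \<gamma>: "shortest_walk (verts U') E \<gamma>" "hd \<gamma> = Elt (c' 0)" "last \<gamma> = Elt (c' n')" "is_walk V E \<gamma>"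
      using shortest[OF c'] unfolding U'_def by blast
    obtain \<gamma>' where \<gamma>': "\<gamma> = Elt (c' 0) # \<gamma>'"
      using \<gamma>(2,4) unfolding is_walk_def by (metis list.collapse)
    have "wl (subwalk i j \<alpha>) \<le> \<mu>' * rel.wdist x y + \<mu>'"
      if "i \<le> j" "j < length \<alpha>" "\<alpha> ! i = Elt x" "\<alpha> ! j = Elt y" for i j x y
      using quasichain_shortest_walk[OF quasichain_mono[OF c mu'(2)] U_def \<alpha>(1) that] .
    then have q\<alpha>: "electric_quasigeodesic G S H P \<alpha>"
      unfolding P_def by (rule electric_quasigeodesicI[OF \<alpha>(4,2,3) mu'(1)])
    have nA: "Cone A \<notin> set \<alpha>" "Cone A \<notin> set \<gamma>"
      using shortest_walk_avoids_cone[OF \<alpha>(1-3) UA(1)] shortest_walk_avoids_cone[OF \<gamma>(1-3) UA(2)] by auto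
    have \<gamma>_A: "m = 0" if m: "m < length \<gamma>" "\<gamma> ! m \<in> insert (Cone A) (Elt ` A)" for m
    proof -
      have "\<gamma> ! m \<noteq> Cone A" using nA m nth_mem by metis
      then obtain x where x: "\<gamma> ! m = Elt x" "x \<in> A" using m by auto
      then have "x \<in> U'" using is_walk_nth[of "verts U'" E \<gamma> m] \<gamma>(1) m
        unfolding shortest_walk_def verts_def by auto
      then have "\<gamma> ! m = \<gamma> ! 0" using x UA \<gamma>' by auto
      then show ?thesis using shortest_walk_distinct[OF \<gamma>(1), of 0 m] m by simp
    qed
    \<comment> \<open>The walk is in \<open>A\<close> only at \<open>c 0\<close>, the cone vertex
      and \<open>c' 0\<close>, while \<alpha> avoids that cone vertex. The first penetration
      condition therefore bounds exactly the distance of these two elements, which may also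
      coincide.\<close>
    define \<beta> where "\<beta> = Elt (c 0) # Cone A # \<gamma>"
    have \<beta>_nth: "\<beta> ! Suc (Suc m) = \<gamma> ! m" "\<beta> ! 0 = Elt (c 0)" "\<beta> ! Suc 0 = Cone A" for m
      unfolding \<beta>_def by simp_all
    have cc: "c 0 \<in> carrier G" "c' 0 \<in> carrier G" using quasichainD(1) c c' by auto
    have w\<beta>: "is_walk V E \<beta>"
      using \<gamma>(4) A start cc unfolding \<beta>_def \<gamma>'
      by (auto simp: is_walk_def coned_vertices_def coned_edges_def)
    have ends: "hd \<beta> = Elt (c 0)" "last \<beta> = Elt (c' n')" unfolding \<beta>_def using \<gamma>(3) \<gamma>' by auto
    have "wl (subwalk i j \<beta>) \<le> \<mu>' * rel.wdist x y + \<mu>'"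
      if ij: "i \<le> j" "j < length \<beta>" "\<beta> ! i = Elt x" "\<beta> ! j = Elt y" for i j x y
    proof -
      have ne: "i \<noteq> Suc 0" "j \<noteq> Suc 0" using ij \<beta>_nth by auto
      consider "j = 0" | j' where "i = 0" "j = Suc (Suc j')"
        | i' j' where "i = Suc (Suc i')" "j = Suc (Suc j')"
        using ne ij(1) by (metis le_zero_eq not0_implies_Suc)
      then show ?thesis
      proof cases
        case 1
        then show ?thesis using ij mu' rel.wdist_nonneg unfolding \<beta>_def by simp
      next
        case (2 j')
        have j': "j' < length \<gamma>" "\<gamma> ! j' = Elt y" "x = c 0" using ij 2 \<beta>_nth unfolding \<beta>_def by auto
        have "subwalk i j \<beta> = Elt (c 0) # Cone A # Elt (c' 0) # take j' \<gamma>'"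
          unfolding \<beta>_def \<gamma>' using 2 by simp
        then have "wl (subwalk i j \<beta>) = 1 + wl (subwalk 0 j' \<gamma>)"
          unfolding \<gamma>' by (simp add: walk_length_Cons)
        moreover have "wl (subwalk 0 j' \<gamma>) \<le> \<mu> * rel.wdist (c' 0) y + \<mu>"
          by (rule quasichain_shortest_walk[OF c' U'_def \<gamma>(1)]) (use j' \<gamma>' in auto)
        moreover have "y \<in> carrier G"
          using is_walk_nth[OF \<gamma>(4) j'(1)] j' unfolding coned_vertices_def by auto
        then have "rel.wdist (c' 0) y \<le> rel.wdist x y + 1"
          using rel.wdist_triangle[of "c' 0" "c 0" y] coset_rel_dist[OF A start(2,1)] cc j' by simp
        then have "\<mu> * rel.wdist (c' 0) y \<le> \<mu> * (rel.wdist x y + 1)" using mu by (rule mult_left_mono)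
        ultimately have "wl (subwalk i j \<beta>) \<le> \<mu> * rel.wdist x y + \<mu>'"
          unfolding \<mu>'_def by (simp add: algebra_simps)
        then show ?thesis using mult_right_mono[OF mu'(2) rel.wdist_nonneg, of x y] by linarith
      next
        case (3 i' j')
        have "wl (subwalk i' j' \<gamma>) \<le> \<mu>' * rel.wdist x y + \<mu>'"
          by (rule quasichain_shortest_walk[OF quasichain_mono[OF c' mu'(2)] U'_def \<gamma>(1)])
            (use ij 3 \<beta>_nth in \<open>auto simp: \<beta>_def\<close>)
        then show ?thesis using 3 unfolding \<beta>_def by simp
      qed
    qed
    then have q\<beta>: "electric_quasigeodesic G S H P \<beta>"
      unfolding P_def by (rule electric_quasigeodesicI[OF w\<beta> ends mu'(1)])
    have b\<beta>: "without_backtracking G H \<beta>"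
      unfolding without_backtracking_def
    proof (intro ballI allI impI, elim conjE)
      fix C i j k
      assume C: "C \<in> cosets" and ijk: "i \<le> j" "j \<le> k" "k < length \<beta>"
        and vi: "\<beta> ! i \<in> insert (Cone C) (Elt ` C)" and vk: "\<beta> ! k \<in> insert (Cone C) (Elt ` C)"
      show "\<beta> ! j \<in> insert (Cone C) (Elt ` C)"
      proof (cases "C = A")
        case True
        have "k \<le> Suc (Suc 0)"
        proof (rule ccontr)
          assume "\<not> k \<le> Suc (Suc 0)"
          then obtain m where m: "k = Suc (Suc m)" "m \<noteq> 0" by (metis Suc_le_mono le0 not0_implies_Suc)
          then show False using \<gamma>_A[of m] ijk vk \<beta>_nth True unfolding \<beta>_def by simp
        qed
        then have "j = 0 \<or> j = Suc 0 \<or> j = Suc (Suc 0)" using ijk by linarith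
        then show ?thesis using start True \<gamma>' unfolding \<beta>_def by auto
      next
        case False
        have "i \<noteq> 0" using vi \<beta>_nth cosets_meet[OF C A _ start(1)] False by auto
        moreover have "i \<noteq> Suc 0" using vi \<beta>_nth False by auto
        ultimately have "2 \<le> i" by linarith
        then have "i = Suc (Suc (i - 2))" "j = Suc (Suc (j - 2))" "k = Suc (Suc (k - 2))"
          using ijk by auto
        then obtain i' j' k' where i': "i = Suc (Suc i')" and j': "j = Suc (Suc j')"
          and k': "k = Suc (Suc k')" by blast
        have "i' \<le> j'" "j' \<le> k'" "k' < length \<gamma>" using i' j' k' ijk unfolding \<beta>_def by auto
        then show ?thesis
          using shortest_walk_without_backtracking[OF \<gamma>(1), unfolded without_backtracking_def,
              rule_format, OF C, of i' j' k'] vi vk unfolding i' j' k' \<beta>_nth(1) by blast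
      qed
    qed
    have elements: "elements_in_coset A \<beta> = c 0 # c' 0 # elements_in_coset A \<gamma>'"
      using start unfolding \<beta>_def \<gamma>' elements_in_coset_def by simp
    have "elements_in_coset A \<gamma>' = []"
    proof (rule ccontr)
      assume "elements_in_coset A \<gamma>' \<noteq> []"
      then obtain x where "Elt x \<in> set \<gamma>'" "x \<in> A"
        using mem_elements_in_coset[of _ A \<gamma>'] by (metis list.set_intros(1) neq_Nil_conv)
      then obtain m where "m < length \<gamma>'" "\<gamma>' ! m = Elt x" "x \<in> A" by (auto simp: in_set_conv_nth)
      then show False using \<gamma>_A[of "Suc m"] \<gamma>' by simp
    qed
    then have "entry_vertex A \<beta> = c 0" "exit_vertex A \<beta> = c' 0"
      unfolding entry_vertex_def exit_vertex_def elements by simp_all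
    moreover have "penetrates \<beta> A" "\<not> penetrates \<alpha> A"
      using nA unfolding penetrates_def \<beta>_def by auto
    ultimately show "wdist (c 0) (c' 0) \<le> D"
      using D[OF q\<beta> b\<beta> q\<alpha> shortest_walk_without_backtracking[OF \<alpha>(1)] _ _ A] ends \<alpha> end_eq by simp
  qed
qed

subsection \<open>Exit points\<close>

text \<open>All such points are kept and none is chosen, so that left translations carry exit sets
  to exit sets. Minimizing over both cosets makes a geodesic from \<open>x\<close> to
  \<open>y\<close> leave \<open>A\<close> at once.\<close>

definition exits :: "'a set \<Rightarrow> 'a set \<Rightarrow> 'a set" where
  "exits A B = {x \<in> A. \<exists>y\<in>B. \<forall>x'\<in>A. \<forall>y'\<in>B. rel.wdist x y \<le> rel.wdist x' y'}"

lemma exits_nonempty: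
  assumes "A \<in> cosets" "B \<in> cosets"
  obtains x where "x \<in> exits A B"
proof -
  define P where "P n \<longleftrightarrow> (\<exists>x\<in>A. \<exists>y\<in>B. rel.len (inv x \<otimes> y) = n)" for n
  obtain a b where "a \<in> carrier G" "A = a <# H" "b \<in> carrier G" "B = b <# H"
    using assms unfolding LCOSETS_def by blast
  then have "a \<in> A" "b \<in> B" using coset_self by auto
  then have ex: "\<exists>n. P n" unfolding P_def by blast
  obtain x y where xy: "x \<in> A" "y \<in> B" "rel.len (inv x \<otimes> y) = (LEAST n. P n)"
    using LeastI_ex[OF ex] unfolding P_def by blast
  have "rel.len (inv x \<otimes> y) \<le> rel.len (inv x' \<otimes> y')" if "x' \<in> A" "y' \<in> B" for x' y'
    unfolding xy(3) by (rule Least_le) (use that in \<open>auto simp: P_def\<close>)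
  then have "x \<in> exits A B"
    using xy(1,2) unfolding exits_def word_dist_def by (auto intro!: bexI[of _ y])
  then show ?thesis using that by blast
qed

text \<open>A later point of the geodesic in \<open>A\<close> would be closer to \<open>B\<close>
  than \<open>x\<close> is.\<close>

lemma exits_chain:
  assumes A: "A \<in> cosets" and B: "B \<in> cosets" and AB: "A \<noteq> B" and x: "x \<in> exits A B"
  obtains c n where "c 0 = x" "c n \<in> B" "quasichain 1 c n" "\<And>k. 0 < k \<Longrightarrow> k \<le> n \<Longrightarrow> c k \<notin> A"
    "\<And>i j. i \<le> j \<Longrightarrow> j \<le> n \<Longrightarrow> rel.wdist (c i) (c j) = real (j - i)"
proof -
  obtain y where y: "x \<in> A" "y \<in> B" "\<And>x' y'. x' \<in> A \<Longrightarrow> y' \<in> B \<Longrightarrow> rel.wdist x y \<le> rel.wdist x' y'"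
    using x unfolding exits_def by blast
  have xy: "x \<in> carrier G" "y \<in> carrier G" using y A B coset_carrier by auto
  obtain c n where c: "c 0 = x" "c n = y" "\<And>k. c k \<in> carrier G" "real n = rel.wdist x y"
    "\<And>i j. i \<le> j \<Longrightarrow> j \<le> n \<Longrightarrow> rel.wdist (c i) (c j) = real (j - i)"
    using rel.wdist_geodesic[OF xy] by blast
  have "quasichain 1 c n" unfolding quasichain_def using c by simp
  moreover have "c k \<notin> A" if "0 < k" "k \<le> n" for k
    using y(3)[of "c k" y] y(2) c(5)[of k n] c(2,4) that by auto
  ultimately show ?thesis using that c y by blast
qed

lemma exits_left:
  assumes g: "g \<in> carrier G" and A: "A \<in> cosets" and B: "B \<in> cosets" and x: "x \<in> exits A B"
  shows "g \<otimes> x \<in> exits (g <# A) (g <# B)"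
proof -
  obtain y where y: "x \<in> A" "y \<in> B" "\<And>x' y'. x' \<in> A \<Longrightarrow> y' \<in> B \<Longrightarrow> rel.wdist x y \<le> rel.wdist x' y'"
    using x unfolding exits_def by blast
  have "rel.wdist (g \<otimes> x) (g \<otimes> y) \<le> rel.wdist x' y'" if x': "x' \<in> g <# A" "y' \<in> g <# B" for x' y'
  proof -
    obtain a b where "a \<in> A" "x' = g \<otimes> a" "b \<in> B" "y' = g \<otimes> b"
      using x' unfolding l_coset_def by blast
    then show ?thesis using y rel.wdist_left g coset_carrier[OF A] coset_carrier[OF B] by simp
  qed
  then show ?thesis using y unfolding exits_def l_coset_def by blast
qed

text \<open>Geodesics from two exit points end at possibly different points of \<open>B\<close>. One
  of them is prolonged by a letter of \<open>H\<close> to the end of the other, which turns the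
  constant 1 into 3; the added point is outside \<open>A\<close> because cosets are
  disjoint.\<close>

lemma exits_bounded:
  assumes bcp: "bounded_coset_penetration G S H"
  obtains D where "\<And>A B x x'. A \<in> cosets \<Longrightarrow> B \<in> cosets \<Longrightarrow> A \<noteq> B \<Longrightarrow>
    x \<in> exits A B \<Longrightarrow> x' \<in> exits A B \<Longrightarrow> wdist x x' \<le> D"
proof -
  obtain D where D: "\<And>A c n c' n'. A \<in> cosets \<Longrightarrow> quasichain 3 c n \<Longrightarrow> quasichain 3 c' n' \<Longrightarrow>
    c n = c' n' \<Longrightarrow> c 0 \<in> A \<Longrightarrow> c' 0 \<in> A \<Longrightarrow> (\<And>k. 0 < k \<Longrightarrow> k \<le> n \<Longrightarrow> c k \<notin> A) \<Longrightarrow>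
    (\<And>k. 0 < k \<Longrightarrow> k \<le> n' \<Longrightarrow> c' k \<notin> A) \<Longrightarrow> wdist (c 0) (c' 0) \<le> D"
    using coset_exit[OF bcp, of 3] by auto
  show ?thesis
  proof (rule that[of D])
    fix A B x x'
    assume A: "A \<in> cosets" and B: "B \<in> cosets" and AB: "A \<noteq> B"
      and x: "x \<in> exits A B" "x' \<in> exits A B"
    obtain c n where c: "c 0 = x" "c n \<in> B" "quasichain 1 c n" "\<And>k. 0 < k \<Longrightarrow> k \<le> n \<Longrightarrow> c k \<notin> A"
      using exits_chain[OF A B AB x(1)] by metis
    obtain c' n' where c': "c' 0 = x'" "c' n' \<in> B" "quasichain 1 c' n'" "\<And>k. 0 < k \<Longrightarrow> k \<le> n' \<Longrightarrow> c' k \<notin> A"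
      using exits_chain[OF A B AB x(2)] by metis
    define c'' where "c'' k = (if k \<le> n' then c' k else c n)" for k
    have "quasichain 3 c'' (Suc n')"
      using quasichain_snoc[OF c'(3), of "c n"] coset_rel_dist[OF B c'(2) c(2)] quasichainD(1)[OF c(3)]
      unfolding c''_def by simp
    moreover have "quasichain 3 c n" using quasichain_mono[OF c(3)] by simp
    moreover have "c n \<notin> A" using c(2) cosets_meet[OF A B] AB by blast
    then have "c'' k \<notin> A" if "0 < k" "k \<le> Suc n'" for k
      using c'(4) that unfolding c''_def by auto
    moreover have "c 0 \<in> A" "c'' 0 \<in> A" using x c(1) c'(1) unfolding c''_def exits_def by auto
    moreover have "c n = c'' (Suc n')" unfolding c''_def by simp
    ultimately have "wdist (c 0) (c'' 0) \<le> D" using D[OF A, of c n c'' "Suc n'"] c(4) by blast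
    then show "wdist x x' \<le> D" using c c' unfolding c''_def by simp
  qed
qed

text \<open>
  If \<open>n\<close> were outside \<open>H\<close>, the exit points from \<open>H\<close> to \<open>n H\<close> would form a bounded
  \<open>H\<close>-invariant set.
\<close>

lemma self_normalizing:
  assumes bcp: "bounded_coset_penetration G S H" and S: "finite S" and inf: "infinite H"
    and n: "n \<in> carrier G" "\<And>h. h \<in> H \<Longrightarrow> inv n \<otimes> h \<otimes> n \<in> H"
  shows "n \<in> H"
proof (rule ccontr)
  assume nH: "n \<notin> H"
  have Hc: "h \<in> H \<Longrightarrow> h \<in> carrier G" for h using subgroup.mem_carrier[OF H] .
  have A: "H \<in> cosets"
    using coset_in[OF one_closed] lcos_mult_one[OF subgroup.subset[OF H]] by simp
  have B: "n <# H \<in> cosets" using coset_in n by simp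
  have AB: "H \<noteq> n <# H" using coset_self[OF n(1)] nH by blast
  obtain x where x: "x \<in> exits H (n <# H)" using exits_nonempty[OF A B] by blast
  then have xH: "x \<in> H" unfolding exits_def by simp
  obtain D where D: "\<And>A B x x'. A \<in> cosets \<Longrightarrow> B \<in> cosets \<Longrightarrow> A \<noteq> B \<Longrightarrow>
    x \<in> exits A B \<Longrightarrow> x' \<in> exits A B \<Longrightarrow> wdist x x' \<le> D"
    using exits_bounded[OF bcp] by blast
  have "H \<subseteq> {g \<in> carrier G. len g \<le> nat \<lfloor>D\<rfloor>}"
  proof
    fix h assume h: "h \<in> H"
    \<comment> \<open>Chosen so that \<open>k \<otimes> x = x \<otimes> h\<close>: translation by
      \<open>k\<close> preserves both \<open>H\<close> and \<open>n <# H\<close> and moves the exit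
      point \<open>x\<close> by exactly \<open>len h\<close>.\<close>
    define k where "k = x \<otimes> h \<otimes> inv x"
    have k: "k \<in> H" "k \<in> carrier G" "k \<otimes> x = x \<otimes> h"
      using h xH Hc subgroup.m_closed[OF H] subgroup.m_inv_closed[OF H]
      unfolding k_def by (simp_all add: m_assoc)
    have "k <# H = H" using coset_join3[OF k(2) H k(1)] .
    moreover have "k <# (n <# H) = n <# H"
    proof -
      have "inv n \<otimes> (k \<otimes> n) \<in> H" using n(2)[OF k(1)] n(1) k by (simp add: m_assoc)
      then have "k \<otimes> n \<in> n <# H" using in_coset_iff[OF n(1), of "k \<otimes> n"] k n by simp
      then have "n <# H = (k \<otimes> n) <# H" using coset_eq[OF B] by simp
      then show ?thesis using lcos_m_assoc[OF subgroup.subset[OF H] k(2) n(1)] by simp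
    qed
    ultimately have "k \<otimes> x \<in> exits H (n <# H)" using exits_left[OF k(2) A B x] by simp
    then have "wdist x (x \<otimes> h) \<le> D" using D[OF A B AB x] k(3) by simp
    then show "h \<in> {g \<in> carrier G. len g \<le> nat \<lfloor>D\<rfloor>}" using xH h Hc by simp linarith
  qed
  then show False using inf finite_len_ball[OF S] finite_subset by blast
qed

text \<open>A word geodesic from \<open>a\<close> to \<open>u i\<close> has length at most
  \<open>r\<close>, so it is a quasichain with constant \<open>r + 1\<close> whatever it does in the
  electric metric. After its last visit to \<open>A\<close> it forms, with the initial piece of
  \<open>u\<close>, a pair of chains leaving \<open>A\<close> and ending at \<open>u i\<close>, to
  which \<open>coset_exit\<close> applies.\<close>

lemma geodesic_near_coset:
  assumes bcp: "bounded_coset_penetration G S H" and r: "0 \<le> r"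
  obtains D where "\<And>A u n i a. A \<in> cosets \<Longrightarrow> quasichain 1 u n \<Longrightarrow> u 0 \<in> A \<Longrightarrow>
    (\<And>k. 0 < k \<Longrightarrow> k \<le> n \<Longrightarrow> u k \<notin> A) \<Longrightarrow> i \<le> n \<Longrightarrow> a \<in> A \<Longrightarrow> wdist a (u i) \<le> r \<Longrightarrow>
    wdist (u 0) (u i) \<le> D"
proof -
  define \<mu> where "\<mu> = r + 1"
  have mu: "0 \<le> \<mu>" "1 \<le> \<mu>" "r \<le> \<mu>" unfolding \<mu>_def using r by auto
  obtain D where D: "\<And>A c n c' n'. A \<in> cosets \<Longrightarrow> quasichain \<mu> c n \<Longrightarrow> quasichain \<mu> c' n' \<Longrightarrow>
    c n = c' n' \<Longrightarrow> c 0 \<in> A \<Longrightarrow> c' 0 \<in> A \<Longrightarrow> (\<And>k. 0 < k \<Longrightarrow> k \<le> n \<Longrightarrow> c k \<notin> A) \<Longrightarrow>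
    (\<And>k. 0 < k \<Longrightarrow> k \<le> n' \<Longrightarrow> c' k \<notin> A) \<Longrightarrow> wdist (c 0) (c' 0) \<le> D"
    using coset_exit[OF bcp mu(1)] by blast
  show ?thesis
  proof (rule that[of "D + r"])
    fix A u n i a
    assume A: "A \<in> cosets" and u: "quasichain 1 u n" "u 0 \<in> A" "\<And>k. 0 < k \<Longrightarrow> k \<le> n \<Longrightarrow> u k \<notin> A"
      and i: "i \<le> n" and a: "a \<in> A" "wdist a (u i) \<le> r"
    have ui: "u k \<in> carrier G" for k using quasichainD(1)[OF u(1)] .
    have ac: "a \<in> carrier G" using coset_carrier A a by blast
    obtain v m where v: "v 0 = a" "v m = u i" "\<And>k. v k \<in> carrier G" "real m = wdist a (u i)"
      "\<And>i j. i \<le> j \<Longrightarrow> j \<le> m \<Longrightarrow> wdist (v i) (v j) = real (j - i)"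
      using wdist_geodesic[OF ac ui] by blast
    define P where "P k \<longleftrightarrow> k \<le> m \<and> v k \<in> A" for k
    have P0: "P 0" unfolding P_def using v a by simp
    have bd: "\<And>k. P k \<Longrightarrow> k \<le> m" unfolding P_def by simp
    define l where "l = Greatest P"
    have l: "l \<le> m" "v l \<in> A" using GreatestI_nat[of P, OF P0 bd] unfolding l_def P_def by auto
    have max: "v (l + k) \<notin> A" if "0 < k" "k \<le> m - l" for k
    proof
      assume "v (l + k) \<in> A"
      then have "P (l + k)" unfolding P_def using that l(1) by simp
      then have "l + k \<le> Greatest P" by (rule Greatest_le_nat[OF _ bd])
      then show False using that(1) unfolding l_def[symmetric] by simp
    qed
    have "quasichain \<mu> v m"
      unfolding quasichain_def
    proof (intro conjI allI impI)
      show "rel.wdist (v k) (v (Suc k)) \<le> 1" if "k < m" for k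
        using rel_wdist_le[OF v(3) v(3), of k "Suc k"] v(5)[of k "Suc k"] that by simp
      show "real (k - j) \<le> \<mu> * rel.wdist (v j) (v k) + \<mu>" if "j \<le> k \<and> k \<le> m" for j k
      proof -
        have "real (k - j) \<le> \<mu>" using that v(4) a(2) mu(3) by linarith
        then show ?thesis using mult_nonneg_nonneg[OF mu(1) rel.wdist_nonneg, of "v j" "v k"] by linarith
      qed
    qed (rule v(3))
    then have q: "quasichain \<mu> (\<lambda>k. v (l + k)) (m - l)" using quasichain_shift l by blast
    have "wdist (u 0) (v (l + 0)) \<le> D"
    proof (rule D[OF A _ q])
      show "quasichain \<mu> u i" using quasichain_mono[OF quasichain_take[OF u(1) i] mu(2)] .
    qed (use u i v l max in auto)
    moreover have "wdist (v l) (u i) \<le> r" using v(2,4) v(5)[of l m] l a(2) by simp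
    ultimately show "wdist (u 0) (u i) \<le> D + r"
      using wdist_triangle[OF ui[of 0] v(3)[of l] ui[of i]] by simp
  qed
qed

text \<open>A letter of \<open>H\<close> goes to a letter of \<open>H\<close>, hence to a single
  electric step, but the image may be far away in the word metric of \<open>S\<close>. The path
  therefore waits at \<open>f x\<close> and jumps at the very end, and nearness to
  \<open>f x\<close> is claimed only before index \<open>L\<close>.\<close>

lemma step_path:
  assumes x: "x \<in> carrier G" "y \<in> carrier G" "rel.wdist x y \<le> 1"
    and f: "f \<in> hom G G" "f ` H \<subseteq> H" and L: "0 < L" "\<And>s. s \<in> S \<Longrightarrow> len (f s) \<le> L"
  obtains w where "w 0 = f x" "w L = f y" "\<And>j. w j \<in> carrier G"
    "\<And>j. j < L \<Longrightarrow> rel.wdist (w j) (w (Suc j)) \<le> 1" "\<And>j. j < L \<Longrightarrow> wdist (f x) (w j) \<le> L"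
proof -
  interpret f: group_hom G G f by unfold_locales (rule f)
  define g where "g = inv x \<otimes> y"
  have g: "g \<in> carrier G" "rel.len g \<le> 1" "y = x \<otimes> g"
    using x unfolding g_def by (auto simp: word_dist_def m_assoc[symmetric])
  have fy: "f y = f x \<otimes> f g" using g x by simp
  have "g = \<one> \<or> g \<in> rel.letters" using rel.len_le_1_letter[OF g(1,2)] .
  then consider "g \<in> H" | "g = \<one> \<or> g \<in> letters"
    using subgroup.m_inv_closed[OF H] by auto
  then show ?thesis
  proof cases
    case 1
    have "rel.len (f g) \<le> 1" using rel.len_letter[of "f g"] f 1 by auto
    then have "rel.wdist (f x) (f y) \<le> 1" using fy rel.wdist_right[of "f x" "f g"] x g by simp
    then show ?thesis using x L(1)
      by (intro that[of "\<lambda>j. if j < L then f x else f y"]) auto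
  next
    case 2
    have "len (f g) \<le> L"
    proof -
      have "len (f (inv s)) \<le> L" if "s \<in> S" for s
        using L(2)[OF that] len_inv[of "f s"] that S_carrier by auto
      then show ?thesis using 2 L(2) by auto
    qed
    then have le: "wdist (f x) (f y) \<le> L" using fy x g by simp
    obtain c n where c: "c 0 = f x" "c n = f y" "\<And>k. c k \<in> carrier G" "real n = wdist (f x) (f y)"
      "\<And>i j. i \<le> j \<Longrightarrow> j \<le> n \<Longrightarrow> wdist (c i) (c j) = real (j - i)"
      using wdist_geodesic[of "f x" "f y"] x by auto
    have n: "n \<le> L" using c(4) le by linarith
    show ?thesis
    proof (rule that[of "\<lambda>j. c (min j n)"])
      show "rel.wdist (c (min j n)) (c (min (Suc j) n)) \<le> 1" for j
        using rel_wdist_le[OF c(3) c(3), of "min j n" "min (Suc j) n"] c(5)[of "min j n" "min (Suc j) n"]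
        by (auto simp: min_def split: if_splits)
      show "wdist (f x) (c (min j n)) \<le> L" for j
        using c(1) c(5)[of 0 "min j n"] n by (auto simp: min_def split: if_splits)
    qed (use c n in \<open>auto simp: min_def\<close>)
  qed
qed

text \<open>Every step of the geodesic is given exactly \<open>L\<close> indices, so that index
  \<open>k\<close> belongs to step \<open>k div L\<close>. In the constant,
  \<open>L * \<Lambda>\<close> comes from the two changes of scale,
  \<open>2 * L * L * \<Lambda>\<close> from the error \<open>L\<close> at both ends, and
  \<open>L\<close> from the remainders modulo \<open>L\<close>.\<close>

lemma image_chain:
  assumes u: "\<And>k. u k \<in> carrier G" "\<And>i j. i \<le> j \<Longrightarrow> j \<le> n \<Longrightarrow> rel.wdist (u i) (u j) = real (j - i)"
    and f: "f \<in> hom G G" "f ` H \<subseteq> H" and L: "0 < L" "\<And>s. s \<in> S \<Longrightarrow> len (f s) \<le> L"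
    and \<Lambda>: "0 \<le> \<Lambda>" "\<And>x y. x \<in> carrier G \<Longrightarrow> y \<in> carrier G \<Longrightarrow> rel.wdist x y \<le> \<Lambda> * rel.wdist (f x) (f y)"
  obtains c where "quasichain (real L * \<Lambda> + 2 * real L * real L * \<Lambda> + real L) c (n * L)"
    "c 0 = f (u 0)" "c (n * L) = f (u n)"
    "\<And>k. k \<le> n * L \<Longrightarrow> wdist (f (u (k div L))) (c k) \<le> L"
proof -
  interpret f: group_hom G G f by unfold_locales (rule f)
  define Q where "Q i w \<longleftrightarrow> w 0 = f (u i) \<and> w L = f (u (Suc i)) \<and> (\<forall>j. w j \<in> carrier G)
      \<and> (\<forall>j<L. rel.wdist (w j) (w (Suc j)) \<le> 1) \<and> (\<forall>j<L. wdist (f (u i)) (w j) \<le> L)" for i w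
  have "\<exists>w. Q i w" if "i < n" for i
  proof -
    have "rel.wdist (u i) (u (Suc i)) \<le> 1" using u(2)[of i "Suc i"] that by simp
    from step_path[OF u(1) u(1) this f L]
    obtain w where "w 0 = f (u i)" "w L = f (u (Suc i))" "\<And>j. w j \<in> carrier G"
      "\<And>j. j < L \<Longrightarrow> rel.wdist (w j) (w (Suc j)) \<le> 1" "\<And>j. j < L \<Longrightarrow> wdist (f (u i)) (w j) \<le> L"
      by blast
    then show ?thesis unfolding Q_def by blast
  qed
  then have "\<forall>i. \<exists>w. i < n \<longrightarrow> Q i w" by blast
  from choice[OF this] obtain W where "\<And>i. i < n \<Longrightarrow> Q i (W i)" by blast
  then have W: "W i 0 = f (u i)" "W i L = f (u (Suc i))" "W i j \<in> carrier G"
    "j < L \<Longrightarrow> rel.wdist (W i j) (W i (Suc j)) \<le> 1" "j < L \<Longrightarrow> wdist (f (u i)) (W i j) \<le> L"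
    if "i < n" for i j
    using that unfolding Q_def by simp_all
  \<comment> \<open>The last index \<open>n * L\<close> begins no step and gets the image of the end
    point.\<close>
  define c where "c k = (if k < n * L then W (k div L) (k mod L) else f (u n))" for k
  have div: "k div L < n" if "k < n * L" for k using that by (simp add: less_mult_imp_div_less)
  have cc: "c k \<in> carrier G" for k unfolding c_def using W(3) div u(1) by simp
  have step: "c (Suc k) = W (k div L) (Suc (k mod L))" if k: "k < n * L" for k
  proof (cases "Suc (k mod L) = L")
    case True
    then have s: "Suc k mod L = 0" "Suc k div L = Suc (k div L)" by (simp_all add: mod_Suc div_Suc)
    show ?thesis
    proof (cases "Suc k < n * L")
      case True
      then show ?thesis using s W(1)[of "Suc k div L"] W(2)[OF div[OF k]] div[OF True] \<open>Suc (k mod L) = L\<close>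
        unfolding c_def by simp
    next
      case False
      then have "Suc k = n * L" using k by simp
      then have "Suc k div L = n" using L(1) by simp
      then show ?thesis using s W(2)[OF div[OF k]] False \<open>Suc (k mod L) = L\<close> unfolding c_def by simp
    qed
  next
    case False
    then have s: "Suc k mod L = Suc (k mod L)" "Suc k div L = k div L" by (simp_all add: mod_Suc div_Suc)
    have "Suc k < n * L"
    proof (rule ccontr)
      assume "\<not> Suc k < n * L"
      then have "Suc k = n * L" using k by simp
      then show False using s(1) by simp
    qed
    then show ?thesis using s unfolding c_def by simp
  qed
  have near: "wdist (f (u (k div L))) (c k) \<le> L" if "k \<le> n * L" for k
  proof (cases "k < n * L")
    case True
    then show ?thesis using W(5)[OF div[OF True], of "k mod L"] L(1) unfolding c_def by simp
  next
    case False
    then have "k = n * L" using that by simp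
    then show ?thesis using L(1) u(1) unfolding c_def by simp
  qed
  have "quasichain (real L * \<Lambda> + 2 * real L * real L * \<Lambda> + real L) c (n * L)"
    unfolding quasichain_def
  proof (intro conjI allI impI)
    show "rel.wdist (c k) (c (Suc k)) \<le> 1" if k: "k < n * L" for k
      unfolding step[OF k] using W(4)[OF div[OF k], of "k mod L"] k L(1) by (simp add: c_def)
    fix j k assume jk: "j \<le> k \<and> k \<le> n * L"
    define i where "i = j div L"
    define i' where "i' = k div L"
    have i: "i \<le> i'" unfolding i_def i'_def using jk by (simp add: div_le_mono)
    have i': "i' \<le> n" unfolding i'_def using jk L(1) by (metis div_le_mono div_mult_self_is_m)
    define d where "d = rel.wdist (c j) (c k)"
    have d0: "0 \<le> d" unfolding d_def by (rule rel.wdist_nonneg)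
    have fu: "f (u i) \<in> carrier G" "f (u i') \<in> carrier G" using u by auto
    have "rel.wdist (f (u i)) (c j) \<le> L" "rel.wdist (f (u i')) (c k) \<le> L"
      using near[of j] near[of k] jk rel_wdist_le[OF fu(1) cc] rel_wdist_le[OF fu(2) cc]
      unfolding i_def i'_def by (meson order_trans)+
    then have "rel.wdist (f (u i)) (f (u i')) \<le> d + 2 * L"
      using rel.wdist_triangle[OF fu(1) cc fu(2), of j] rel.wdist_triangle[OF cc cc fu(2), of j k]
        rel.wdist_sym[OF cc fu(2), of k] unfolding d_def by linarith
    then have "\<Lambda> * rel.wdist (f (u i)) (f (u i')) \<le> \<Lambda> * (d + 2 * L)" using \<Lambda>(1) by (rule mult_left_mono)
    then have "real (i' - i) \<le> \<Lambda> * (d + 2 * L)" using u(2)[OF i i'] \<Lambda>(2)[OF u(1) u(1), of i i'] by simp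
    then have "L * real (i' - i) \<le> L * (\<Lambda> * (d + 2 * L))" by (rule mult_left_mono) simp
    moreover have "real (k - j) \<le> L * real (i' - i) + L"
    proof -
      have "k = L * i' + k mod L" "j = L * i + j mod L" unfolding i_def i'_def by simp_all
      moreover have "k mod L < L" using L(1) by simp
      moreover have "L * i' = L * i + L * (i' - i)" using i by (simp add: add_mult_distrib2[symmetric])
      ultimately have "k - j \<le> L * (i' - i) + L" by linarith
      then show ?thesis by (metis of_nat_add of_nat_le_iff of_nat_mult)
    qed
    ultimately have "real (k - j) \<le> L * \<Lambda> * d + (2 * L * L * \<Lambda> + L)" by (simp add: algebra_simps)
    also have "\<dots> \<le> (real L * \<Lambda> + 2 * real L * real L * \<Lambda> + real L) * d + (real L * \<Lambda> + 2 * real L * real L * \<Lambda> + real L)"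
      using \<Lambda>(1) d0 by (intro add_mono mult_right_mono) auto
    finally show "real (k - j) \<le> (real L * \<Lambda> + 2 * real L * real L * \<Lambda> + real L) * rel.wdist (c j) (c k)
        + (real L * \<Lambda> + 2 * real L * real L * \<Lambda> + real L)" unfolding d_def .
  qed (rule cc)
  moreover have "c 0 = f (u 0)"
    using W(1)[of 0] L(1) unfolding c_def by (cases "n = 0") auto
  moreover have "c (n * L) = f (u n)" unfolding c_def by simp
  ultimately show ?thesis using that near by blast
qed

lemma image_coset:
  assumes f: "f \<in> hom G G" "f ` H = H" and a: "a \<in> carrier G"
  shows "f ` (a <# H) = f a <# H"
proof -
  have "f (a \<otimes> h) = f a \<otimes> f h" if "h \<in> H" for h
    using f(1) a subgroup.mem_carrier[OF H that] by (simp add: hom_mult)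
  then have "f ` (a <# H) = (\<lambda>h. f a \<otimes> h) ` (f ` H)" unfolding l_coset_def by force
  then show ?thesis unfolding f(2) l_coset_def by auto
qed

text \<open>
  The image chain may return to the coset \<open>f ` A\<close>. Its last point there is close to the image of a
  point \<open>u\<close> of the geodesic with \<open>u\<close> close to \<open>A\<close>, so \<open>u\<close> is close to the start by
  \<open>geodesic_near_coset\<close>.
\<close>

lemma exits_image:
  assumes bcp: "bounded_coset_penetration G S H" and S: "finite S"
    and f: "f \<in> iso G G" and fH: "f ` H = H"
  obtains D where "\<And>A B x z. A \<in> cosets \<Longrightarrow> B \<in> cosets \<Longrightarrow> A \<noteq> B \<Longrightarrow> x \<in> exits A B \<Longrightarrow>
    z \<in> exits (f ` A) (f ` B) \<Longrightarrow> wdist (f x) z \<le> D"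
proof -
  have fh: "f \<in> hom G G" and bij: "bij_betw f (carrier G) (carrier G)"
    using f unfolding iso_def by auto
  interpret f: group_hom G G f by unfold_locales (rule fh)
  obtain L0 where L0: "\<And>s. s \<in> S \<Longrightarrow> len (f s) \<le> L0" using finite_len_bound[OF S] by blast
  define L where "L = Suc L0"
  have L: "0 < L" "\<And>s. s \<in> S \<Longrightarrow> len (f s) \<le> L"
    unfolding L_def using L0 by (simp, meson le_SucI)
  define f' where "f' = inv_into (carrier G) f"
  have f': "f' \<in> hom G G" using iso_set_sym[OF f] unfolding f'_def iso_def by blast
  have f'H: "f' h \<in> H" if h: "h \<in> H" for h
  proof -
    obtain h' where "h' \<in> H" "h = f h'" using h fH by blast
    then show ?thesis
      unfolding f'_def using bij subgroup.mem_carrier[OF H] by (simp add: bij_betw_def)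
  qed
  obtain L1 where L1: "\<And>s. s \<in> S \<Longrightarrow> len (f' s) \<le> L1" using finite_len_bound[OF S] by blast
  \<comment> \<open>In the electric metric the bound extends to the possibly infinite set
    \<open>H\<close>, because \<open>f\<close> maps letters of \<open>H\<close> to letters of
    \<open>H\<close>.\<close>
  have bound: "rel.len (f s) \<le> L" if "s \<in> S \<union> H" for s
  proof (cases "s \<in> S")
    case True
    then show ?thesis using L(2)[of s] rel_len_le[of "f s"] S_carrier by fastforce
  next
    case False
    then show ?thesis using that rel.len_letter[of "f s"] fH L(1) by force
  qed
  have bound': "rel.len (inv_into (carrier G) f s) \<le> Suc L1" if "s \<in> S \<union> H" for s
  proof (cases "s \<in> S")
    case True
    then have "f' s \<in> carrier G" using hom_in_carrier[OF f'] S_carrier by blast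
    then show ?thesis
      using L1[OF True] rel_len_le[of "f' s"] unfolding f'_def by linarith
  next
    case False
    then show ?thesis using that rel.len_letter[of "f' s"] f'H unfolding f'_def by force
  qed
  obtain \<Lambda> :: real where \<Lambda>: "1 \<le> \<Lambda>"
    "\<And>x y. x \<in> carrier G \<Longrightarrow> y \<in> carrier G \<Longrightarrow> rel.wdist (f x) (f y) \<le> \<Lambda> * rel.wdist x y"
    "\<And>x y. x \<in> carrier G \<Longrightarrow> y \<in> carrier G \<Longrightarrow> rel.wdist x y \<le> \<Lambda> * rel.wdist (f x) (f y)"
    using rel.bounded_iso_bilipschitz[OF f bound bound'] by blast
  obtain \<kappa> :: real where \<kappa>: "1 \<le> \<kappa>"
    "\<And>x y. x \<in> carrier G \<Longrightarrow> y \<in> carrier G \<Longrightarrow> wdist (f x) (f y) \<le> \<kappa> * wdist x y"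
    "\<And>x y. x \<in> carrier G \<Longrightarrow> y \<in> carrier G \<Longrightarrow> wdist x y \<le> \<kappa> * wdist (f x) (f y)"
    using iso_bilipschitz[OF S f] by blast
  \<comment> \<open>The constant of \<open>image_chain\<close>. The 3 added to it covers the
    comparison chain, a geodesic prolonged by one step inside the image of \<open>B\<close>.\<close>
  define \<mu>0 where "\<mu>0 = real L * \<Lambda> + 2 * real L * real L * \<Lambda> + real L"
  define \<mu> where "\<mu> = \<mu>0 + 3"
  have "0 \<le> \<mu>0" unfolding \<mu>0_def using \<Lambda>(1) by simp
  then have mu: "0 \<le> \<mu>" "\<mu>0 \<le> \<mu>" "3 \<le> \<mu>" unfolding \<mu>_def by auto
  obtain D1 where D1: "\<And>A c n c' n'. A \<in> cosets \<Longrightarrow> quasichain \<mu> c n \<Longrightarrow> quasichain \<mu> c' n' \<Longrightarrow>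
    c n = c' n' \<Longrightarrow> c 0 \<in> A \<Longrightarrow> c' 0 \<in> A \<Longrightarrow> (\<And>k. 0 < k \<Longrightarrow> k \<le> n \<Longrightarrow> c k \<notin> A) \<Longrightarrow>
    (\<And>k. 0 < k \<Longrightarrow> k \<le> n' \<Longrightarrow> c' k \<notin> A) \<Longrightarrow> wdist (c 0) (c' 0) \<le> D1"
    using coset_exit[OF bcp mu(1)] by blast
  have "0 \<le> \<kappa> * L" using \<kappa>(1) by simp
  then obtain D2 where D2: "\<And>A u n i a. A \<in> cosets \<Longrightarrow> quasichain 1 u n \<Longrightarrow> u 0 \<in> A \<Longrightarrow>
    (\<And>k. 0 < k \<Longrightarrow> k \<le> n \<Longrightarrow> u k \<notin> A) \<Longrightarrow> i \<le> n \<Longrightarrow> a \<in> A \<Longrightarrow> wdist a (u i) \<le> \<kappa> * L \<Longrightarrow>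
    wdist (u 0) (u i) \<le> D2"
    using geodesic_near_coset[OF bcp, of "\<kappa> * L"] by blast
  have fcoset: "f ` C \<in> cosets" if "C \<in> cosets" for C
  proof -
    obtain a where "a \<in> carrier G" "C = a <# H" using \<open>C \<in> cosets\<close> unfolding LCOSETS_def by blast
    then show ?thesis using image_coset[OF fh fH] coset_in by simp
  qed
  show ?thesis
  \<comment> \<open>The three terms bound the steps from \<open>f x\<close> to the image of a point
    \<open>u i\<close> of the geodesic, from there to the last point \<open>c l\<close> of the image
    chain in the coset, and from \<open>c l\<close> to \<open>z\<close>.\<close>
  proof (rule that[of "\<kappa> * D2 + L + D1"])
    fix A B x z
    assume A: "A \<in> cosets" and B: "B \<in> cosets" and AB: "A \<noteq> B"
      and x: "x \<in> exits A B" and z: "z \<in> exits (f ` A) (f ` B)"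
    have inj: "inj_on f (carrier G)" using bij unfolding bij_betw_def by simp
    have "A \<subseteq> carrier G" "B \<subseteq> carrier G" using coset_carrier A B by auto
    then have fAB: "f ` A \<noteq> f ` B" using AB inj inj_on_image_eq_iff by metis
    note fA = fcoset[OF A] and fB = fcoset[OF B]
    obtain u n where u: "u 0 = x" "u n \<in> B" "quasichain 1 u n" "\<And>k. 0 < k \<Longrightarrow> k \<le> n \<Longrightarrow> u k \<notin> A"
      "\<And>i j. i \<le> j \<Longrightarrow> j \<le> n \<Longrightarrow> rel.wdist (u i) (u j) = real (j - i)"
      using exits_chain[OF A B AB x] by metis
    have uc: "u k \<in> carrier G" for k using quasichainD(1)[OF u(3)] .
    have xA: "x \<in> A" using x unfolding exits_def by simp
    have fH': "f ` H \<subseteq> H" and \<Lambda>0: "0 \<le> \<Lambda>" using fH \<Lambda>(1) by auto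
    obtain c where c: "quasichain \<mu>0 c (n * L)" "c 0 = f (u 0)" "c (n * L) = f (u n)"
      "\<And>k. k \<le> n * L \<Longrightarrow> wdist (f (u (k div L))) (c k) \<le> L"
      using image_chain[of u n f L \<Lambda>, OF uc u(5) fh fH' L \<Lambda>0 \<Lambda>(3)] unfolding \<mu>0_def by blast
    have cc: "c k \<in> carrier G" for k using quasichainD(1)[OF c(1)] .
    define P where "P k \<longleftrightarrow> k \<le> n * L \<and> c k \<in> f ` A" for k
    have P0: "P 0" unfolding P_def using c(2) u(1) xA by simp
    have bd: "\<And>k. P k \<Longrightarrow> k \<le> n * L" unfolding P_def by simp
    define l where "l = Greatest P"
    have l: "l \<le> n * L" "c l \<in> f ` A" using GreatestI_nat[of P, OF P0 bd] unfolding l_def P_def by auto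
    have max: "c (l + k) \<notin> f ` A" if "0 < k" "k \<le> n * L - l" for k
    proof
      assume "c (l + k) \<in> f ` A"
      then have "P (l + k)" unfolding P_def using that l(1) by simp
      then have "l + k \<le> Greatest P" by (rule Greatest_le_nat[OF _ bd])
      then show False using that(1) unfolding l_def[symmetric] by simp
    qed
    obtain v m where v: "v 0 = z" "v m \<in> f ` B" "quasichain 1 v m" "\<And>k. 0 < k \<Longrightarrow> k \<le> m \<Longrightarrow> v k \<notin> f ` A"
      using exits_chain[OF fA fB fAB z] by metis
    define v' where "v' k = (if k \<le> m then v k else f (u n))" for k
    have img: "f (u n) \<in> f ` B" "f (u n) \<in> carrier G" using u(2) uc by auto
    have "quasichain 3 v' (Suc m)"
      using quasichain_snoc[OF v(3), of "f (u n)"] coset_rel_dist[OF fB v(2) img(1)] img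
      unfolding v'_def by simp
    then have qv: "quasichain \<mu> v' (Suc m)" using quasichain_mono mu by blast
    have "f (u n) \<notin> f ` A" using img(1) cosets_meet[OF fA fB] fAB by blast
    then have v'A: "v' k \<notin> f ` A" if "0 < k" "k \<le> Suc m" for k
      using v(4) that unfolding v'_def by auto
    have qc: "quasichain \<mu> (\<lambda>k. c (l + k)) (n * L - l)"
      using quasichain_mono[OF quasichain_shift[OF c(1) l(1)] mu(2)] .
    have zA: "z \<in> f ` A" using z unfolding exits_def by simp
    have "wdist (c (l + 0)) (v' 0) \<le> D1"
      by (rule D1[OF fA qc qv]) (use c(3) l max v'A zA v(1) in \<open>auto simp: v'_def\<close>)
    then have 1: "wdist (c l) z \<le> D1" using v(1) unfolding v'_def by simp
    define i where "i = l div L"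
    have i: "i \<le> n" unfolding i_def using l(1) L(1) by (metis div_le_mono div_mult_self_is_m)
    have near: "wdist (f (u i)) (c l) \<le> L" unfolding i_def using c(4) l by blast
    obtain a where a: "a \<in> A" "c l = f a" using l by blast
    have ac: "a \<in> carrier G" using coset_carrier A a by blast
    have "wdist a (u i) \<le> \<kappa> * wdist (f a) (f (u i))" using \<kappa>(3) ac uc by blast
    also have "\<dots> \<le> \<kappa> * L"
      using near a \<kappa>(1) wdist_sym[of "f a" "f (u i)"] ac uc by (intro mult_left_mono) auto
    finally have "wdist (u 0) (u i) \<le> D2" using D2[OF A u(3) _ u(4) i a(1)] u(1) xA by blast
    then have "\<kappa> * wdist (u 0) (u i) \<le> \<kappa> * D2" using \<kappa>(1) by (intro mult_left_mono) auto
    then have "wdist (f x) (f (u i)) \<le> \<kappa> * D2" using \<kappa>(2)[OF uc uc, of 0 i] u(1) by simp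
    moreover have "z \<in> carrier G" using zA coset_carrier[OF fA] by blast
    moreover have "f x \<in> carrier G" using u(1) uc[of 0] by simp
    ultimately show "wdist (f x) z \<le> \<kappa> * D2 + L + D1"
      using wdist_triangle[of "f x" "f (u i)" z] wdist_triangle[of "f (u i)" "c l" z] 1 near uc[of i] cc[of l]
      by simp
  qed
qed

text \<open>Hyperbolicity of the coned-off graph restricts to group elements, where the metric is
  that of \<open>S \<union> H\<close>. Routes leaving an element through its cone vertex pay 1/2
  there and save at most 1/2, so they do not shorten the distance of points.\<close>

lemma weakly_hyperbolic_imp_hyperbolic_group:
  assumes hyp: "weakly_hyperbolic_rel G S H" and fin: "finite S" "finite H"
  obtains \<delta> where "hyperbolic_group G (S \<union> H) \<delta>"
proof -
  \<comment> \<open>An element is named as an end of the edge to its own cone vertex, which always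
    exists; a Cayley edge at it need not.\<close>
  define pt where "pt x = (Elt x, Cone (x <# H), 0::real)" for x
  have pt: "pt x \<in> graph_points E coned_weight" if "x \<in> carrier G" for x
    using coset_in coset_self that unfolding pt_def graph_points_def coned_edges_def by auto
  have dist: "point_dist V E coned_weight (pt x) (pt y) = rel.wdist x y"
    if xy: "x \<in> carrier G" "y \<in> carrier G" for x y
  proof -
    obtain vs where vs: "is_walk V E vs" "hd vs = Elt x" "last vs = Elt y" using connected[OF xy] .
    have c: "x <# H \<in> cosets" "x \<in> x <# H" "y <# H \<in> cosets" "y \<in> y <# H"
      using coset_in coset_self xy by auto
    have vs0: "vs \<noteq> []" using vs(1) unfolding is_walk_def by simp
    have w1: "is_walk V E [Cone (x <# H), Elt x]" "is_walk V E [Elt y, Cone (y <# H)]"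
      using c xy by (auto simp: is_walk_def coned_vertices_def coned_edges_def)
    define us where "us = vs @ tl [Elt y, Cone (y <# H)]"
    have us: "is_walk V E us" "hd us = Elt x" "last us = Cone (y <# H)" "us \<noteq> []"
      using is_walk_glue[OF vs(1) w1(2)] vs vs0 unfolding us_def by simp_all
    have w3: "is_walk V E ([Cone (x <# H), Elt x] @ tl vs)" "is_walk V E ([Cone (x <# H), Elt x] @ tl us)"
      using is_walk_glue[OF w1(1) vs(1)] is_walk_glue[OF w1(1) us(1)] vs us by simp_all
    have l3: "last ([Cone (x <# H), Elt x] @ tl vs) = Elt y"
      "last ([Cone (x <# H), Elt x] @ tl us) = Cone (y <# H)"
      using last_glue[OF vs0, of "[Cone (x <# H), Elt x]"] last_glue[OF us(4), of "[Cone (x <# H), Elt x]"]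
        vs us by simp_all
    have 1: "rel.wdist x y - 1 / 2 \<le> vdist (Elt x) (Cone (y <# H))"
      using vdist_ge[OF us(1), of x y] c us by simp
    have 2: "rel.wdist x y - 1 / 2 \<le> vdist (Cone (x <# H)) (Elt y)"
      using vdist_ge[OF w3(1), of x y] c l3(1) by simp
    have 3: "rel.wdist x y - 1 \<le> vdist (Cone (x <# H)) (Cone (y <# H))"
      using vdist_ge[OF w3(2), of x y] c l3(2) by simp
    have same: "rel.wdist x y = 0" if "y = x" using that xy by simp
    show ?thesis
      unfolding point_dist_def pt_def prod.case
      by (rule Min_eqI) (use 1 2 3 same rel.wdist_nonneg[of x y] xy in \<open>auto simp: vdist_Elt split: if_splits\<close>)
  qed
  obtain \<delta> where \<delta>: "0 \<le> \<delta>" "\<And>e x y z. e \<in> graph_points E coned_weight \<Longrightarrow>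
      x \<in> graph_points E coned_weight \<Longrightarrow> y \<in> graph_points E coned_weight \<Longrightarrow>
      z \<in> graph_points E coned_weight \<Longrightarrow>
      min (gromov_product (point_dist V E coned_weight) e x y)
        (gromov_product (point_dist V E coned_weight) e y z) - \<delta>
        \<le> gromov_product (point_dist V E coned_weight) e x z"
    using hyp unfolding weakly_hyperbolic_rel_def gromov_hyperbolic_def by blast
  have "hyperbolic_group G (S \<union> H) \<delta>"
  proof unfold_locales
    show "min (gromov_product rel.wdist e x y) (gromov_product rel.wdist e y z) - \<delta>
        \<le> gromov_product rel.wdist e x z"
      if "e \<in> carrier G" "x \<in> carrier G" "y \<in> carrier G" "z \<in> carrier G" for e x y z
      using \<delta>(2)[OF pt[OF that(1)] pt[OF that(2)] pt[OF that(3)] pt[OF that(4)]] that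
      by (simp add: gromov_product_def dist)
    show "\<exists>c n. c 0 = x \<and> c n = y \<and> (\<forall>k. c k \<in> carrier G) \<and> real n = rel.wdist x y
        \<and> (\<forall>i j. i \<le> j \<and> j \<le> n \<longrightarrow> rel.wdist (c i) (c j) = real (j - i))"
      if "x \<in> carrier G" "y \<in> carrier G" for x y
      using rel.wdist_geodesic[OF that] by metis
  qed (use \<delta>(1) fin rel.wdist_nonneg rel.wdist_sym rel.wdist_triangle in auto)
  then show ?thesis using that by blast
qed

end

section \<open>Group extensions\<close>

locale extension =
  fixes K :: "('k, 'a) monoid_scheme" and i :: "'k \<Rightarrow> 'g" and G :: "('g, 'b) monoid_scheme"
    and p :: "'g \<Rightarrow> 'q" and Q :: "('q, 'c) monoid_scheme"
  assumes ext: "group_extension K i G p Q"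
begin

sublocale K: group K using ext unfolding group_extension_def by simp
sublocale G: group G using ext unfolding group_extension_def by simp
sublocale Q: group Q using ext unfolding group_extension_def by simp

lemma i_hom: "i \<in> hom K G" and i_inj: "inj_on i (carrier K)"
  and p_hom: "p \<in> hom G Q" and p_surj: "p ` carrier G = carrier Q"
  and exact: "i ` carrier K = kernel G Q p"
  using ext unfolding group_extension_def mon_def epi_def by auto

sublocale i: group_hom K G i by unfold_locales (rule i_hom)
sublocale p: group_hom G Q p by unfold_locales (rule p_hom)

lemma p_i [simp]: "k \<in> carrier K \<Longrightarrow> p (i k) = \<one>\<^bsub>Q\<^esub>"
  using exact unfolding kernel_def by blast

lemma kernel_image:
  assumes "g \<in> carrier G" "p g = \<one>\<^bsub>Q\<^esub>"
  obtains k where "k \<in> carrier K" "g = i k"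
  using exact assms unfolding kernel_def by blast

section \<open>The conjugation action of G on K\<close>

definition conj_by :: "'g \<Rightarrow> 'k \<Rightarrow> 'k" where
  "conj_by g k = inv_into (carrier K) i (g \<otimes>\<^bsub>G\<^esub> i k \<otimes>\<^bsub>G\<^esub> inv\<^bsub>G\<^esub> g)"

lemma
  assumes g: "g \<in> carrier G" and k: "k \<in> carrier K"
  shows conj_closed [simp]: "conj_by g k \<in> carrier K"
    and i_conj: "i (conj_by g k) = g \<otimes>\<^bsub>G\<^esub> i k \<otimes>\<^bsub>G\<^esub> inv\<^bsub>G\<^esub> g"
proof -
  have "p (g \<otimes>\<^bsub>G\<^esub> i k \<otimes>\<^bsub>G\<^esub> inv\<^bsub>G\<^esub> g) = \<one>\<^bsub>Q\<^esub>" using assms by simp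
  then obtain k' where "k' \<in> carrier K" "g \<otimes>\<^bsub>G\<^esub> i k \<otimes>\<^bsub>G\<^esub> inv\<^bsub>G\<^esub> g = i k'"
    using kernel_image[of "g \<otimes>\<^bsub>G\<^esub> i k \<otimes>\<^bsub>G\<^esub> inv\<^bsub>G\<^esub> g"] assms by auto
  then have "g \<otimes>\<^bsub>G\<^esub> i k \<otimes>\<^bsub>G\<^esub> inv\<^bsub>G\<^esub> g \<in> i ` carrier K" by simp
  from inv_into_into[OF this] f_inv_into_f[OF this]
  show "conj_by g k \<in> carrier K" "i (conj_by g k) = g \<otimes>\<^bsub>G\<^esub> i k \<otimes>\<^bsub>G\<^esub> inv\<^bsub>G\<^esub> g"
    unfolding conj_by_def .
qed

lemma i_eq_iff: "k \<in> carrier K \<Longrightarrow> k' \<in> carrier K \<Longrightarrow> i k = i k' \<longleftrightarrow> k = k'"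
  using i_inj by (meson inj_on_eq_iff)

lemma conj_mult_left:
  assumes "g \<in> carrier G" "h \<in> carrier G" "k \<in> carrier K"
  shows "conj_by (g \<otimes>\<^bsub>G\<^esub> h) k = conj_by g (conj_by h k)"
  using assms i_eq_iff[of "conj_by (g \<otimes>\<^bsub>G\<^esub> h) k" "conj_by g (conj_by h k)"]
  by (simp add: i_conj G.inv_mult_group G.m_assoc)

lemma conj_i:
  assumes "k \<in> carrier K" "x \<in> carrier K"
  shows "conj_by (i k) x = k \<otimes>\<^bsub>K\<^esub> x \<otimes>\<^bsub>K\<^esub> inv\<^bsub>K\<^esub> k"
  using assms i_eq_iff[of "conj_by (i k) x" "k \<otimes>\<^bsub>K\<^esub> x \<otimes>\<^bsub>K\<^esub> inv\<^bsub>K\<^esub> k"] by (simp add: i_conj)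

lemma conj_hom: "g \<in> carrier G \<Longrightarrow> conj_by g \<in> hom K K"
proof (rule homI)
  fix x y assume *: "g \<in> carrier G" "x \<in> carrier K" "y \<in> carrier K"
  have "g \<otimes>\<^bsub>G\<^esub> i x \<otimes>\<^bsub>G\<^esub> inv\<^bsub>G\<^esub> g \<otimes>\<^bsub>G\<^esub> (g \<otimes>\<^bsub>G\<^esub> i y \<otimes>\<^bsub>G\<^esub> inv\<^bsub>G\<^esub> g)
      = g \<otimes>\<^bsub>G\<^esub> (i x \<otimes>\<^bsub>G\<^esub> i y) \<otimes>\<^bsub>G\<^esub> inv\<^bsub>G\<^esub> g"
    using * by (simp add: G.m_assoc) (simp add: G.m_assoc[symmetric])
  then have "i (conj_by g (x \<otimes>\<^bsub>K\<^esub> y)) = i (conj_by g x \<otimes>\<^bsub>K\<^esub> conj_by g y)"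
    using * by (simp add: i_conj)
  then show "conj_by g (x \<otimes>\<^bsub>K\<^esub> y) = conj_by g x \<otimes>\<^bsub>K\<^esub> conj_by g y"
    using * i_eq_iff[of "conj_by g (x \<otimes>\<^bsub>K\<^esub> y)" "conj_by g x \<otimes>\<^bsub>K\<^esub> conj_by g y"]
    by (simp del: i.hom_mult)
qed simp

lemma conj_one: "k \<in> carrier K \<Longrightarrow> conj_by \<one>\<^bsub>G\<^esub> k = k"
  using i_eq_iff[of "conj_by \<one>\<^bsub>G\<^esub> k" k] by (simp add: i_conj)

lemma conj_iso:
  assumes g: "g \<in> carrier G"
  shows "conj_by g \<in> iso K K"
proof -
  have "bij_betw (conj_by g) (carrier K) (carrier K)"
    by (rule bij_betw_byWitness[of _ "conj_by (inv\<^bsub>G\<^esub> g)"])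
      (use g in \<open>auto simp: conj_mult_left[symmetric] conj_one\<close>)
  then show ?thesis using conj_hom[OF g] unfolding iso_def by simp
qed

text \<open>
  A coarsely \<open>G\<close>-equivariant map \<open>m\<close> to \<open>K\<close> yields a section: \<open>s q\<close> is the inverse of an element of
  the coset over \<open>q\<^sup>-\<^sup>1\<close> which \<open>m\<close> sends close to the identity.
\<close>

lemma quasi_isometric_section:
  fixes m :: "'g \<Rightarrow> 'k" and SG :: "'g set" and SQ :: "'q set"
  assumes "marked_group K SK" "finite SK"
    and SG: "finite_generating_set G SG" and SQ: "finite_generating_set Q SQ"
    and m: "\<And>g. g \<in> carrier G \<Longrightarrow> m g \<in> carrier K"
    and m_left: "\<And>k g. k \<in> carrier K \<Longrightarrow> g \<in> carrier G \<Longrightarrow>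
      word_dist K SK (m (i k \<otimes>\<^bsub>G\<^esub> g)) (k \<otimes>\<^bsub>K\<^esub> m g) \<le> C0"
    and m_conj: "\<And>t. t \<in> carrier G \<Longrightarrow>
      \<exists>C. \<forall>g\<in>carrier G. word_dist K SK (m (t \<otimes>\<^bsub>G\<^esub> g)) (conj_by t (m g)) \<le> C"
  shows "\<exists>R \<epsilon> s. R \<ge> 1 \<and> \<epsilon> \<ge> 0 \<and> s \<in> carrier Q \<rightarrow> carrier G
           \<and> (\<forall>q\<in>carrier Q. p (s q) = q)
           \<and> (\<forall>q\<in>carrier Q. \<forall>q'\<in>carrier Q.
                1 / R * word_dist Q SQ q q' - \<epsilon> \<le> word_dist G SG (s q) (s q')
                \<and> word_dist G SG (s q) (s q') \<le> R * word_dist Q SQ q q' + \<epsilon>)"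
proof -
  interpret KM: marked_group K SK by fact
  interpret GM: marked_group G SG
    using SG unfolding finite_generating_set_def by unfold_locales auto
  interpret QM: marked_group Q SQ
    using SQ unfolding finite_generating_set_def by unfold_locales auto
  have fin: "finite SG" "finite SQ" using SG SQ unfolding finite_generating_set_def by auto
  have "\<exists>g\<in>carrier G. p g = inv\<^bsub>Q\<^esub> q \<and> KM.len (m g) \<le> C0" if q: "q \<in> carrier Q" for q
  proof -
    have "inv\<^bsub>Q\<^esub> q \<in> p ` carrier G" using q p_surj by simp
    then obtain h where h: "h \<in> carrier G" "p h = inv\<^bsub>Q\<^esub> q" by auto
    have mh: "m h \<in> carrier K" using m h by blast
    \<comment> \<open>Left multiplication by the inverse of \<open>m h\<close> moves the value of
      \<open>m\<close> to within \<open>C0\<close> of the identity and does not change the image in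
      \<open>Q\<close>.\<close>
    let ?g = "i (inv\<^bsub>K\<^esub> (m h)) \<otimes>\<^bsub>G\<^esub> h"
    have "word_dist K SK (m ?g) \<one>\<^bsub>K\<^esub> \<le> C0"
      using m_left[of "inv\<^bsub>K\<^esub> (m h)" h] h mh by simp
    moreover have "m ?g \<in> carrier K" using m h mh by simp
    ultimately have "KM.len (m ?g) \<le> C0" using KM.wdist_sym[of "m ?g" "\<one>\<^bsub>K\<^esub>"] by simp
    moreover have "p ?g = inv\<^bsub>Q\<^esub> q" using h mh q p_i[of "inv\<^bsub>K\<^esub> (m h)"] by (simp del: i.hom_inv)
    ultimately show ?thesis using h mh by (intro bexI[of _ ?g]) auto
  qed
  then obtain \<sigma> where \<sigma>: "\<And>q. q \<in> carrier Q \<Longrightarrow> \<sigma> q \<in> carrier G"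
    "\<And>q. q \<in> carrier Q \<Longrightarrow> p (\<sigma> q) = inv\<^bsub>Q\<^esub> q" "\<And>q. q \<in> carrier Q \<Longrightarrow> KM.len (m (\<sigma> q)) \<le> C0"
    by metis
  define s where "s q = inv\<^bsub>G\<^esub> (\<sigma> q)" for q
  have s: "s q \<in> carrier G" "p (s q) = q" if "q \<in> carrier Q" for q
    using \<sigma> that unfolding s_def by simp_all
  have "\<exists>N::nat. \<forall>q\<in>carrier Q. GM.wdist (s q) (s (q \<otimes>\<^bsub>Q\<^esub> t)) \<le> N" if t: "t \<in> carrier Q" for t
  proof -
    obtain \<tau> where \<tau>: "\<tau> \<in> carrier G" "p \<tau> = t" using t unfolding p_surj[symmetric] by auto
    obtain C where C: "\<And>g. g \<in> carrier G \<Longrightarrow>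
        KM.wdist (m (inv\<^bsub>G\<^esub> \<tau> \<otimes>\<^bsub>G\<^esub> g)) (conj_by (inv\<^bsub>G\<^esub> \<tau>) (m g)) \<le> C"
      using m_conj[of "inv\<^bsub>G\<^esub> \<tau>"] \<tau> by auto
    define B where "B = {k \<in> carrier K. KM.len k \<le> nat \<lfloor>C0\<rfloor>}"
    have finB: "finite B" unfolding B_def by (rule KM.finite_len_ball) fact
    define L where "L = Max (insert 0 ((\<lambda>k. KM.len (conj_by (inv\<^bsub>G\<^esub> \<tau>) k)) ` B))"
    have L: "KM.len (conj_by (inv\<^bsub>G\<^esub> \<tau>) k) \<le> L" if "k \<in> B" for k
      unfolding L_def using finB that by (intro Max_ge) auto
    \<comment> \<open>For \<open>b = i k \<otimes> h\<close> as below, \<open>2 * C0\<close> bounds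
      the length of \<open>k \<otimes> m h\<close>, which is close to \<open>m b\<close>, and
      \<open>C + L\<close> bounds that of \<open>m h\<close>, which is close to the conjugate of
      \<open>m a\<close>. Together they bound \<open>k\<close>, whence the finite set.\<close>
    define B' where "B' = {k \<in> carrier K. KM.len k \<le> nat \<lfloor>C0 + C0 + C + L\<rfloor>}"
    have finB': "finite B'" unfolding B'_def by (rule KM.finite_len_ball) fact
    define N where "N = Max (insert 0 ((\<lambda>k. GM.len (\<tau> \<otimes>\<^bsub>G\<^esub> inv\<^bsub>G\<^esub> (i k))) ` B'))"
    have N: "GM.len (\<tau> \<otimes>\<^bsub>G\<^esub> inv\<^bsub>G\<^esub> (i k)) \<le> N" if "k \<in> B'" for k
      unfolding N_def using finB' that by (intro Max_ge) auto
    have "GM.wdist (s q) (s (q \<otimes>\<^bsub>Q\<^esub> t)) \<le> N" if q: "q \<in> carrier Q" for q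
    proof -
      define a where "a = \<sigma> q"
      define b where "b = \<sigma> (q \<otimes>\<^bsub>Q\<^esub> t)"
      have a: "a \<in> carrier G" "p a = inv\<^bsub>Q\<^esub> q" "KM.len (m a) \<le> C0" and
        b: "b \<in> carrier G" "p b = inv\<^bsub>Q\<^esub> (q \<otimes>\<^bsub>Q\<^esub> t)" "KM.len (m b) \<le> C0"
        using \<sigma> q t unfolding a_def b_def by auto
      define h where "h = inv\<^bsub>G\<^esub> \<tau> \<otimes>\<^bsub>G\<^esub> a"
      have h: "h \<in> carrier G" unfolding h_def using \<tau> a by simp
      have "p (b \<otimes>\<^bsub>G\<^esub> inv\<^bsub>G\<^esub> h) = \<one>\<^bsub>Q\<^esub>"
        unfolding h_def using a b \<tau> q t
        by (simp add: Q.inv_mult_group Q.m_assoc) (simp add: Q.m_assoc[symmetric])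
      then obtain k where k: "k \<in> carrier K" "b \<otimes>\<^bsub>G\<^esub> inv\<^bsub>G\<^esub> h = i k"
        using kernel_image[of "b \<otimes>\<^bsub>G\<^esub> inv\<^bsub>G\<^esub> h"] b h by auto
      have bk: "b = i k \<otimes>\<^bsub>G\<^esub> h" unfolding k(2)[symmetric] using b h by (simp add: G.m_assoc)
      have mc: "m a \<in> carrier K" "m b \<in> carrier K" "m h \<in> carrier K" using m a b h by auto
      have "m a \<in> B" unfolding B_def using a mc by simp linarith
      then have 1: "KM.wdist \<one>\<^bsub>K\<^esub> (conj_by (inv\<^bsub>G\<^esub> \<tau>) (m a)) \<le> L" using L mc \<tau> by simp
      have cc: "conj_by (inv\<^bsub>G\<^esub> \<tau>) (m a) \<in> carrier K" using mc \<tau> by simp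
      have 2: "KM.wdist (m h) (conj_by (inv\<^bsub>G\<^esub> \<tau>) (m a)) \<le> C" unfolding h_def using C a by simp
      have 3: "KM.wdist (m b) (k \<otimes>\<^bsub>K\<^esub> m h) \<le> C0" unfolding bk using m_left k h by simp
      have "KM.wdist k (k \<otimes>\<^bsub>K\<^esub> m h) \<le> L + C"
        using KM.wdist_triangle[OF K.one_closed cc mc(3)] KM.wdist_sym[OF mc(3) cc] 1 2 k mc by simp
      moreover have "KM.wdist \<one>\<^bsub>K\<^esub> (k \<otimes>\<^bsub>K\<^esub> m h) \<le> C0 + C0"
        using KM.wdist_triangle[OF K.one_closed mc(2), of "k \<otimes>\<^bsub>K\<^esub> m h"] 3 b k mc by simp
      ultimately have "KM.wdist \<one>\<^bsub>K\<^esub> k \<le> C0 + C0 + C + L"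
        using KM.wdist_triangle[OF K.one_closed _ k(1), of "k \<otimes>\<^bsub>K\<^esub> m h"]
          KM.wdist_sym[of k "k \<otimes>\<^bsub>K\<^esub> m h"] k mc by simp
      then have "k \<in> B'" unfolding B'_def using k by simp linarith
      moreover have "inv\<^bsub>G\<^esub> (s q) \<otimes>\<^bsub>G\<^esub> s (q \<otimes>\<^bsub>Q\<^esub> t) = \<tau> \<otimes>\<^bsub>G\<^esub> inv\<^bsub>G\<^esub> (i k)"
      proof -
        have "inv\<^bsub>G\<^esub> (s q) \<otimes>\<^bsub>G\<^esub> s (q \<otimes>\<^bsub>Q\<^esub> t) = a \<otimes>\<^bsub>G\<^esub> inv\<^bsub>G\<^esub> b"
          unfolding s_def a_def[symmetric] b_def[symmetric] using a by simp
        also have "\<dots> = a \<otimes>\<^bsub>G\<^esub> (inv\<^bsub>G\<^esub> a \<otimes>\<^bsub>G\<^esub> \<tau> \<otimes>\<^bsub>G\<^esub> inv\<^bsub>G\<^esub> (i k))"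
          unfolding bk h_def using a \<tau> k by (simp add: G.inv_mult_group del: i.hom_inv)
        also have "\<dots> = \<tau> \<otimes>\<^bsub>G\<^esub> inv\<^bsub>G\<^esub> (i k)"
          using a \<tau> k by (simp add: G.m_assoc[symmetric] del: i.hom_inv)
        finally show ?thesis .
      qed
      ultimately show ?thesis using N unfolding word_dist_def by simp
    qed
    then show ?thesis by blast
  qed
  then obtain N :: "'q \<Rightarrow> nat" where N: "\<And>t q. t \<in> carrier Q \<Longrightarrow> q \<in> carrier Q \<Longrightarrow>
      GM.wdist (s q) (s (q \<otimes>\<^bsub>Q\<^esub> t)) \<le> N t"
    by metis
  define R0 where "R0 = Max (insert 0 (N ` QM.letters))"
  have R0: "N t \<le> R0" if "t \<in> QM.letters" for t
    unfolding R0_def using fin that by (intro Max_ge) auto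
  have upper: "GM.wdist (s q) (s (q \<otimes>\<^bsub>Q\<^esub> QM.word_prod ws)) \<le> real R0 * length ws"
    if "q \<in> carrier Q" "set ws \<subseteq> QM.letters" for q ws
    using that
  proof (induction ws arbitrary: q)
    case Nil
    then show ?case using s by simp
  next
    case (Cons t ws)
    have t: "t \<in> carrier Q" "t \<in> QM.letters" "QM.word_prod ws \<in> carrier Q"
      using Cons.prems QM.letters_carrier QM.word_prod_closed by auto
    have eq: "q \<otimes>\<^bsub>Q\<^esub> QM.word_prod (t # ws) = q \<otimes>\<^bsub>Q\<^esub> t \<otimes>\<^bsub>Q\<^esub> QM.word_prod ws"
      using Cons.prems t by (simp add: Q.m_assoc)
    have "GM.wdist (s q) (s (q \<otimes>\<^bsub>Q\<^esub> QM.word_prod (t # ws)))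
        \<le> GM.wdist (s q) (s (q \<otimes>\<^bsub>Q\<^esub> t)) + GM.wdist (s (q \<otimes>\<^bsub>Q\<^esub> t)) (s (q \<otimes>\<^bsub>Q\<^esub> QM.word_prod (t # ws)))"
      unfolding eq using Cons.prems t s by (intro GM.wdist_triangle) simp_all
    moreover have "GM.wdist (s q) (s (q \<otimes>\<^bsub>Q\<^esub> t)) \<le> R0"
      using N[of t q] R0[of t] Cons.prems t by (meson of_nat_mono order_trans)
    moreover have "GM.wdist (s (q \<otimes>\<^bsub>Q\<^esub> t)) (s (q \<otimes>\<^bsub>Q\<^esub> QM.word_prod (t # ws))) \<le> real R0 * length ws"
      unfolding eq using Cons t by simp
    ultimately show ?case by (simp add: algebra_simps)
  qed
  define R1 where "R1 = Max (insert 0 (QM.len ` p ` SG))"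
  have "QM.len (p x) \<le> R1" if "x \<in> SG" for x
    unfolding R1_def using fin that by (intro Max_ge) auto
  then have R1: "QM.len (p g) \<le> R1 * GM.len g" if "g \<in> carrier G" for g
    using GM.len_hom_le[OF QM.marked_group_axioms p_hom] that by blast
  \<comment> \<open>\<open>R1\<close> is a Lipschitz constant of \<open>p\<close> and gives the
    lower bound, \<open>R0\<close> bounds the jump of \<open>s\<close> along a generator of
    \<open>Q\<close>, and the 1 ensures \<open>1 \<le> R\<close>. Jumps add up along a word without
    further loss, so \<epsilon> can be 0.\<close>
  define R where "R = real (R0 + R1 + 1)"
  have "1 / R * QM.wdist q q' - 0 \<le> GM.wdist (s q) (s q')
      \<and> GM.wdist (s q) (s q') \<le> R * QM.wdist q q' + 0"
    if q: "q \<in> carrier Q" "q' \<in> carrier Q" for q q'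
  proof
    have "QM.len (p (inv\<^bsub>G\<^esub> (s q) \<otimes>\<^bsub>G\<^esub> s q')) \<le> R1 * GM.len (inv\<^bsub>G\<^esub> (s q) \<otimes>\<^bsub>G\<^esub> s q')"
      by (rule R1) (use s q in simp)
    moreover have "p (inv\<^bsub>G\<^esub> (s q) \<otimes>\<^bsub>G\<^esub> s q') = inv\<^bsub>Q\<^esub> q \<otimes>\<^bsub>Q\<^esub> q'" using s q by simp
    ultimately have "QM.wdist q q' \<le> real R1 * GM.wdist (s q) (s q')"
      unfolding word_dist_def by (metis of_nat_le_iff of_nat_mult)
    also have "\<dots> \<le> R * GM.wdist (s q) (s q')"
      unfolding R_def using GM.wdist_nonneg by (intro mult_right_mono) auto
    finally show "1 / R * QM.wdist q q' - 0 \<le> GM.wdist (s q) (s q')"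
      unfolding R_def by (simp add: field_simps)
    obtain ws where ws: "length ws = QM.len (inv\<^bsub>Q\<^esub> q \<otimes>\<^bsub>Q\<^esub> q')" "set ws \<subseteq> QM.letters"
      "QM.word_prod ws = inv\<^bsub>Q\<^esub> q \<otimes>\<^bsub>Q\<^esub> q'"
      using QM.len_word[of "inv\<^bsub>Q\<^esub> q \<otimes>\<^bsub>Q\<^esub> q'"] q by blast
    have "q \<otimes>\<^bsub>Q\<^esub> QM.word_prod ws = q'" unfolding ws(3) using q by (simp add: Q.m_assoc[symmetric])
    then have "GM.wdist (s q) (s q') \<le> real R0 * QM.wdist q q'"
      using upper[OF q(1) ws(2)] ws(1) by (simp add: word_dist_def)
    also have "\<dots> \<le> R * QM.wdist q q'"
      unfolding R_def using QM.wdist_nonneg by (intro mult_right_mono) auto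
    finally show "GM.wdist (s q) (s q') \<le> R * QM.wdist q q' + 0" by simp
  qed
  moreover have "1 \<le> R" unfolding R_def by simp
  ultimately show ?thesis using s by (intro exI[of _ R] exI[of _ "0::real"] exI[of _ s]) auto
qed

text \<open>The value at \<open>g\<close> is a center of the ideal triple moved by \<open>g\<close>.
  Conjugation by \<open>t\<close> changes the constant of a center by an amount depending on
  \<open>t\<close>, whereas left multiplication by \<open>k\<close> changes it by
  \<open>2 * \<delta>\<close> only; uniqueness of centers turns both into distances.\<close>

lemma hyperbolic_equivariant_map:
  assumes "hyperbolic_group K S \<delta>" "\<not> virtually_cyclic K"
  obtains m C0 where "\<And>g. g \<in> carrier G \<Longrightarrow> m g \<in> carrier K"
    "\<And>k g. k \<in> carrier K \<Longrightarrow> g \<in> carrier G \<Longrightarrow>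
      word_dist K S (m (i k \<otimes>\<^bsub>G\<^esub> g)) (k \<otimes>\<^bsub>K\<^esub> m g) \<le> C0"
    "\<And>t. t \<in> carrier G \<Longrightarrow>
      \<exists>C. \<forall>g\<in>carrier G. word_dist K S (m (t \<otimes>\<^bsub>G\<^esub> g)) (conj_by t (m g)) \<le> C"
proof -
  interpret H: hyperbolic_group K S \<delta> by fact
  obtain C x y z where C: "0 \<le> C" and
    seq: "H.gromov_seq x" "H.gromov_seq y" "H.gromov_seq z" and
    lim: "H.limit_center C \<one>\<^bsub>K\<^esub> x y z"
    using H.ideal_triple_exists[OF assms(2)] .
  note xc = seq[THEN H.gromov_seq_carrier]
  define E where "E = 1 + 3 * \<delta>"
  have E0: "0 \<le> E" unfolding E_def using H.delta_nonneg by simp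
  let ?lim = "\<lambda>C m g. H.limit_center C m (\<lambda>n. conj_by g (x n)) (\<lambda>n. conj_by g (y n)) (\<lambda>n. conj_by g (z n))"
  have image: "\<exists>D. \<forall>m\<in>carrier K. \<forall>g\<in>carrier G. ?lim C m g \<longrightarrow> ?lim D (conj_by t m) (t \<otimes>\<^bsub>G\<^esub> g)"
    if t: "t \<in> carrier G" and C: "0 \<le> C" for t C
  proof -
    obtain D where D: "\<And>m x y z. m \<in> carrier K \<Longrightarrow> x \<in> carrier K \<Longrightarrow> y \<in> carrier K \<Longrightarrow>
        z \<in> carrier K \<Longrightarrow> H.center C m x y z \<Longrightarrow> H.center D (conj_by t m) (conj_by t x) (conj_by t y) (conj_by t z)"
      using H.iso_center[OF conj_iso[OF t] C] by blast
    have "?lim D (conj_by t m) (t \<otimes>\<^bsub>G\<^esub> g)" if m: "m \<in> carrier K" "g \<in> carrier G" "?lim C m g" for m g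
    proof -
      obtain N where "\<And>n. N \<le> n \<Longrightarrow> H.center C m (conj_by g (x n)) (conj_by g (y n)) (conj_by g (z n))"
        using m unfolding H.limit_center_def by blast
      then show ?thesis
        unfolding H.limit_center_def using D m t xc by (intro exI[of _ N]) (simp add: conj_mult_left)
    qed
    then show ?thesis by blast
  qed
  have gseq: "H.gromov_seq (\<lambda>n. conj_by g (x n))" "H.gromov_seq (\<lambda>n. conj_by g (y n))"
    "H.gromov_seq (\<lambda>n. conj_by g (z n))" if "g \<in> carrier G" for g
    using seq H.gromov_seq_iso[OF conj_iso[OF that]] by auto
  have "\<exists>m\<in>carrier K. ?lim E m g" if g: "g \<in> carrier G" for g
  proof -
    \<comment> \<open>The identity is fixed by conjugation, so it is a center of every moved triple,
      with a constant depending on \<open>g\<close>; \<open>limit_center_exists\<close> then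
      supplies one with the uniform constant \<open>E\<close>.\<close>
    have "?lim C \<one>\<^bsub>K\<^esub> \<one>\<^bsub>G\<^esub>" using lim xc by (simp add: conj_one)
    then obtain D where "?lim D (conj_by g \<one>\<^bsub>K\<^esub>) (g \<otimes>\<^bsub>G\<^esub> \<one>\<^bsub>G\<^esub>)"
      using image[OF g C] by blast
    moreover have "conj_by g \<one>\<^bsub>K\<^esub> = \<one>\<^bsub>K\<^esub>"
      using hom_one[OF conj_hom[OF g]] K.is_group by blast
    ultimately have "?lim D \<one>\<^bsub>K\<^esub> g" using g by simp
    then show ?thesis using H.limit_center_exists[OF gseq[OF g]] unfolding E_def by blast
  qed
  then obtain m where m: "\<And>g. g \<in> carrier G \<Longrightarrow> m g \<in> carrier K" "\<And>g. g \<in> carrier G \<Longrightarrow> ?lim E (m g) g"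
    by metis
  show ?thesis
  proof (rule that[of m "E + (E + 2 * \<delta>) + 2 * \<delta>"])
    fix k g assume k: "k \<in> carrier K" and g: "g \<in> carrier G"
    have left: "H.gromov_seq (\<lambda>n. k \<otimes>\<^bsub>K\<^esub> w n)" if "H.gromov_seq w" for w
      unfolding H.gromov_seq_def
    proof (intro conjI allI)
      show "range (\<lambda>n. k \<otimes>\<^bsub>K\<^esub> w n) \<subseteq> carrier K" using k H.gromov_seq_carrier[OF that] by auto
      fix R
      have "H.gp \<one>\<^bsub>K\<^esub> (k \<otimes>\<^bsub>K\<^esub> w n) (k \<otimes>\<^bsub>K\<^esub> w n') = H.gp (inv\<^bsub>K\<^esub> k) (w n) (w n')" for n n'
        using H.gp_left[of k "inv\<^bsub>K\<^esub> k" "w n" "w n'"] k H.gromov_seq_carrier[OF that] by simp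
      then show "\<exists>N. \<forall>n\<ge>N. \<forall>n'\<ge>N. R \<le> H.gp \<one>\<^bsub>K\<^esub> (k \<otimes>\<^bsub>K\<^esub> w n) (k \<otimes>\<^bsub>K\<^esub> w n')"
        using H.gromov_seq_gp_base[OF that, of "inv\<^bsub>K\<^esub> k" R] k by simp
    qed
    have kg: "i k \<otimes>\<^bsub>G\<^esub> g \<in> carrier G" using k g by simp
    obtain N where N: "\<And>n. N \<le> n \<Longrightarrow> H.center E (m g) (conj_by g (x n)) (conj_by g (y n)) (conj_by g (z n))"
      using m(2)[OF g] unfolding H.limit_center_def by blast
    have "H.limit_center E (k \<otimes>\<^bsub>K\<^esub> m g) (\<lambda>n. k \<otimes>\<^bsub>K\<^esub> conj_by g (x n)) (\<lambda>n. k \<otimes>\<^bsub>K\<^esub> conj_by g (y n))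
        (\<lambda>n. k \<otimes>\<^bsub>K\<^esub> conj_by g (z n))"
      unfolding H.limit_center_def
      using N k g m xc by (intro exI[of _ N]) (simp add: H.center_left)
    \<comment> \<open>The right factor \<open>inv k\<close> displaces the sequences by
      \<open>len k\<close>, which is unbounded in \<open>k\<close>, but the constant in
      \<open>limit_center_perturb\<close> ignores the size of the displacement.\<close>
    moreover have "H.wdist (k \<otimes>\<^bsub>K\<^esub> conj_by g w) (conj_by (i k \<otimes>\<^bsub>G\<^esub> g) w) \<le> H.len k" if "w \<in> carrier K" for w
      using that k g by (simp add: conj_mult_left conj_i H.len_inv)
    ultimately have "?lim (E + 2 * \<delta>) (k \<otimes>\<^bsub>K\<^esub> m g) (i k \<otimes>\<^bsub>G\<^esub> g)"
      using H.limit_center_perturb[OF left[OF gseq(1)[OF g]] gseq(1)[OF kg] _ _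
          left[OF gseq(2)[OF g]] gseq(2)[OF kg] left[OF gseq(3)[OF g]] gseq(3)[OF kg],
          of E "k \<otimes>\<^bsub>K\<^esub> m g" "H.len k"] k g m(1) xc by simp
    then show "H.wdist (m (i k \<otimes>\<^bsub>G\<^esub> g)) (k \<otimes>\<^bsub>K\<^esub> m g) \<le> E + (E + 2 * \<delta>) + 2 * \<delta>"
      using H.limit_center_unique[OF gseq[OF kg] m(1)[OF kg] _ m(2)[OF kg],
          of "k \<otimes>\<^bsub>K\<^esub> m g" "E + 2 * \<delta>"] m(1) k g by simp
  next
    fix t assume t: "t \<in> carrier G"
    obtain D where D: "\<And>m g. m \<in> carrier K \<Longrightarrow> g \<in> carrier G \<Longrightarrow> ?lim E m g \<Longrightarrow>
        ?lim D (conj_by t m) (t \<otimes>\<^bsub>G\<^esub> g)"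
      using image[OF t E0] by blast
    have "H.wdist (m (t \<otimes>\<^bsub>G\<^esub> g)) (conj_by t (m g)) \<le> E + D + 2 * \<delta>" if g: "g \<in> carrier G" for g
    proof -
      have tg: "t \<otimes>\<^bsub>G\<^esub> g \<in> carrier G" using t g by simp
      show ?thesis
        using H.limit_center_unique[OF gseq[OF tg] m(1)[OF tg] _ m(2)[OF tg] D] m g t by simp
    qed
    then show "\<exists>C. \<forall>g\<in>carrier G. H.wdist (m (t \<otimes>\<^bsub>G\<^esub> g)) (conj_by t (m g)) \<le> C" by blast
  qed (rule m)
qed

lemma conj_inj: "g \<in> carrier G \<Longrightarrow> inj_on (conj_by g) (carrier K)"
  using conj_iso unfolding iso_def bij_betw_def by auto

text \<open>Write \<open>g\<close> as \<open>i (\<kappa> g) \<otimes> \<nu> g\<close> with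
  \<open>\<nu> g\<close> preserving \<open>K1\<close>. Then \<open>\<nu> g\<close> moves the fixed
  coset to \<open>B (\<nu> g)\<close>, and \<open>m g\<close> is an exit point towards it translated
  by \<open>\<kappa> g\<close>. What has to be seen is that another decomposition changes this only
  boundedly.\<close>

lemma penetration_equivariant_map:
  assumes "coned_off K S K1" and S: "finite S" and bcp: "bounded_coset_penetration K S K1"
    and inf: "infinite K1" and proper: "K1 \<subset> carrier K" and cusps: "preserves_cusps K K1 i G"
  obtains m C0 where "\<And>g. g \<in> carrier G \<Longrightarrow> m g \<in> carrier K"
    "\<And>k g. k \<in> carrier K \<Longrightarrow> g \<in> carrier G \<Longrightarrow>
      word_dist K S (m (i k \<otimes>\<^bsub>G\<^esub> g)) (k \<otimes>\<^bsub>K\<^esub> m g) \<le> C0"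
    "\<And>t. t \<in> carrier G \<Longrightarrow>
      \<exists>C. \<forall>g\<in>carrier G. word_dist K S (m (t \<otimes>\<^bsub>G\<^esub> g)) (conj_by t (m g)) \<le> C"
proof -
  interpret C: coned_off K S K1 by fact
  have K1c: "x \<in> K1 \<Longrightarrow> x \<in> carrier K" for x using proper by blast
  have K1coset: "K1 \<in> C.cosets"
    using C.coset_in[OF K.one_closed] K.lcos_mult_one[of K1] proper by auto
  \<comment> \<open>The elements whose conjugation preserves \<open>K1\<close>. Cusp preservation
    says that \<open>i K\<close> and these elements together fill \<open>G\<close>.\<close>
  define N where "N n \<longleftrightarrow> n \<in> carrier G \<and> conj_by n ` K1 = K1" for n
  have Nc: "n \<in> carrier G" if "N n" for n using that unfolding N_def by simp
  have image_mult: "conj_by (g \<otimes>\<^bsub>G\<^esub> h) ` Z = conj_by g ` conj_by h ` Z"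
    if "g \<in> carrier G" "h \<in> carrier G" "Z \<subseteq> carrier K" for g h Z
    using that by (force simp: conj_mult_left image_image)
  have N_mult: "N (n \<otimes>\<^bsub>G\<^esub> n')" if "N n" "N n'" for n n'
    using that image_mult[of n n' K1] proper unfolding N_def by auto
  have decompose: "\<exists>k n. k \<in> carrier K \<and> N n \<and> g = i k \<otimes>\<^bsub>G\<^esub> n" if g: "g \<in> carrier G" for g
  proof -
    have image_i: "i ` conj_by g ` K1 = conjugate_subset G g (i ` K1)" if "g \<in> carrier G" for g
      using i_conj[OF that K1c] unfolding conjugate_subset_def image_image by (rule image_cong[OF refl])
    obtain k where k: "k \<in> carrier K" "conjugate_subset G g (i ` K1) = conjugate_subset G (i k) (i ` K1)"
      using cusps g unfolding preserves_cusps_def by blast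
    have ik: "i k \<in> carrier G" using k by simp
    have sub: "conj_by h ` K1 \<subseteq> carrier K" if "h \<in> carrier G" for h using that K1c by auto
    have eq: "conj_by g ` K1 = conj_by (i k) ` K1"
      using inj_on_image_eq_iff[OF i_inj sub[OF g] sub[OF ik]] image_i[OF g] image_i[OF ik] k(2) by simp
    define n where "n = inv\<^bsub>G\<^esub> (i k) \<otimes>\<^bsub>G\<^esub> g"
    have "conj_by n ` K1 = conj_by (inv\<^bsub>G\<^esub> (i k)) ` conj_by (i k) ` K1"
      unfolding n_def eq[symmetric] using image_mult[of "inv\<^bsub>G\<^esub> (i k)" g K1] ik g proper
      by (simp add: less_imp_le del: i.hom_inv)
    also have "\<dots> = conj_by \<one>\<^bsub>G\<^esub> ` K1"
      using image_mult[of "inv\<^bsub>G\<^esub> (i k)" "i k" K1] ik proper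
      by (simp add: less_imp_le del: i.hom_inv)
    also have "\<dots> = K1" using K1c by (simp add: conj_one)
    finally have "N n" unfolding N_def n_def using ik g by simp
    moreover have "g = i k \<otimes>\<^bsub>G\<^esub> n" unfolding n_def using ik g by (simp add: G.m_assoc[symmetric])
    ultimately show ?thesis using k by blast
  qed
  then obtain \<kappa> \<nu> where \<kappa>: "\<And>g. g \<in> carrier G \<Longrightarrow> \<kappa> g \<in> carrier K"
    and \<nu>: "\<And>g. g \<in> carrier G \<Longrightarrow> N (\<nu> g)"
    and split: "\<And>g. g \<in> carrier G \<Longrightarrow> g = i (\<kappa> g) \<otimes>\<^bsub>G\<^esub> \<nu> g"
    by metis
  \<comment> \<open>Two decompositions of one element differ by an element of \<open>K\<close> that
    normalizes \<open>K1\<close>; self-normalization puts it into \<open>K1\<close>.\<close>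
  have in_K1: "h \<in> K1" if h: "h \<in> carrier K" "N n" "N (i h \<otimes>\<^bsub>G\<^esub> n)" for h n
  proof -
    have "conj_by (i h) ` K1 = K1"
      using image_mult[of "i h" n K1] h proper unfolding N_def by auto
    then have "h \<otimes>\<^bsub>K\<^esub> x \<otimes>\<^bsub>K\<^esub> inv\<^bsub>K\<^esub> h \<in> K1" if "x \<in> K1" for x
      using that conj_i[OF h(1) K1c[OF that]] by force
    then have "inv\<^bsub>K\<^esub> h \<in> K1"
      using C.self_normalizing[OF bcp S inf, of "inv\<^bsub>K\<^esub> h"] h(1) by simp
    then show ?thesis using subgroup.m_inv_closed[OF C.H] h(1) by force
  qed
  obtain b where b: "b \<in> carrier K" "b \<notin> K1" using proper by blast
  define B0 where "B0 = b <#\<^bsub>K\<^esub> K1"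
  define B where "B n = conj_by n ` B0" for n
  have B0: "B0 \<in> C.cosets" "B0 \<noteq> K1" "B0 \<subseteq> carrier K"
    using C.coset_in C.coset_self C.coset_carrier b unfolding B0_def by blast+
  have B: "B n = conj_by n b <#\<^bsub>K\<^esub> K1" "B n \<in> C.cosets" "K1 \<noteq> B n" if n: "N n" for n
  proof -
    show eq: "B n = conj_by n b <#\<^bsub>K\<^esub> K1"
      unfolding B_def B0_def using C.image_coset[OF conj_hom _ b(1)] n unfolding N_def by blast
    then show "B n \<in> C.cosets" using C.coset_in b n unfolding N_def by simp
    have "conj_by n ` B0 \<noteq> conj_by n ` K1"
      using inj_on_image_eq_iff[OF conj_inj B0(3), of n K1] B0(2) n proper unfolding N_def by blast
    then show "K1 \<noteq> B n" using n unfolding B_def N_def by auto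
  qed
  define e where "e n = (SOME x. x \<in> C.exits K1 (B n))" for n
  have e: "e n \<in> C.exits K1 (B n)" if "N n" for n
    unfolding e_def by (rule C.exits_nonempty[OF K1coset B(2)[OF that]]) (rule someI)
  have exits_c: "x \<in> carrier K" if "x \<in> C.exits K1 Y" for x Y
    using that K1c unfolding C.exits_def by blast
  obtain D where D: "\<And>A B x x'. A \<in> C.cosets \<Longrightarrow> B \<in> C.cosets \<Longrightarrow> A \<noteq> B \<Longrightarrow>
    x \<in> C.exits A B \<Longrightarrow> x' \<in> C.exits A B \<Longrightarrow> C.wdist x x' \<le> D"
    using C.exits_bounded[OF bcp] by blast
  define m where "m g = \<kappa> g \<otimes>\<^bsub>K\<^esub> e (\<nu> g)" for g
  have mc: "m g \<in> carrier K" if "g \<in> carrier G" for g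
    unfolding m_def using \<kappa> \<nu> e exits_c that by blast
  \<comment> \<open>Up to the error \<open>D\<close>, the value of \<open>m\<close> can be read off
    from any decomposition and any exit point, not only from the chosen ones.\<close>
  have near: "C.wdist (m (i k \<otimes>\<^bsub>G\<^esub> n)) (k \<otimes>\<^bsub>K\<^esub> x) \<le> D"
    if k: "k \<in> carrier K" and n: "N n" and x: "x \<in> C.exits K1 (B n)" for k n x
  proof -
    define g where "g = i k \<otimes>\<^bsub>G\<^esub> n"
    have g: "g \<in> carrier G" unfolding g_def using k Nc[OF n] by simp
    define h where "h = inv\<^bsub>K\<^esub> (\<kappa> g) \<otimes>\<^bsub>K\<^esub> k"
    have h: "h \<in> carrier K" unfolding h_def using k \<kappa> g by simp
    have \<nu>g: "\<nu> g \<in> carrier G" "\<kappa> g \<in> carrier K" using \<nu> \<kappa> g Nc by auto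
    have "i h = inv\<^bsub>G\<^esub> (i (\<kappa> g)) \<otimes>\<^bsub>G\<^esub> i k" unfolding h_def using k \<nu>g by simp
    then have "i h \<otimes>\<^bsub>G\<^esub> n = inv\<^bsub>G\<^esub> (i (\<kappa> g)) \<otimes>\<^bsub>G\<^esub> (i k \<otimes>\<^bsub>G\<^esub> n)"
      using k \<nu>g Nc[OF n] by (simp add: G.m_assoc del: i.hom_inv)
    also have "i k \<otimes>\<^bsub>G\<^esub> n = g" unfolding g_def ..
    also have "inv\<^bsub>G\<^esub> (i (\<kappa> g)) \<otimes>\<^bsub>G\<^esub> g = inv\<^bsub>G\<^esub> (i (\<kappa> g)) \<otimes>\<^bsub>G\<^esub> (i (\<kappa> g) \<otimes>\<^bsub>G\<^esub> \<nu> g)"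
      using split[OF g] by (rule arg_cong)
    also have "\<dots> = \<nu> g" using \<nu>g by (simp add: G.m_assoc[symmetric] del: i.hom_inv)
    finally have hn: "i h \<otimes>\<^bsub>G\<^esub> n = \<nu> g" .
    then have hK1: "h \<in> K1" using in_K1[OF h n] \<nu>[OF g] by simp
    have hinv: "inv\<^bsub>K\<^esub> h \<in> K1" using subgroup.m_inv_closed[OF C.H hK1] .
    define c where "c = conj_by n b"
    have c: "c \<in> carrier K" unfolding c_def using n b Nc by simp
    have "B (\<nu> g) = (h \<otimes>\<^bsub>K\<^esub> c \<otimes>\<^bsub>K\<^esub> inv\<^bsub>K\<^esub> h) <#\<^bsub>K\<^esub> K1"
      using B(1)[OF \<nu>[OF g]] conj_mult_left[of "i h" n b] conj_i[OF h c] h b Nc[OF n]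
      unfolding hn[symmetric] c_def by simp
    \<comment> \<open>The right factor \<open>inv h\<close> lies in \<open>K1\<close> and is
      absorbed by the coset; conjugation by \<open>i h\<close> thus acts on these cosets as left
      translation by \<open>h\<close>.\<close>
    also have "\<dots> = (h \<otimes>\<^bsub>K\<^esub> c) <#\<^bsub>K\<^esub> K1"
    proof -
      have "h \<otimes>\<^bsub>K\<^esub> c \<otimes>\<^bsub>K\<^esub> inv\<^bsub>K\<^esub> h \<in> (h \<otimes>\<^bsub>K\<^esub> c) <#\<^bsub>K\<^esub> K1"
        using hinv unfolding l_coset_def by blast
      then show ?thesis using C.coset_eq[OF C.coset_in] h c by (metis K.m_closed)
    qed
    also have "\<dots> = h <#\<^bsub>K\<^esub> B n"
      using B(1)[OF n] K.lcos_m_assoc[OF _ h c, of K1] proper unfolding c_def by auto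
    finally have "h <#\<^bsub>K\<^esub> B n = B (\<nu> g)" by simp
    moreover have "h <#\<^bsub>K\<^esub> K1 = K1" using K.coset_join3[OF h C.H hK1] .
    ultimately have "h \<otimes>\<^bsub>K\<^esub> x \<in> C.exits K1 (B (\<nu> g))"
      using C.exits_left[OF h K1coset B(2)[OF n] x] by simp
    then have "C.wdist (e (\<nu> g)) (h \<otimes>\<^bsub>K\<^esub> x) \<le> D"
      using D[OF K1coset B(2,3)[OF \<nu>[OF g]] e[OF \<nu>[OF g]]] by blast
    moreover have "e (\<nu> g) \<in> carrier K" "x \<in> carrier K" using e[OF \<nu>[OF g]] x exits_c by auto
    moreover have "\<kappa> g \<otimes>\<^bsub>K\<^esub> (h \<otimes>\<^bsub>K\<^esub> x) = k \<otimes>\<^bsub>K\<^esub> x"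
      unfolding h_def using k \<nu>g exits_c[OF x] by (simp add: K.m_assoc[symmetric])
    ultimately show ?thesis
      using C.wdist_left[of "\<kappa> g" "e (\<nu> g)" "h \<otimes>\<^bsub>K\<^esub> x"] h \<nu>g unfolding m_def g_def[symmetric] by simp
  qed
  show ?thesis
  proof (rule that[of m D])
    fix k g assume k: "k \<in> carrier K" and g: "g \<in> carrier G"
    have "i k \<otimes>\<^bsub>G\<^esub> g = i k \<otimes>\<^bsub>G\<^esub> (i (\<kappa> g) \<otimes>\<^bsub>G\<^esub> \<nu> g)" using split[OF g] by simp
    also have "\<dots> = i (k \<otimes>\<^bsub>K\<^esub> \<kappa> g) \<otimes>\<^bsub>G\<^esub> \<nu> g"
      using k \<kappa>[OF g] Nc[OF \<nu>[OF g]] by (simp add: G.m_assoc)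
    finally have kg: "i k \<otimes>\<^bsub>G\<^esub> g = i (k \<otimes>\<^bsub>K\<^esub> \<kappa> g) \<otimes>\<^bsub>G\<^esub> \<nu> g" .
    have "C.wdist (m (i k \<otimes>\<^bsub>G\<^esub> g)) (k \<otimes>\<^bsub>K\<^esub> \<kappa> g \<otimes>\<^bsub>K\<^esub> e (\<nu> g)) \<le> D"
      unfolding kg by (rule near) (use k \<kappa>[OF g] \<nu>[OF g] e in auto)
    then show "C.wdist (m (i k \<otimes>\<^bsub>G\<^esub> g)) (k \<otimes>\<^bsub>K\<^esub> m g) \<le> D"
      unfolding m_def[of g] using k \<kappa>[OF g] exits_c[OF e[OF \<nu>[OF g]]] by (simp add: K.m_assoc)
  next
    fix t assume t: "t \<in> carrier G"
    define a where "a = \<kappa> t"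
    define \<tau> where "\<tau> = \<nu> t"
    have a: "a \<in> carrier K" and \<tau>: "N \<tau>" "\<tau> \<in> carrier G" and t_split: "t = i a \<otimes>\<^bsub>G\<^esub> \<tau>"
      unfolding a_def \<tau>_def using \<kappa> \<nu> split Nc t by blast+
    let ?f = "conj_by \<tau>"
    have fK1: "?f ` K1 = K1" using \<tau> unfolding N_def by simp
    obtain D' where D': "\<And>A B x z. A \<in> C.cosets \<Longrightarrow> B \<in> C.cosets \<Longrightarrow> A \<noteq> B \<Longrightarrow> x \<in> C.exits A B \<Longrightarrow>
        z \<in> C.exits (?f ` A) (?f ` B) \<Longrightarrow> C.wdist (?f x) z \<le> D'"
      using C.exits_image[OF bcp S conj_iso[OF \<tau>(2)] fK1] by blast
    \<comment> \<open>\<open>D\<close> pays for the decomposition \<open>t g = i y \<tau> n\<close>,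
      \<open>D'\<close> for replacing the image of an exit point by an exit point of the image
      cosets, and \<open>C.len a\<close> for the right factor \<open>inv a\<close> that conjugation
      by \<open>i a\<close> adds to a left translation.\<close>
    have "C.wdist (m (t \<otimes>\<^bsub>G\<^esub> g)) (conj_by t (m g)) \<le> D + D' + C.len a" if g: "g \<in> carrier G" for g
    proof -
      define k where "k = \<kappa> g"
      define n where "n = \<nu> g"
      have k: "k \<in> carrier K" and n: "N n" "n \<in> carrier G" and g_split: "g = i k \<otimes>\<^bsub>G\<^esub> n"
        unfolding k_def n_def using \<kappa> \<nu> split Nc g by blast+
      have en: "e n \<in> C.exits K1 (B n)" "e n \<in> carrier K" using e[OF n(1)] exits_c by auto
      have \<tau>n: "N (\<tau> \<otimes>\<^bsub>G\<^esub> n)" using N_mult[OF \<tau>(1) n(1)] .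
      define z where "z = e (\<tau> \<otimes>\<^bsub>G\<^esub> n)"
      have z: "z \<in> C.exits K1 (B (\<tau> \<otimes>\<^bsub>G\<^esub> n))" "z \<in> carrier K"
        unfolding z_def using e[OF \<tau>n] exits_c by auto
      have "B (\<tau> \<otimes>\<^bsub>G\<^esub> n) = ?f ` B n" unfolding B_def using image_mult[OF \<tau>(2) n(2) B0(3)] .
      then have 1: "C.wdist (?f (e n)) z \<le> D'"
        using D'[OF K1coset B(2,3)[OF n(1)] en(1)] z(1) fK1 by simp
      have fc: "?f k \<in> carrier K" "?f (e n) \<in> carrier K" using k en \<tau> by auto
      define y where "y = a \<otimes>\<^bsub>K\<^esub> ?f k"
      have y: "y \<in> carrier K" unfolding y_def using a fc by simp
      have "i a \<otimes>\<^bsub>G\<^esub> \<tau> \<otimes>\<^bsub>G\<^esub> (i k \<otimes>\<^bsub>G\<^esub> n) = i y \<otimes>\<^bsub>G\<^esub> (\<tau> \<otimes>\<^bsub>G\<^esub> n)"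
      proof -
        have "i (?f k) \<otimes>\<^bsub>G\<^esub> \<tau> = \<tau> \<otimes>\<^bsub>G\<^esub> i k" using i_conj[OF \<tau>(2) k] \<tau>(2) k by (simp add: G.m_assoc)
        then have "i (?f k) \<otimes>\<^bsub>G\<^esub> (\<tau> \<otimes>\<^bsub>G\<^esub> n) = \<tau> \<otimes>\<^bsub>G\<^esub> (i k \<otimes>\<^bsub>G\<^esub> n)"
          using \<tau>(2) k n(2) fc(1) G.m_assoc by (metis i.hom_closed)
        then show ?thesis unfolding y_def using a k fc \<tau>(2) n(2) by (simp add: G.m_assoc)
      qed
      then have tg: "t \<otimes>\<^bsub>G\<^esub> g = i y \<otimes>\<^bsub>G\<^esub> (\<tau> \<otimes>\<^bsub>G\<^esub> n)" unfolding t_split g_split .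
      have 2: "C.wdist (m (t \<otimes>\<^bsub>G\<^esub> g)) (y \<otimes>\<^bsub>K\<^esub> z) \<le> D" unfolding tg by (rule near[OF y \<tau>n z(1)])
      have 3: "C.wdist (y \<otimes>\<^bsub>K\<^esub> z) (y \<otimes>\<^bsub>K\<^esub> ?f (e n)) \<le> D'"
        using C.wdist_left[OF y z(2) fc(2)] 1 C.wdist_sym[OF fc(2) z(2)] by simp
      have "m g = k \<otimes>\<^bsub>K\<^esub> e n" unfolding m_def k_def n_def by simp
      then have "conj_by t (m g) = conj_by (i a) (?f (k \<otimes>\<^bsub>K\<^esub> e n))"
        using conj_mult_left[of "i a" \<tau>] a \<tau>(2) k en(2) unfolding t_split by simp
      also have "?f (k \<otimes>\<^bsub>K\<^esub> e n) = ?f k \<otimes>\<^bsub>K\<^esub> ?f (e n)" using hom_mult[OF conj_hom[OF \<tau>(2)] k en(2)] .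
      also have "conj_by (i a) (?f k \<otimes>\<^bsub>K\<^esub> ?f (e n)) = y \<otimes>\<^bsub>K\<^esub> ?f (e n) \<otimes>\<^bsub>K\<^esub> inv\<^bsub>K\<^esub> a"
        unfolding y_def using conj_i[OF a] fc a by (simp add: K.m_assoc)
      finally have ct: "conj_by t (m g) = y \<otimes>\<^bsub>K\<^esub> ?f (e n) \<otimes>\<^bsub>K\<^esub> inv\<^bsub>K\<^esub> a" .
      have 4: "C.wdist (y \<otimes>\<^bsub>K\<^esub> ?f (e n)) (conj_by t (m g)) = C.len a"
        unfolding ct using y fc a by (simp add: C.len_inv)
      have c1: "m (t \<otimes>\<^bsub>G\<^esub> g) \<in> carrier K" using mc t g by simp
      have c2: "y \<otimes>\<^bsub>K\<^esub> z \<in> carrier K" "y \<otimes>\<^bsub>K\<^esub> ?f (e n) \<in> carrier K" "conj_by t (m g) \<in> carrier K"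
        using y z fc t mc[OF g] by auto
      show ?thesis
        using C.wdist_triangle[OF c1 c2(1,3)] C.wdist_triangle[OF c2(1,2,3)] 2 3 4 by linarith
    qed
    then show "\<exists>C. \<forall>g\<in>carrier G. C.wdist (m (t \<otimes>\<^bsub>G\<^esub> g)) (conj_by t (m g)) \<le> C" by blast
  qed (rule mc)
qed

end

theorem theorem2p10:
  fixes K :: "'k monoid" and G :: "'g monoid" and Q :: "'q monoid"
    and i :: "'k \<Rightarrow> 'g" and p :: "'g \<Rightarrow> 'q"
    and K1 :: "'k set" and SG :: "'g set" and SQ :: "'q set"
  assumes "group_extension K i G p Q"
    and "finitely_generated K"
    and "finite_generating_set G SG"
    and "finite_generating_set Q SQ"
    and "strongly_hyperbolic_rel K K1"
    and "K1 \<subset> carrier K"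
    and "non_elementary K K1"
    and "preserves_cusps K K1 i G"
  shows "\<exists>R \<epsilon> s. R \<ge> 1 \<and> \<epsilon> \<ge> 0 \<and> s \<in> carrier Q \<rightarrow> carrier G
           \<and> (\<forall>q\<in>carrier Q. p (s q) = q)
           \<and> (\<forall>q\<in>carrier Q. \<forall>q'\<in>carrier Q.
                1 / R * word_dist Q SQ q q' - \<epsilon> \<le> word_dist G SG (s q) (s q')
                \<and> word_dist G SG (s q) (s q') \<le> R * word_dist Q SQ q q' + \<epsilon>)"
proof -
  interpret extension K i G p Q by unfold_locales fact
  obtain S where S: "subgroup K1 K" "finite_generating_set K S" "weakly_hyperbolic_rel K S K1"
    "bounded_coset_penetration K S K1"
    using assms(5) unfolding strongly_hyperbolic_rel_def by blast
  interpret C: coned_off K S K1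
    by (intro coned_off.intro marked_group.intro marked_group_axioms.intro coned_off_axioms.intro)
      (use S(1,2) K.is_group in \<open>auto simp: finite_generating_set_def\<close>)
  have finS: "finite S" using S(2) unfolding finite_generating_set_def by simp
  show ?thesis
  \<comment> \<open>The section is built from a finite generating set of \<open>K\<close>:
    \<open>S \<union> K1\<close> if \<open>K1\<close> is finite, where the electric metric is meant,
    and \<open>S\<close> otherwise, where the penetration bounds are measured.\<close>
  proof (cases "finite K1")
    case True
    obtain \<delta> where \<delta>: "hyperbolic_group K (S \<union> K1) \<delta>"
      using C.weakly_hyperbolic_imp_hyperbolic_group[OF S(3) finS True] .
    have nvc: "\<not> virtually_cyclic K" using assms(7) unfolding non_elementary_def by simp
    have fin: "finite (S \<union> K1)" using finS True by simp
    show ?thesis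
    proof (rule hyperbolic_equivariant_map[OF \<delta> nvc])
      fix m C0
      assume "\<And>g. g \<in> carrier G \<Longrightarrow> m g \<in> carrier K"
        "\<And>k g. k \<in> carrier K \<Longrightarrow> g \<in> carrier G \<Longrightarrow>
          word_dist K (S \<union> K1) (m (i k \<otimes>\<^bsub>G\<^esub> g)) (k \<otimes>\<^bsub>K\<^esub> m g) \<le> C0"
        "\<And>t. t \<in> carrier G \<Longrightarrow>
          \<exists>C. \<forall>g\<in>carrier G. word_dist K (S \<union> K1) (m (t \<otimes>\<^bsub>G\<^esub> g)) (conj_by t (m g)) \<le> C"
      then show ?thesis by (rule quasi_isometric_section[OF C.rel.marked_group_axioms fin assms(3,4)])
    qed
  next
    case False
    show ?thesis
    proof (rule penetration_equivariant_map[OF C.coned_off_axioms finS S(4) False assms(6,8)])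
      fix m C0
      assume "\<And>g. g \<in> carrier G \<Longrightarrow> m g \<in> carrier K"
        "\<And>k g. k \<in> carrier K \<Longrightarrow> g \<in> carrier G \<Longrightarrow>
          word_dist K S (m (i k \<otimes>\<^bsub>G\<^esub> g)) (k \<otimes>\<^bsub>K\<^esub> m g) \<le> C0"
        "\<And>t. t \<in> carrier G \<Longrightarrow>
          \<exists>C. \<forall>g\<in>carrier G. word_dist K S (m (t \<otimes>\<^bsub>G\<^esub> g)) (conj_by t (m g)) \<le> C"
      then show ?thesis by (rule quasi_isometric_section[OF C.marked_group_axioms finS assms(3,4)])
    qed
  qed
qed

end
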